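(* Let $f:\mathbb{T}^1\to\mathbb{T}^1$ be a $C^2$ local diffeomorphism away from a non-degenerate critical set $\mathcal{C}$, which is non-uniformly expanding and whose orbits have slow recurrence to the critical set. Assume that $f$ has a dense orbit and that there are $\sigma,\delta\in(0,1)$ such that the first $(\sigma,\delta)$-hyperbolic time map $h$ is defined $\lambda$-almost everywhere and is $L^p$-integrable for some $p>3$, that is, $\int h(x)^p\,d\lambda(x)<\infty$. Then there exists a Borel measurable function $\zeta:\mathbb{T}^1\to\mathbb{R}^+=(0,\infty)$, locally constant at $\lambda$-almost every point, such that $f$ is stochastically stable under the random perturbation $(f_{\underline t},\theta_\epsilon^{\mathbb N})_{\epsilon>0}$ generated by the family $f_t(x)=f(x)+t\,\zeta(x)$.
   Context: Setting. $M=\mathbb{T}^n=(\mathbb{S}^1)^n$ (here $n=1$), $\lambda$ is normalized Lebesgue measure on $M$, $d$ the standard distance. "$C^2$ local diffeomorphism away from a non-degenerate critical set" means: $\mathcal{C}=\{x\in M:\det Df(x)=0\}$, $f$ is a $C^2$ local diffeomorphism on $M\setminus\mathcal C$, and there are constants $B>1$, $\beta>0$ such that for all $x,y\in M\setminus\mathcal C$ with $d(x,y)<\frac12 d(x,\mathcal C)$: (S1) $\frac1B d(x,\mathcal C)^\beta\le \frac{\|Df(x)v\|}{\|v\|}\le B\,d(x,\mathcal C)^{-\beta}$ for all $0\ne v\in T_xM$; (S2) $\big|\log\|Df(x)^{-1}\|-\log\|Df(y)^{-1}\|\big|\le B\frac{d(x,y)}{d(x,\mathcal C)^\beta}$; (S3)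 $\big|\log|\det Df(x)^{-1}|-\log|\det Df(y)^{-1}|\big|\le B\frac{d(x,y)}{d(x,\mathcal C)^\beta}$. Non-uniformly expanding: there is $c>0$ with $\limsup_{n\to\infty}\frac1n\sum_{j=0}^{n-1}\log\|Df(f^j(x))^{-1}\|\le -c$ for $\lambda$-a.e. $x$. Slow recurrence: for every $\gamma>0$ there is $\delta>0$ with $\limsup_{n\to\infty}\frac1n\sum_{j=0}^{n-1}-\log d_\delta(f^j(x),\mathcal C)\le\gamma$ for $\lambda$-a.e. $x$, where $d_\delta(x,\mathcal C)=d(x,\mathcal C)$ if $d(x,\mathcal C)<\delta$ and $d_\delta(x,\mathcal C)=1$ otherwise. Hyperbolic times: $n\ge1$ is a $(\sigma,\delta)$-hyperbolic time for $x$ if for all $1\le k\le n$, $\prod_{j=n-k}^{n-1}\|Df(f^j(x))^{-1}\|\le\sigma^k$ and $d_\delta(f^{n-k}(x),\mathcal C)\ge\sigma^{bk}$, with $b=\min\{1/2,1/(2\beta)\}$. The first hyperbolic time map $h$ assigns to $x$ its smallest $(\sigma,\delta)$-hyperbolic time $h(x)\in\mathbb Z^+$. Physical measures: by a known theorem of Alves-Bonatti-Viana, such an $f$ has finitely many $f$-invariant ergodic absolutely continuous probability measures $\mu_1,\dots,\mu_p$ (physical measures), whose basins cover $\lambda$-almost all of $M$; every absolutely continuous invariant probability measure is a convex combination of them. Random perturbations: $X$ is the closed unit ball of $\mathbb{R}^n$, $f_t(x)=f(x)+t\zeta(x)$ for $t\in X$ (addition on the torus), $\Omega=X^{\mathbb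 N}$, $f^n_{\underline t}=f_{t_n}\circ\cdots\circ f_{t_1}$ for $\underline t=(t_1,t_2,\dots)\in\Omega$, and $\theta_\epsilon=\lambda|_{B(0,\epsilon)}/\lambda(B(0,\epsilon))$ is the normalized Lebesgue measure on the $\epsilon$-ball at $0$ in $\mathbb{R}^n$. A probability measure $\mu^\epsilon$ on $M$ is stationary for $(f_{\underline t},\theta_\epsilon^{\mathbb N})$ if $\int\phi\,d\mu^\epsilon=\int\int\phi(f_t(x))\,d\mu^\epsilon(x)\,d\theta_\epsilon(t)$ for all $\phi\in C^0(M,\mathbb R)$. $f$ is stochastically stable under $(f_{\underline t},\theta_\epsilon^{\mathbb N})_{\epsilon>0}$ if every weak$^*$ accumulation point $\mu^0$, as $\epsilon\searrow0$, of a family $(\mu^\epsilon)_{\epsilon>0}$ of stationary measures is of the form $\mu^0=\sum_i\alpha_i\mu_i$ with $\alpha_i\ge0$, $\sum_i\alpha_i=1$. *)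

theory Defs
  imports "HOL-Probability.Probability"
begin

section \<open>The circle\<close>

text \<open>The one-dimensional torus, as the additive group of reals modulo integers. It has length 1,
  so that normalized Lebesgue measure is arc length.\<close>

quotient_type circle = real / "\<lambda>x y :: real. x - y \<in> \<int>"
proof (rule equivpI)
  show "reflp (\<lambda>x y :: real. x - y \<in> \<int>)"
    by (simp add: reflp_def)
  show "symp (\<lambda>x y :: real. x - y \<in> \<int>)"
    by (metis (mono_tags, lifting) Ints_minus minus_diff_eq sympI)
  show "transp (\<lambda>x y :: real. x - y \<in> \<int>)"
  proof (rule transpI)
    fix x y z :: real
    assume "x - y \<in> \<int>" "y - z \<in> \<int>"
    then have "(x - y) + (y - z) \<in> \<int>" by (rule Ints_add)
    then show "x - z \<in> \<int>" by simp
  qed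
qed

lift_definition to_circle :: "real \<Rightarrow> circle" is "\<lambda>x. x" .

instantiation circle :: ab_group_add
begin

lift_definition zero_circle :: circle is "0 :: real" .

lift_definition plus_circle :: "circle \<Rightarrow> circle \<Rightarrow> circle" is "(+)"
proof -
  fix a b c d :: real
  assume "a - b \<in> \<int>" "c - d \<in> \<int>"
  then have "(a - b) + (c - d) \<in> \<int>" by (rule Ints_add)
  then show "(a + c) - (b + d) \<in> \<int>" by (simp add: algebra_simps)
qed

lift_definition uminus_circle :: "circle \<Rightarrow> circle" is "uminus"
proof -
  fix a b :: real
  assume "a - b \<in> \<int>"
  then have "- (a - b) \<in> \<int>" by (rule Ints_minus)
  then show "- a - - b \<in> \<int>" by simp
qed

definition minus_circle :: "circle \<Rightarrow> circle \<Rightarrow> circle" where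
  "minus_circle x y = x + - y"

instance
proof
  fix x y z :: circle
  show "x + y + z = x + (y + z)" by transfer (simp add: algebra_simps)
  show "x + y = y + x" by transfer (simp add: algebra_simps)
  show "0 + x = x" by transfer simp
  show "- x + x = 0" by transfer simp
  show "x - y = x + - y" by (rule minus_circle_def)
qed

end

text \<open>The representative in \<open>[-1/2, 1/2)\<close>: the logarithmic chart of the circle at 0.\<close>

lift_definition circle_rep :: "circle \<Rightarrow> real" is "\<lambda>x. x - of_int (round x)"
proof -
  fix a b :: real
  assume "a - b \<in> \<int>"
  then obtain k where k: "a - b = of_int k" by (rule Ints_cases)
  then have a: "a = b + of_int k" by simp
  have "round a = round b + k"
    unfolding a round_def by (metis add.assoc add.commute floor_add_int)
  then show "a - of_int (round a) = b - of_int (round b)"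
    by (simp add: a)
qed

lemma to_circle_rep: "to_circle (circle_rep x) = x"
  by transfer simp

lemma to_circle_add: "to_circle (a + b) = to_circle a + to_circle b"
  by transfer simp

lemma to_circle_diff: "to_circle (a - b) = to_circle a - to_circle b"
  unfolding minus_circle_def by transfer simp

lemma to_circle_minus: "to_circle (- a) = - to_circle a"
  by transfer simp

lemma to_circle_0: "to_circle 0 = 0"
  by transfer simp

lemma abs_circle_rep_le: "\<bar>circle_rep (to_circle a)\<bar> \<le> \<bar>a\<bar>"
  by transfer (use round_diff_minimal[of _ 0] in \<open>simp add: abs_minus_commute\<close>)

instantiation circle :: metric_space
begin

definition dist_circle :: "circle \<Rightarrow> circle \<Rightarrow> real" where
  "dist_circle x y = \<bar>circle_rep (x - y)\<bar>"

definition uniformity_circle :: "(circle \<times> circle) filter" where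
  "uniformity_circle = (INF e\<in>{0<..}. principal {(x, y). dist x y < e})"

definition open_circle :: "circle set \<Rightarrow> bool" where
  "open_circle U \<longleftrightarrow> (\<forall>x\<in>U. \<forall>\<^sub>F (x', y) in uniformity. x' = x \<longrightarrow> y \<in> U)"

instance
proof
  fix x y z :: circle
  show "dist x y = 0 \<longleftrightarrow> x = y"
  proof
    assume "dist x y = 0"
    then have "to_circle (circle_rep (x - y)) = 0"
      by (simp add: dist_circle_def to_circle_0)
    then show "x = y" by (simp add: to_circle_rep)
  next
    assume "x = y"
    then show "dist x y = 0"
      using abs_circle_rep_le[of 0] by (simp add: dist_circle_def to_circle_0)
  qed
  have *: "x - y = to_circle (circle_rep (x - z) - circle_rep (y - z))"
    by (simp add: to_circle_diff to_circle_rep)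
  have "dist x y \<le> \<bar>circle_rep (x - z) - circle_rep (y - z)\<bar>"
    unfolding dist_circle_def * by (rule abs_circle_rep_le)
  then show "dist x y \<le> dist x z + dist y z"
    unfolding dist_circle_def by linarith
qed (simp_all only: uniformity_circle_def open_circle_def)

end

lemma dist_to_circle_le: "dist (to_circle a) (to_circle b) \<le> dist a b"
  by (metis abs_circle_rep_le dist_circle_def dist_real_def to_circle_diff)

lemma continuous_on_to_circle: "continuous_on A to_circle"
  unfolding continuous_on_iff by (meson dist_to_circle_le le_less_trans)

lemma measurable_to_circle [measurable]: "to_circle \<in> borel_measurable borel"
  by (rule borel_measurable_continuous_onI) (rule continuous_on_to_circle)

definition circle_lebesgue :: "circle measure" where
  "circle_lebesgue = distr (uniform_measure lborel {0..<1}) borel to_circle"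

lemma prob_space_circle_lebesgue: "prob_space circle_lebesgue"
  unfolding circle_lebesgue_def
  by (intro prob_space.prob_space_distr prob_space_uniform_measure) simp_all


section \<open>Differentiation on the circle\<close>

text \<open>Tangent spaces are identified with the reals by translation. The map
  \<open>h \<mapsto> circle_rep (f (x + to_circle h) - f x)\<close> is \<open>f\<close> read in the charts at \<open>x\<close> and \<open>f x\<close>. As
  \<open>circle_rep\<close> is a local isometry at 0, its discontinuity at the antipode is irrelevant.\<close>

definition has_circle_deriv :: "(circle \<Rightarrow> circle) \<Rightarrow> real \<Rightarrow> circle \<Rightarrow> bool" where
  "has_circle_deriv f D x \<longleftrightarrow>
     ((\<lambda>h. circle_rep (f (x + to_circle h) - f x)) has_real_derivative D) (at 0)"

definition circle_deriv :: "(circle \<Rightarrow> circle) \<Rightarrow> circle \<Rightarrow> real" where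
  "circle_deriv f x = deriv (\<lambda>h. circle_rep (f (x + to_circle h) - f x)) 0"

lemma has_circle_deriv_imp_circle_deriv: "has_circle_deriv f D x \<Longrightarrow> circle_deriv f x = D"
  unfolding has_circle_deriv_def circle_deriv_def by (rule DERIV_imp_deriv)

definition C2_on :: "circle set \<Rightarrow> (circle \<Rightarrow> circle) \<Rightarrow> bool" where
  "C2_on U f \<longleftrightarrow> (\<exists>D D2 :: circle \<Rightarrow> real.
     (\<forall>x\<in>U. has_circle_deriv f (D x) x) \<and>
     (\<forall>x\<in>U. ((\<lambda>h. D (x + to_circle h)) has_real_derivative D2 x) (at 0)) \<and>
     continuous_on U D2)"

definition C2_diffeomorphism_on :: "circle set \<Rightarrow> (circle \<Rightarrow> circle) \<Rightarrow> bool" where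
  "C2_diffeomorphism_on U f \<longleftrightarrow>
     open U \<and> open (f ` U) \<and> C2_on U f \<and> (\<exists>g. (\<forall>x\<in>U. g (f x) = x) \<and> C2_on (f ` U) g)"

definition critical_set :: "(circle \<Rightarrow> circle) \<Rightarrow> circle set" where
  "critical_set f = {x. has_circle_deriv f 0 x}"

definition C2_local_diffeomorphism_on :: "circle set \<Rightarrow> (circle \<Rightarrow> circle) \<Rightarrow> bool" where
  "C2_local_diffeomorphism_on S f \<longleftrightarrow>
     (\<forall>x\<in>S. \<exists>U\<subseteq>S. x \<in> U \<and> C2_diffeomorphism_on U f)"


section \<open>Non-degenerate critical set, expansion and recurrence\<close>

text \<open>The critical set may be empty (e.g. for the doubling map), whereas \<^term>\<open>infdist x {} = 0\<close>.
  With distance 1 to the empty set, the truncated distance below is constantly 1 and the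
  non-degeneracy conditions are the uniform bounds enjoyed by every \<open>C\<^sup>2\<close> local diffeomorphism.\<close>

definition crit_dist :: "(circle \<Rightarrow> circle) \<Rightarrow> circle \<Rightarrow> real" where
  "crit_dist f x = (if critical_set f = {} then 1 else infdist x (critical_set f))"

definition trunc_crit_dist :: "(circle \<Rightarrow> circle) \<Rightarrow> real \<Rightarrow> circle \<Rightarrow> real" where
  "trunc_crit_dist f \<delta> x = (if crit_dist f x < \<delta> then crit_dist f x else 1)"

text \<open>In dimension one both \<open>\<parallel>Df(x)\<^sup>-\<^sup>1\<parallel>\<close> and \<open>\<bar>det Df(x)\<^sup>-\<^sup>1\<bar>\<close> are the absolute value of
  \<^term>\<open>inverse (circle_deriv f x)\<close>, so the distortion conditions for the norm and for the
  determinant are one and the same.\<close>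

definition nondegenerate_critical_set :: "(circle \<Rightarrow> circle) \<Rightarrow> real \<Rightarrow> real \<Rightarrow> bool" where
  "nondegenerate_critical_set f B \<beta> \<longleftrightarrow>
     B > 1 \<and> \<beta> > 0 \<and>
     (\<forall>x\<in>- critical_set f. \<forall>y\<in>- critical_set f. dist x y < crit_dist f x / 2 \<longrightarrow>
        (\<forall>v. v \<noteq> 0 \<longrightarrow>
           1 / B * crit_dist f x powr \<beta> \<le> \<bar>circle_deriv f x * v\<bar> / \<bar>v\<bar> \<and>
           \<bar>circle_deriv f x * v\<bar> / \<bar>v\<bar> \<le> B * crit_dist f x powr (- \<beta>)) \<and>
        \<bar>ln \<bar>inverse (circle_deriv f x)\<bar> - ln \<bar>inverse (circle_deriv f y)\<bar>\<bar>
          \<le> B * (dist x y / crit_dist f x powr \<beta>))"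

text \<open>The following two logarithms are \<open>\<infinity>\<close> on the critical set.\<close>

definition log_inverse_deriv :: "(circle \<Rightarrow> circle) \<Rightarrow> circle \<Rightarrow> ereal" where
  "log_inverse_deriv f x =
     (if x \<in> critical_set f then \<infinity> else ereal (ln \<bar>inverse (circle_deriv f x)\<bar>))"

definition neg_log_trunc_crit_dist :: "(circle \<Rightarrow> circle) \<Rightarrow> real \<Rightarrow> circle \<Rightarrow> ereal" where
  "neg_log_trunc_crit_dist f \<delta> x =
     (if trunc_crit_dist f \<delta> x = 0 then \<infinity> else ereal (- ln (trunc_crit_dist f \<delta> x)))"

definition nonuniformly_expanding :: "(circle \<Rightarrow> circle) \<Rightarrow> bool" where
  "nonuniformly_expanding f \<longleftrightarrow>
     (\<exists>c>0. AE x in circle_lebesgue.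
        limsup (\<lambda>n. (\<Sum>j<n. log_inverse_deriv f ((f ^^ j) x)) / ereal (real n)) \<le> ereal (- c))"

definition slow_recurrence :: "(circle \<Rightarrow> circle) \<Rightarrow> bool" where
  "slow_recurrence f \<longleftrightarrow>
     (\<forall>\<gamma>>0. \<exists>\<delta>>0. AE x in circle_lebesgue.
        limsup (\<lambda>n. (\<Sum>j<n. neg_log_trunc_crit_dist f \<delta> ((f ^^ j) x)) / ereal (real n))
          \<le> ereal \<gamma>)"

text \<open>\<open>\<beta>\<close> is the exponent of the non-degeneracy condition. The second requirement keeps
  \<open>x, \<dots>, (f ^^ (n - 1)) x\<close> off the critical set, so the convention \<^term>\<open>inverse 0 = (0 :: real)\<close>
  plays no role.\<close>

definition hyperbolic_time ::
  "(circle \<Rightarrow> circle) \<Rightarrow> real \<Rightarrow> real \<Rightarrow> real \<Rightarrow> circle \<Rightarrow> nat \<Rightarrow> bool" where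
  "hyperbolic_time f \<beta> \<sigma> \<delta> x n \<longleftrightarrow>
     n \<ge> 1 \<and>
     (\<forall>k\<in>{1..n}.
        (\<Prod>j\<in>{n - k..<n}. \<bar>inverse (circle_deriv f ((f ^^ j) x))\<bar>) \<le> \<sigma> ^ k \<and>
        trunc_crit_dist f \<delta> ((f ^^ (n - k)) x) \<ge> \<sigma> powr (min (1 / 2) (1 / (2 * \<beta>)) * real k))"

definition first_hyperbolic_time ::
  "(circle \<Rightarrow> circle) \<Rightarrow> real \<Rightarrow> real \<Rightarrow> real \<Rightarrow> circle \<Rightarrow> nat" where
  "first_hyperbolic_time f \<beta> \<sigma> \<delta> x = (LEAST n. hyperbolic_time f \<beta> \<sigma> \<delta> x n)"

definition has_dense_orbit :: "(circle \<Rightarrow> circle) \<Rightarrow> bool" where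
  "has_dense_orbit f \<longleftrightarrow> (\<exists>x. closure (range (\<lambda>n. (f ^^ n) x)) = UNIV)"


section \<open>Physical measures and stochastic stability\<close>

definition circle_prob :: "circle measure \<Rightarrow> bool" where
  "circle_prob \<mu> \<longleftrightarrow> prob_space \<mu> \<and> sets \<mu> = sets borel"

definition invariant_measure :: "(circle \<Rightarrow> circle) \<Rightarrow> circle measure \<Rightarrow> bool" where
  "invariant_measure f \<mu> \<longleftrightarrow> distr \<mu> borel f = \<mu>"

definition ergodic_measure :: "(circle \<Rightarrow> circle) \<Rightarrow> circle measure \<Rightarrow> bool" where
  "ergodic_measure f \<mu> \<longleftrightarrow>
     (\<forall>A\<in>sets borel. f -` A = A \<longrightarrow> measure \<mu> A = 0 \<or> measure \<mu> A = 1)"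

definition physical_measures :: "(circle \<Rightarrow> circle) \<Rightarrow> circle measure set" where
  "physical_measures f =
     {\<mu>. circle_prob \<mu> \<and> invariant_measure f \<mu> \<and> ergodic_measure f \<mu> \<and>
         absolutely_continuous circle_lebesgue \<mu>}"

definition perturbed_map ::
  "(circle \<Rightarrow> circle) \<Rightarrow> (circle \<Rightarrow> real) \<Rightarrow> real \<Rightarrow> circle \<Rightarrow> circle" where
  "perturbed_map f \<zeta> t x = f x + to_circle (t * \<zeta> x)"

definition noise :: "real \<Rightarrow> real measure" where
  "noise \<epsilon> = uniform_measure lborel (ball 0 \<epsilon>)"

definition stationary_measure ::
  "(circle \<Rightarrow> circle) \<Rightarrow> (circle \<Rightarrow> real) \<Rightarrow> real \<Rightarrow> circle measure \<Rightarrow> bool" where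
  "stationary_measure f \<zeta> \<epsilon> \<mu> \<longleftrightarrow>
     circle_prob \<mu> \<and>
     (\<forall>\<phi> :: circle \<Rightarrow> real. continuous_on UNIV \<phi> \<longrightarrow>
        (\<integral>x. \<phi> x \<partial>\<mu>) = (\<integral>t. (\<integral>x. \<phi> (perturbed_map f \<zeta> t x) \<partial>\<mu>) \<partial>noise \<epsilon>))"

text \<open>Every basic weak* neighbourhood of \<open>\<mu>0\<close> contains \<open>\<mu> \<epsilon>\<close> for arbitrarily small
  \<open>\<epsilon> > 0\<close>.\<close>

definition weak_star_accumulation_point ::
  "(real \<Rightarrow> circle measure) \<Rightarrow> circle measure \<Rightarrow> bool" where
  "weak_star_accumulation_point \<mu> \<mu>0 \<longleftrightarrow>
     circle_prob \<mu>0 \<and>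
     (\<forall>\<Phi> :: (circle \<Rightarrow> real) set. \<forall>\<eta>>0. finite \<Phi> \<and> (\<forall>\<phi>\<in>\<Phi>. continuous_on UNIV \<phi>) \<longrightarrow>
        (\<exists>\<^sub>F \<epsilon> in at_right 0. \<forall>\<phi>\<in>\<Phi>. \<bar>(\<integral>x. \<phi> x \<partial>\<mu> \<epsilon>) - (\<integral>x. \<phi> x \<partial>\<mu>0)\<bar> < \<eta>))"

text \<open>A sum over an infinite set is 0, so total weight 1 includes finiteness of
  \<^term>\<open>physical_measures f\<close>.\<close>

definition convex_combination_of_physical ::
  "(circle \<Rightarrow> circle) \<Rightarrow> circle measure \<Rightarrow> bool" where
  "convex_combination_of_physical f \<mu>0 \<longleftrightarrow>
     (\<exists>\<alpha> :: circle measure \<Rightarrow> real.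
        (\<forall>\<nu>\<in>physical_measures f. \<alpha> \<nu> \<ge> 0) \<and>
        (\<Sum>\<nu>\<in>physical_measures f. \<alpha> \<nu>) = 1 \<and>
        (\<forall>A\<in>sets borel. measure \<mu>0 A = (\<Sum>\<nu>\<in>physical_measures f. \<alpha> \<nu> * measure \<nu> A)))"

text \<open>Only small noise levels matter, so \<open>\<mu> \<epsilon>\<close> is required to be stationary for small
  \<open>\<epsilon> > 0\<close> only; in particular the noise may be assumed to live in \<open>[-1, 1]\<close>.\<close>

definition stochastically_stable :: "(circle \<Rightarrow> circle) \<Rightarrow> (circle \<Rightarrow> real) \<Rightarrow> bool" where
  "stochastically_stable f \<zeta> \<longleftrightarrow>
     (\<forall>\<mu> \<mu>0. (\<forall>\<^sub>F \<epsilon> in at_right 0. stationary_measure f \<zeta> \<epsilon> (\<mu> \<epsilon>)) \<and>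
        weak_star_accumulation_point \<mu> \<mu>0 \<longrightarrow>
        convex_combination_of_physical f \<mu>0)"

definition locally_constant_at :: "(circle \<Rightarrow> real) \<Rightarrow> circle \<Rightarrow> bool" where
  "locally_constant_at \<zeta> x \<longleftrightarrow> (\<forall>\<^sub>F y in nhds x. \<zeta> y = \<zeta> x)"

end

theory Submission
  imports Defs
begin

text \<open>Bounded distortion at hyperbolic times, together with the integrability of the first hyperbolic
  time, yields a finite measure \<open>\<nu>\<close>, absolutely continuous with respect to Lebesgue measure \<open>\<lambda>\<close>, such
  that \<open>\<lambda> (f\<^sup>-\<^sup>j A) \<le> \<nu> A\<close> for all \<open>j\<close> and \<open>A\<close>. Bounded distortion also shows that a forward invariant
  set of positive measure contains almost all of some arc. With a dense orbit this makes the absolutely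
  continuous invariant probability measure unique and ergodic, so it suffices that every zero noise limit
  is invariant and absolutely continuous.

  The noise is concentrated on a decreasing sequence of open sets \<open>R\<^sub>l\<close> with \<open>\<nu> R\<^sub>l = O(1 / n\<^sub>l)\<close> that every
  pseudo-orbit with sufficiently small errors meets within \<open>n\<^sub>l\<close> steps. On \<open>R\<^sub>l - R\<^sub>l\<^sub>+\<^sub>1\<close> the function \<open>\<zeta>\<close> has a
  constant value \<open>z\<^sub>l\<close>, and \<open>z\<^sub>l / z\<^sub>l\<^sub>+\<^sub>1\<close> is tiny. If \<open>1 / z\<^sub>l\<^sub>+\<^sub>1 \<le> \<epsilon> < 1 / z\<^sub>l\<close>, then one step of the chain from
  \<open>R\<^sub>l\<^sub>+\<^sub>1\<close> has bounded density, while outside of \<open>R\<^sub>l\<close> the chain is shadowed by orbits of \<open>f\<close>. Decomposing a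
  stationary measure \<open>\<mu>\<^sup>\<epsilon>\<close> according to the last visit to the set \<open>R\<close> of strong noise gives
  \<open>\<mu>\<^sup>\<epsilon> R = O(1 / n\<^sub>l)\<close>. After that visit the density is \<open>O(1 / n\<^sub>l)\<close>, and each of the at most \<open>n\<^sub>l\<close> following steps
  turns it into a measure \<open>O(1 / n\<^sub>l) \<nu>\<close>. Hence \<open>\<mu>\<^sup>\<epsilon> B = O(\<nu> B')\<close> for a small neighbourhood \<open>B'\<close> of \<open>B\<close>, which
  gives absolute continuity in the limit; invariance follows from \<open>\<mu>\<^sup>\<epsilon> R \<longlonglongrightarrow> 0\<close>.\<close>

text \<open>The measure \<open>\<nu>\<close> controls the images of Lebesgue measure under the
  iterates of \<open>f\<close>, but not the images of \<open>\<nu>\<close> itself, so the noise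
  cannot be treated as a perturbation at every step. Strong noise on \<open>R\<close> restarts the
  chain from a density, and between two restarts there are at most \<open>n\<close> steps, for which
  uniform continuity gives shadowing. The constants balance: the restart density is of order
  \<open>\<mu> R\<close>, there are \<open>n\<close> terms, and \<open>\<mu> R\<close> is of order
  \<open>1 / n\<close>, so the bound on \<open>\<mu> B\<close> does not depend on the noise level.

  Since every pseudo-orbit has to meet \<open>R\<close>, a Rokhlin tower up to null sets is not
  enough; halving and compactness yield sets that all points hit.

  While \<open>\<epsilon>\<close> runs through one range of scales, the amplitude on the shell
  between two consecutive sets passes through intermediate sizes, where the noise is neither weak
  nor strong. For this reason the tower is refined until a thickened shell is small compared with
  the error \<open>e\<close>, and the contribution of the shell is absorbed.\<close>

section \<open>Topology and Lebesgue measure of the circle\<close>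

lemma to_circle_eq_iff: "to_circle a = to_circle b \<longleftrightarrow> a - b \<in> \<int>"
  by transfer simp

lemma to_circle_add_of_int [simp]: "to_circle (a + of_int k) = to_circle a"
  by (simp add: to_circle_eq_iff)

lemma circle_rep_ge: "- 1 / 2 \<le> circle_rep x"
  by transfer (simp add: round_def; linarith)

lemma circle_rep_less: "circle_rep x < 1 / 2"
  by transfer (simp add: round_def; linarith)

lemma circle_rep_to_circle:
  assumes "- 1 / 2 \<le> a" "a < 1 / 2"
  shows "circle_rep (to_circle a) = a"
proof -
  have "round a = 0"
    using assms unfolding round_def by (intro floor_unique) auto
  then show ?thesis by transfer simp
qed

lemma dist_to_circle_eq:
  assumes "\<bar>a - b\<bar> \<le> 1 / 2"
  shows "dist (to_circle a) (to_circle b) = \<bar>a - b\<bar>"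
\<comment> \<open>Representatives lie in \<open>[-1/2, 1/2)\<close>, so a difference of
  \<open>1/2\<close> is represented by \<open>-1/2\<close>, which has the same absolute
  value.\<close>
proof (cases "a - b = 1 / 2")
  case True
  have "a - b - (- 1 / 2) = 1" using True by simp
  then have "to_circle (a - b) = to_circle (- 1 / 2)"
    unfolding to_circle_eq_iff by (metis Ints_1)
  moreover have "circle_rep (to_circle (- 1 / 2)) = - 1 / 2"
    by (rule circle_rep_to_circle) auto
  ultimately have "circle_rep (to_circle (a - b)) = - 1 / 2" by simp
  then show ?thesis
    unfolding dist_circle_def to_circle_diff[symmetric] True by simp
next
  case False
  then have "circle_rep (to_circle (a - b)) = a - b"
    using assms by (intro circle_rep_to_circle) linarith+
  then show ?thesis unfolding dist_circle_def to_circle_diff[symmetric] by simp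
qed

lemma dist_add_to_circle_le: "dist (x + to_circle h) x \<le> \<bar>h\<bar>"
  unfolding dist_circle_def by (simp add: abs_circle_rep_le)

lemma surj_to_circle: "surj to_circle"
  by (metis surjI to_circle_rep)

lemma ex_to_circle_Ico:
  obtains t where "a \<le> t" "t < a + 1" "to_circle t = x"
proof -
  obtain s where s: "to_circle s = x" by (metis to_circle_rep)
  define t where "t = s - of_int \<lfloor>s - a\<rfloor>"
  have "to_circle t = x"
    unfolding t_def s[symmetric] to_circle_eq_iff by simp
  moreover have "a \<le> t" "t < a + 1" unfolding t_def by linarith+
  ultimately show ?thesis using that by blast
qed

lemma compact_UNIV_circle: "compact (UNIV :: circle set)"
proof -
  have "to_circle ` {0..1} = UNIV"
    using ex_to_circle_Ico[of 0] by (metis (no_types, opaque_lifting) UNIV_eq_I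
        add_0 atLeastAtMost_iff image_eqI less_eq_real_def)
  then show ?thesis
    by (metis compact_Icc compact_continuous_image continuous_on_to_circle)
qed

lemma open_image_to_circle:
  assumes "open U"
  shows "open (to_circle ` U)"
  unfolding open_dist
proof safe
  fix t assume "t \<in> U"
  then obtain e where e: "e > 0" "ball t e \<subseteq> U"
    using assms openE by blast
  have "y \<in> to_circle ` U" if "dist y (to_circle t) < e" for y
  proof -
    have "y = to_circle (t + circle_rep (y - to_circle t))"
      by (simp add: to_circle_add to_circle_rep)
    moreover have "t + circle_rep (y - to_circle t) \<in> U"
      using that e(2) unfolding dist_circle_def by (auto simp: subset_iff dist_real_def)
    ultimately show ?thesis by blast
  qed
  then show "\<exists>e>0. \<forall>y. dist y (to_circle t) < e \<longrightarrow> y \<in> to_circle ` U"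
    using e(1) by blast
qed

text \<open>Completeness and second countability make the circle a Polish space, where finite Borel
  measures are regular: outer regularity is applied to \<open>\<nu>\<close>, inner regularity to the
  zero noise limit.\<close>

instance circle :: complete_space
proof
  fix X :: "nat \<Rightarrow> circle"
  assume "Cauchy X"
  then show "convergent X"
    using compact_imp_complete[OF compact_UNIV_circle]
    unfolding complete_def convergent_def by blast
qed

instance circle :: second_countable_topology
proof
  obtain \<B> :: "real set set" where B: "countable \<B>" "topological_basis \<B>"
    using ex_countable_basis by blast
  have "topological_basis ((`) to_circle ` \<B>)"
  proof (rule topological_basisI)
    show "open U" if "U \<in> (`) to_circle ` \<B>" for U
      using that B(2) open_image_to_circle topological_basis_open by blast
  next
    fix O' :: "circle set" and x
    assume "open O'" "x \<in> O'"
    obtain t where t: "x = to_circle t" using surj_to_circle by blast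
    have "open (to_circle -` O')"
      using \<open>open O'\<close> continuous_on_to_circle[of UNIV] by (simp add: continuous_on_open_vimage)
    then obtain V where "V \<in> \<B>" "t \<in> V" "V \<subseteq> to_circle -` O'"
      using B(2) t \<open>x \<in> O'\<close> topological_basisE by (metis vimageI)
    then show "\<exists>B'\<in>(`) to_circle ` \<B>. x \<in> B' \<and> B' \<subseteq> O'"
      by (intro bexI[of _ "to_circle ` V"]) (auto simp: t)
  qed
  then have "open = generate_topology ((`) to_circle ` \<B>)"
    by (rule topological_basis_imp_subbasis)
  moreover have "countable ((`) to_circle ` \<B>)" using B(1) by simp
  ultimately show "\<exists>B :: circle set set. countable B \<and> open = generate_topology B"
    by blast
qed

instance circle :: polish_space ..

lemma sets_circle_lebesgue [simp, measurable_cong]: "sets circle_lebesgue = sets borel"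
  by (simp add: circle_lebesgue_def)

lemma space_circle_lebesgue [simp]: "space circle_lebesgue = UNIV"
  by (simp add: circle_lebesgue_def)

interpretation circle_lebesgue: prob_space circle_lebesgue
  by (rule prob_space_circle_lebesgue)

lemma vimage_to_circle_borel: "B \<in> sets borel \<Longrightarrow> to_circle -` B \<in> sets borel"
  using measurable_sets[OF measurable_to_circle] by simp

lemma emeasure_circle_lebesgue:
  assumes "B \<in> sets borel"
  shows "emeasure circle_lebesgue B = emeasure lborel ({0..<1} \<inter> to_circle -` B)"
  unfolding circle_lebesgue_def
  using assms vimage_to_circle_borel[OF assms]
  by (subst emeasure_distr) (auto simp: emeasure_uniform_measure divide_ennreal_def)

lemma emeasure_lborel_shift:
  fixes c :: real
  assumes "S \<in> sets borel"
  shows "emeasure lborel ((\<lambda>x. c + x) -` S) = emeasure lborel S"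
proof -
  have "emeasure lborel S = emeasure (distr lborel borel ((+) c)) S"
    by (simp add: lborel_distr_plus)
  also have "\<dots> = emeasure lborel ((\<lambda>x. c + x) -` S)"
    using assms by (subst emeasure_distr) auto
  finally show ?thesis by simp
qed

text \<open>Up to an integer translation the interval starts at \<open>s = frac a\<close>; the part
  of \<open>[s, s + 1)\<close> beyond 1 is then moved back to \<open>[0, s)\<close>.\<close>

lemma emeasure_circle_lebesgue_Ico:
  assumes B: "B \<in> sets borel"
  shows "emeasure circle_lebesgue B = emeasure lborel ({a..<a + 1} \<inter> to_circle -` B)"
proof -
  define P where "P = to_circle -` B"
  have P [measurable]: "P \<in> sets borel"
    unfolding P_def by (rule vimage_to_circle_borel[OF B])
  have per: "of_int k + x \<in> P \<longleftrightarrow> x \<in> P" for k x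
    unfolding P_def by (simp add: add.commute)
  define s where "s = frac a"
  have s: "0 \<le> s" "s < 1" "a = of_int \<lfloor>a\<rfloor> + s"
    unfolding s_def by (simp_all add: frac_lt_1) (simp add: frac_def)
  have "(\<lambda>x. of_int \<lfloor>a\<rfloor> + x) -` ({a..<a + 1} \<inter> P) = {s..<s + 1} \<inter> P"
    using s(3) per by auto
  then have "emeasure lborel ({a..<a + 1} \<inter> P) = emeasure lborel ({s..<s + 1} \<inter> P)"
    using emeasure_lborel_shift[of "{a..<a + 1} \<inter> P" "of_int \<lfloor>a\<rfloor>"] by auto
  also have "{s..<s + 1} \<inter> P = ({s..<1} \<inter> P) \<union> ({1..<1 + s} \<inter> P)"
    using s by auto
  also have "emeasure lborel \<dots> = emeasure lborel ({s..<1} \<inter> P) + emeasure lborel ({1..<1 + s} \<inter> P)"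
    by (rule plus_emeasure[symmetric]) auto
  also have "(\<lambda>x. 1 + x) -` ({1..<1 + s} \<inter> P) = {0..<s} \<inter> P"
    using per[of 1] by auto
  then have "emeasure lborel ({1..<1 + s} \<inter> P) = emeasure lborel ({0..<s} \<inter> P)"
    using emeasure_lborel_shift[of "{1..<1 + s} \<inter> P" 1] by auto
  also have "emeasure lborel ({s..<1} \<inter> P) + emeasure lborel ({0..<s} \<inter> P)
      = emeasure lborel (({s..<1} \<inter> P) \<union> ({0..<s} \<inter> P))"
    by (rule plus_emeasure) auto
  also have "({s..<1} \<inter> P) \<union> ({0..<s} \<inter> P) = {0..<1} \<inter> P"
    using s by auto
  finally show ?thesis
    unfolding P_def using emeasure_circle_lebesgue[OF B] by simp
qed

text \<open>At most \<open>b - a + 1\<close> unit intervals are needed to cover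
  \<open>[a, b)\<close>. The extra 1 reappears in the density bound for one noisy step.\<close>

lemma emeasure_lborel_Ico_le:
  assumes B: "B \<in> sets borel" and "a \<le> b"
  shows "emeasure lborel ({a..<b} \<inter> to_circle -` B) \<le> ennreal (b - a + 1) * emeasure circle_lebesgue B"
proof -
  define N where "N = nat \<lceil>b - a\<rceil>"
  have P [measurable]: "to_circle -` B \<in> sets borel"
    by (rule vimage_to_circle_borel[OF B])
  have N: "b - a \<le> real N" "real N \<le> b - a + 1"
    using \<open>a \<le> b\<close> unfolding N_def by linarith+
  have "{a..<b} \<inter> to_circle -` B \<subseteq> (\<Union>i<N. {a + real i..<a + real i + 1} \<inter> to_circle -` B)"
  proof
    fix x assume x: "x \<in> {a..<b} \<inter> to_circle -` B"
    define i where "i = nat \<lfloor>x - a\<rfloor>"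
    have "i < N" "a + real i \<le> x" "x < a + real i + 1"
      using x N unfolding i_def by (auto simp: ) linarith+
    then show "x \<in> (\<Union>i<N. {a + real i..<a + real i + 1} \<inter> to_circle -` B)"
      using x by auto
  qed
  then have "emeasure lborel ({a..<b} \<inter> to_circle -` B)
      \<le> emeasure lborel (\<Union>i<N. {a + real i..<a + real i + 1} \<inter> to_circle -` B)"
    by (rule emeasure_mono) auto
  also have "\<dots> \<le> (\<Sum>i<N. emeasure lborel ({a + real i..<a + real i + 1} \<inter> to_circle -` B))"
    by (rule emeasure_subadditive_finite) auto
  also have "\<dots> = of_nat N * emeasure circle_lebesgue B"
    by (simp add: emeasure_circle_lebesgue_Ico[OF B, symmetric])
  also have "\<dots> \<le> ennreal (b - a + 1) * emeasure circle_lebesgue B"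
    using N by (intro mult_right_mono) (auto simp: ennreal_of_nat_eq_real_of_nat intro!: ennreal_leI)
  finally show ?thesis .
qed

lemma emeasure_circle_lebesgue_open_pos:
  assumes "open A" "A \<noteq> {}"
  shows "emeasure circle_lebesgue A > 0"
proof -
  obtain t where t: "to_circle t \<in> A" using assms(2) surj_to_circle by (metis ex_in_conv surjD)
  have "open (to_circle -` A)"
    using assms continuous_on_to_circle[of UNIV] by (simp add: continuous_on_open_vimage)
  then obtain e where e: "e > 0" "ball t e \<subseteq> to_circle -` A"
    using t openE by (metis vimageI)
  define d where "d = min e (1 / 2)"
  have d: "d > 0" "d \<le> 1/2" "{t - d<..<t + d} \<subseteq> to_circle -` A"
    using e by (auto simp: d_def subset_iff dist_real_def)
  have A: "A \<in> sets borel" using assms by simp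
  have "0 < emeasure lborel {t - d<..<t + d}" using d by simp
  also have "\<dots> \<le> emeasure lborel ({t - 1/2..<t - 1/2 + 1} \<inter> to_circle -` A)"
    using d vimage_to_circle_borel[OF A] by (intro emeasure_mono) auto
  finally show ?thesis unfolding emeasure_circle_lebesgue_Ico[OF A, of "t - 1/2"] .
qed

lemma emeasure_circle_lebesgue_ball_le:
  assumes "r \<ge> 0"
  shows "emeasure circle_lebesgue (ball x r) \<le> ennreal (2 * r)"
proof -
  obtain t where t: "x = to_circle t" using surj_to_circle by blast
  have "{t - 1/2..<t - 1/2 + 1} \<inter> to_circle -` ball x r \<subseteq> {t - r..t + r}"
  proof
    fix u assume u: "u \<in> {t - 1/2..<t - 1/2 + 1} \<inter> to_circle -` ball x r"
    then have "t - 1/2 \<le> u" "u < t + 1/2" by auto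
    then have "dist (to_circle t) (to_circle u) = \<bar>t - u\<bar>"
      by (intro dist_to_circle_eq) linarith
    then show "u \<in> {t - r..t + r}" using u t by auto
  qed
  then have "emeasure lborel ({t - 1/2..<t - 1/2 + 1} \<inter> to_circle -` ball x r) \<le> emeasure lborel {t - r..t + r}"
    by (rule emeasure_mono) auto
  then show ?thesis
    using assms unfolding emeasure_circle_lebesgue_Ico[OF borel_open[OF open_ball], of x r "t - 1/2"]
    by simp
qed

section \<open>Lipschitz images and lifts\<close>

text \<open>Cover \<open>E\<close> by countably many almost disjoint intervals of nearly the same
  total length; the image of the part of \<open>E\<close> in an interval of length \<open>s\<close>
  has diameter at most \<open>L * s\<close>. Bounding a Borel subset \<open>Q\<close> of the image
  avoids the question whether the image itself is Borel.\<close>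

lemma emeasure_Lipschitz_image_le:
  fixes g :: "real \<Rightarrow> real"
  assumes E: "E \<in> sets borel" "bounded E" and Q: "Q \<in> sets borel" "Q \<subseteq> g ` E" and L: "L \<ge> 0"
    and lip: "\<And>u v. u \<in> E \<Longrightarrow> v \<in> E \<Longrightarrow> \<bar>g u - g v\<bar> \<le> L * \<bar>u - v\<bar>"
  shows "emeasure lborel Q \<le> ennreal L * emeasure lborel E"
proof -
  obtain a b where ab: "E \<subseteq> cbox a b"
    using E(2) bounded_subset_cbox_symmetric by metis
  have El: "E \<in> lmeasurable"
    using E by (intro bounded_set_imp_lmeasurable) auto
  have Ee: "emeasure lborel E = ennreal (measure lebesgue E)"
  proof -
    have "emeasure lebesgue E = ennreal (measure lebesgue E)"
      using El by (rule emeasure_eq_measure2)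
    then show ?thesis using E(1) by simp
  qed
  have *: "emeasure lborel Q \<le> ennreal L * (emeasure lborel E + ennreal e)" if e: "e > 0" for e
  proof -
    obtain \<D> where D: "countable \<D>" "\<And>K. K \<in> \<D> \<Longrightarrow> \<exists>c d. K = cbox c d"
        "pairwise (\<lambda>A B. interior A \<inter> interior B = {}) \<D>"
        "E \<subseteq> \<Union>\<D>" "\<Union>\<D> \<in> lmeasurable" "measure lebesgue (\<Union>\<D>) \<le> measure lebesgue E + e"
      using measurable_outer_intervals_bounded[OF El ab e] by metis
    define X where "X n = (if n \<in> to_nat_on \<D> ` \<D> then from_nat_into \<D> n else {})" for n
    have X_in: "X n \<in> \<D> \<or> X n = {}" for n
      by (auto simp: X_def D(1))
    have X_cover: "\<exists>n. K = X n" if "K \<in> \<D>" for K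
      using that D(1) unfolding X_def by (intro exI[of _ "to_nat_on \<D> K"]) auto
    have X_disj: "interior (X m) \<inter> interior (X n) = {}" if "m \<noteq> n" for m n
    proof (cases "m \<in> to_nat_on \<D> ` \<D> \<and> n \<in> to_nat_on \<D> ` \<D>")
      case True
      then have "X m \<in> \<D>" "X n \<in> \<D>" "X m \<noteq> X n"
        using that D(1) by (auto simp: X_def)
      then show ?thesis using D(3) by (auto simp: pairwise_def)
    qed (auto simp: X_def)
    have X_Icc: "\<exists>c d. X n = {c..d}" for n
    proof (cases "X n = {}")
      case True
      then show ?thesis by (intro exI[of _ 1] exI[of _ 0]) simp
    next
      case False
      then show ?thesis using X_in[of n] D(2)[of "X n"] by auto
    qed
    \<comment> \<open>Interiors have the same length as the intervals and are disjoint, so their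
      measures add up.\<close>
    have X_int: "emeasure lborel (interior (X n)) = emeasure lborel (X n)" for n
    proof -
      obtain c d where cd: "X n = {c..d}" using X_Icc by blast
      show ?thesis
        by (cases "c \<le> d") (simp_all add: cd)
    qed
    define Y where "Y n = (if E \<inter> X n = {} then {} else {Inf (g ` (E \<inter> X n))..Sup (g ` (E \<inter> X n))})" for n
    have Y: "g ` (E \<inter> X n) \<subseteq> Y n \<and> emeasure lborel (Y n) \<le> ennreal L * emeasure lborel (X n)" for n
    proof (cases "E \<inter> X n = {}")
      case False
      obtain c d where cd: "X n = {c..d}" using X_Icc by blast
      then have "c \<le> d" using False by auto
      define G where "G = g ` (E \<inter> X n)"
      have G: "x \<le> y + L * (d - c)" if "x \<in> G" "y \<in> G" for x y
      proof -
        obtain u where u: "u \<in> E" "u \<in> {c..d}" "x = g u" using \<open>x \<in> G\<close> unfolding G_def cd by blast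
        obtain v where v: "v \<in> E" "v \<in> {c..d}" "y = g v" using \<open>y \<in> G\<close> unfolding G_def cd by blast
        note uv = u v
        have "\<bar>g u - g v\<bar> \<le> L * \<bar>u - v\<bar>" using lip uv by blast
        also have "\<dots> \<le> L * (d - c)" using uv L by (intro mult_left_mono) auto
        finally show ?thesis using uv by linarith
      qed
      have "G \<noteq> {}" using False by (auto simp: G_def)
      then obtain x0 where x0: "x0 \<in> G" by blast
      have bdd: "bdd_above G" "bdd_below G"
        using G[OF _ x0] G[OF x0] by (auto intro!: bdd_aboveI[of _ "x0 + L * (d - c)"]
          bdd_belowI[of _ "x0 - L * (d - c)"] simp: algebra_simps)
      have "x \<le> Inf G + L * (d - c)" if "x \<in> G" for x
        using cInf_greatest[OF \<open>G \<noteq> {}\<close>, of "x - L * (d - c)"] G[OF that] by (simp add: algebra_simps)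
      then have "Sup G \<le> Inf G + L * (d - c)"
        using cSup_least[OF \<open>G \<noteq> {}\<close>] by blast
      moreover have "Inf G \<le> Sup G"
        using cInf_lower[OF x0 bdd(2)] cSup_upper[OF x0 bdd(1)] by linarith
      ultimately have "emeasure lborel {Inf G..Sup G} \<le> ennreal (L * (d - c))"
        by (simp add: ennreal_leI)
      moreover have "ennreal (L * (d - c)) = ennreal L * emeasure lborel (X n)"
        using \<open>c \<le> d\<close> L by (simp add: cd ennreal_mult)
      moreover have "G \<subseteq> {Inf G..Sup G}"
        using cInf_lower[OF _ bdd(2)] cSup_upper[OF _ bdd(1)] by auto
      moreover have "Y n = {Inf G..Sup G}" using False by (simp add: Y_def G_def)
      ultimately show ?thesis unfolding G_def by metis
    qed (simp add: Y_def)
    have "Q \<subseteq> (\<Union>n. Y n)"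
    proof
      fix q assume "q \<in> Q"
      then obtain u where u: "u \<in> E" "q = g u" using Q(2) by blast
      then obtain n where "u \<in> X n" using D(4) X_cover by blast
      then show "q \<in> (\<Union>n. Y n)" using u Y[of n] by blast
    qed
    then have "emeasure lborel Q \<le> emeasure lborel (\<Union>n. Y n)"
      by (rule emeasure_mono) (auto simp: Y_def)
    also have "\<dots> \<le> (\<Sum>n. emeasure lborel (Y n))"
      by (rule emeasure_subadditive_countably) (auto simp: Y_def)
    also have "\<dots> \<le> (\<Sum>n. ennreal L * emeasure lborel (interior (X n)))"
      using Y X_int by (intro suminf_le) auto
    also have "\<dots> = ennreal L * (\<Sum>n. emeasure lborel (interior (X n)))"
      by simp
    also have "(\<Sum>n. emeasure lborel (interior (X n))) = emeasure lborel (\<Union>n. interior (X n))"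
      using X_disj by (intro suminf_emeasure) (auto simp: disjoint_family_on_def)
    also have "\<dots> = emeasure lebesgue (\<Union>n. interior (X n))" by simp
    also have "\<dots> \<le> emeasure lebesgue (\<Union>\<D>)"
    proof (rule emeasure_mono)
      have "interior (X n) \<subseteq> \<Union>\<D>" for n
        using X_in[of n] interior_subset[of "X n"] by auto
      then show "(\<Union>n. interior (X n)) \<subseteq> \<Union>\<D>" by blast
      show "\<Union>\<D> \<in> sets lebesgue" using D(5) by (rule fmeasurableD)
    qed
    also have "\<dots> = ennreal (measure lebesgue (\<Union>\<D>))"
      using D(5) by (rule emeasure_eq_measure2)
    also have "\<dots> \<le> ennreal (measure lebesgue E + e)" using D(6) by (rule ennreal_leI)
    also have "\<dots> = emeasure lborel E + ennreal e" using e Ee by simp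
    finally show ?thesis by (simp add: mult_left_mono)
  qed
  have "emeasure lborel Q \<le> ennreal L * emeasure lborel E + ennreal d" if "d > 0" for d
  proof -
    \<comment> \<open>Dividing by \<open>L + 1\<close> rather than \<open>L\<close> includes the
      case \<open>L = 0\<close>.\<close>
    have "emeasure lborel Q \<le> ennreal L * (emeasure lborel E + ennreal (d / (L + 1)))"
      using * that L by simp
    also have "\<dots> = ennreal L * emeasure lborel E + ennreal (L * (d / (L + 1)))"
    proof -
      have "ennreal (L * (d / (L + 1))) = ennreal L * ennreal (d / (L + 1))"
        using L that by (intro ennreal_mult) auto
      then show ?thesis by (simp only: distrib_left)
    qed
    also have "L * (d / (L + 1)) \<le> d" using L that by (simp add: field_simps)
    then have "ennreal L * emeasure lborel E + ennreal (L * (d / (L + 1))) \<le> ennreal L * emeasure lborel E + ennreal d"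
      by (intro add_left_mono ennreal_leI)
    finally show ?thesis .
  qed
  then show ?thesis
    by (rule ennreal_le_epsilon)
qed

text \<open>Identifies the circle with the complex unit circle. A continuous map from the
  contractible real line into the nonzero complex numbers has a continuous logarithm, and its
  imaginary part yields the lift in \<open>ex_circle_lift\<close>.\<close>

definition circle_cis :: "circle \<Rightarrow> complex" where
  "circle_cis x = cis (2 * pi * circle_rep x)"

lemma circle_cis_to_circle: "circle_cis (to_circle t) = cis (2 * pi * t)"
proof -
  have "to_circle (circle_rep (to_circle t)) = to_circle t" by (rule to_circle_rep)
  then obtain k where "circle_rep (to_circle t) - t = of_int k"
    unfolding to_circle_eq_iff by (auto elim: Ints_cases)
  then have "circle_rep (to_circle t) = t + of_int k" by simp
  then have "circle_cis (to_circle t) = cis (2 * pi * t + 2 * pi * of_int k)"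
    unfolding circle_cis_def by (simp only: distrib_left)
  also have "\<dots> = cis (2 * pi * t) * cis (2 * pi * of_int k)"
    by (rule cis_mult[symmetric])
  also have "cis (2 * pi * of_int k) = 1"
    by (rule cis_multiple_2pi) simp
  finally show ?thesis by simp
qed

lemma continuous_circle_cis: "continuous_on UNIV circle_cis"
  unfolding continuous_on_iff
proof safe
  fix x :: circle and e :: real assume e: "e > 0"
  obtain t where t: "x = to_circle t" using surj_to_circle by blast
  have "continuous_on UNIV (\<lambda>s. cis (2 * pi * s))" by (intro continuous_intros)
  then obtain d where d: "d > 0" "\<And>s. dist s t < d \<Longrightarrow> dist (cis (2 * pi * s)) (cis (2 * pi * t)) < e"
    using e unfolding continuous_on_iff by blast
  have "dist (circle_cis y) (circle_cis x) < e" if "dist y x < d" for y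
  proof -
    have y: "y = to_circle (t + circle_rep (y - x))"
      by (simp add: t to_circle_add to_circle_rep)
    have "dist (t + circle_rep (y - x)) t < d"
      using that by (simp add: dist_circle_def dist_real_def)
    from d(2)[OF this] have "dist (circle_cis (to_circle (t + circle_rep (y - x)))) (circle_cis (to_circle t)) < e"
      by (simp only: circle_cis_to_circle)
    then show ?thesis using y t by simp
  qed
  then show "\<exists>d>0. \<forall>x'\<in>UNIV. dist x' x < d \<longrightarrow> dist (circle_cis x') (circle_cis x) < e"
    using d(1) by blast
qed

lemma ex_circle_lift:
  assumes "continuous_on UNIV f"
  obtains F :: "real \<Rightarrow> real" where "continuous_on UNIV F" "\<And>t. to_circle (F t) = f (to_circle t)"
proof -
  have "continuous_on UNIV (\<lambda>t. circle_cis (f (to_circle t)))"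
    by (rule continuous_on_compose2[OF continuous_circle_cis
          continuous_on_compose2[OF assms continuous_on_to_circle]]) auto
  then obtain g where g: "continuous_on UNIV g" "\<And>t. circle_cis (f (to_circle t)) = exp (g t)"
    by (rule continuous_logarithm_on_contractible) (auto simp: circle_cis_def convex_imp_contractible)
  define F where "F = (\<lambda>t. Im (g t) / (2 * pi))"
  show ?thesis
  proof
    show "continuous_on UNIV F"
      unfolding F_def using g(1) by (intro continuous_intros) auto
    fix t
    define s where "s = circle_rep (f (to_circle t))"
    have fs: "f (to_circle t) = to_circle s" by (simp add: s_def to_circle_rep)
    have "cis (2 * pi * s) = exp (g t)" using g(2)[of t] unfolding fs circle_cis_to_circle .
    then have "norm (exp (g t)) = 1" by (metis norm_cis)
    then have "Re (g t) = 0" by simp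
    then have "exp (g t) = cis (Im (g t))"
      by (simp add: exp_eq_polar)
    also have "Im (g t) = 2 * pi * F t" by (simp add: F_def)
    finally have "cis (2 * pi * s) = cis (2 * pi * F t)"
      using \<open>cis (2 * pi * s) = exp (g t)\<close> by simp
    then have "cis (2 * pi * s - 2 * pi * F t) = 1"
      by (simp add: cis_divide[symmetric])
    then have "cos (2 * pi * s - 2 * pi * F t) = 1"
      by (metis cis.sel(1) one_complex.sel(1))
    then obtain k :: int where "2 * pi * s - 2 * pi * F t = of_int k * 2 * pi"
      using cos_one_2pi_int by blast
    then have "2 * pi * (s - F t) = 2 * pi * of_int k" by (simp add: algebra_simps)
    then have "s - F t = of_int k" by simp
    then show "to_circle (F t) = f (to_circle t)"
      unfolding fs to_circle_eq_iff by (metis Ints_minus Ints_of_int minus_diff_eq)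
  qed
qed

text \<open>Continuity keeps \<open>F (t + h) - F t\<close> within \<open>(-1/2, 1/2)\<close> for
  small \<open>h\<close>. There \<open>circle_rep\<close> undoes \<open>to_circle\<close>, so the
  chart expression of \<open>f\<close> agrees with the increment of \<open>F\<close> near 0.\<close>

lemma lift_has_derivative:
  assumes F: "isCont F t" "\<And>t. to_circle (F t) = f (to_circle t)"
    and D: "has_circle_deriv f D (to_circle t)"
  shows "(F has_real_derivative D) (at t)"
proof -
  have "(\<lambda>h. F (t + h)) \<midarrow>0\<rightarrow> F t" using F(1) by (simp add: isCont_iff)
  then have "eventually (\<lambda>h. dist (F (t + h)) (F t) < 1 / 2) (at 0)"
    by (rule tendstoD) simp
  then have "eventually (\<lambda>h. circle_rep (f (to_circle t + to_circle h) - f (to_circle t)) = F (t + h) - F t) (at 0)"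
  proof eventually_elim
    case (elim h)
    have "f (to_circle t + to_circle h) - f (to_circle t) = to_circle (F (t + h) - F t)"
      by (simp add: F(2) to_circle_diff to_circle_add)
    moreover have "circle_rep (to_circle (F (t + h) - F t)) = F (t + h) - F t"
      using elim unfolding dist_real_def by (intro circle_rep_to_circle) linarith+
    ultimately show ?case by simp
  qed
  moreover have "circle_rep (f (to_circle t + to_circle 0) - f (to_circle t)) = F (t + 0) - F t"
    using circle_rep_to_circle[of 0] by (simp add: to_circle_0)
  ultimately have "eventually (\<lambda>h. circle_rep (f (to_circle t + to_circle h) - f (to_circle t)) = F (t + h) - F t) (nhds 0)"
    unfolding eventually_nhds_conv_at by blast
  then have "((\<lambda>h. F (t + h) - F t) has_real_derivative D) (at 0)"
    using D unfolding has_circle_deriv_def by (subst (asm) DERIV_cong_ev[OF refl _ refl])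
  then have "((\<lambda>h. F (t + h) - F t + F t) has_real_derivative D + 0) (at 0)"
    by (intro derivative_intros)
  then show ?thesis
    using DERIV_shift[of F D 0 t] by (simp add: add.commute)
qed

section \<open>Hyperbolic times\<close>

text \<open>The preimage is the image of \<open>{a..b}\<close> under the continuous inverse, hence
  connected and compact. It serves to pull an interval back along one branch.\<close>

lemma vimage_Icc_inj:
  fixes \<phi> :: "real \<Rightarrow> real"
  assumes cont: "continuous_on {l..r} \<phi>" and inj: "inj_on \<phi> {l..r}" and sub: "{a..b} \<subseteq> \<phi> ` {l..r}"
  obtains a' b' where "{l..r} \<inter> \<phi> -` {a..b} = {a'..b'}" "\<phi> ` {a'..b'} = {a..b}"
proof -
  have im: "\<phi> ` ({l..r} \<inter> \<phi> -` {a..b}) = {a..b}" using sub by blast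
  let ?g = "the_inv_into {l..r} \<phi>"
  have "continuous_on (\<phi> ` {l..r}) ?g"
    by (rule continuous_on_inv[OF cont]) (auto simp: inj the_inv_into_f_f)
  then have cg: "continuous_on {a..b} ?g" using sub continuous_on_subset by blast
  have eq: "?g ` {a..b} = {l..r} \<inter> \<phi> -` {a..b}"
  proof
    show "?g ` {a..b} \<subseteq> {l..r} \<inter> \<phi> -` {a..b}"
      using sub f_the_inv_into_f[OF inj] the_inv_into_into[OF inj _ order_refl] by (auto simp: subset_iff)
    show "{l..r} \<inter> \<phi> -` {a..b} \<subseteq> ?g ` {a..b}"
      by (metis (no_types, lifting) IntD1 IntD2 image_eqI inj subsetI the_inv_into_f_f vimageD)
  qed
  have "connected ({l..r} \<inter> \<phi> -` {a..b})" "compact ({l..r} \<inter> \<phi> -` {a..b})"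
    unfolding eq[symmetric] using cg connected_continuous_image compact_continuous_image
    by (blast intro: connected_Icc compact_Icc)+
  then obtain a' b' where "{l..r} \<inter> \<phi> -` {a..b} = {a'..b'}"
    using connected_compact_interval_1[of "{l..r} \<inter> \<phi> -` {a..b}"] by (auto simp: box_real)
  with im that show ?thesis by metis
qed

text \<open>An injective continuous function is monotone, so the values at the two end points lie on
  opposite sides of \<open>\<phi> z\<close>, each at distance at least \<open>r\<close>; the
  intermediate value theorem does the rest.\<close>

lemma Icc_subset_image:
  fixes \<phi> :: "real \<Rightarrow> real"
  assumes cont: "continuous_on {z - \<rho>..z + \<rho>} \<phi>" and inj: "inj_on \<phi> {z - \<rho>..z + \<rho>}" and "\<rho> \<ge> 0"
    and "\<bar>\<phi> (z - \<rho>) - \<phi> z\<bar> \<ge> r" "\<bar>\<phi> (z + \<rho>) - \<phi> z\<bar> \<ge> r"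
  shows "{\<phi> z - r..\<phi> z + r} \<subseteq> \<phi> ` {z - \<rho>..z + \<rho>}"
proof
  fix y assume y: "y \<in> {\<phi> z - r..\<phi> z + r}"
  have "strict_mono_on {z - \<rho>..z + \<rho>} \<phi> \<or> strict_antimono_on {z - \<rho>..z + \<rho>} \<phi>"
    using injective_eq_monotone_map[of "{z - \<rho>..z + \<rho>}" \<phi>] cont inj by (simp add: is_interval_cc)
  then consider "\<phi> (z - \<rho>) \<le> \<phi> z \<and> \<phi> z \<le> \<phi> (z + \<rho>)" | "\<phi> (z - \<rho>) \<ge> \<phi> z \<and> \<phi> z \<ge> \<phi> (z + \<rho>)"
    using \<open>\<rho> \<ge> 0\<close> unfolding monotone_on_def
    by (cases "\<rho> = 0") (auto simp: less_imp_le)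
  then have "\<phi> (z - \<rho>) \<le> y \<and> y \<le> \<phi> (z + \<rho>) \<or> \<phi> (z + \<rho>) \<le> y \<and> y \<le> \<phi> (z - \<rho>)"
    by cases (use assms(4,5) y in auto)
  then show "y \<in> \<phi> ` {z - \<rho>..z + \<rho>}"
  proof
    assume "\<phi> (z - \<rho>) \<le> y \<and> y \<le> \<phi> (z + \<rho>)"
    then obtain x where "z - \<rho> \<le> x" "x \<le> z + \<rho>" "\<phi> x = y"
      using IVT'[of \<phi> "z - \<rho>" y "z + \<rho>"] cont \<open>\<rho> \<ge> 0\<close> by auto
    then show ?thesis by auto
  next
    assume "\<phi> (z + \<rho>) \<le> y \<and> y \<le> \<phi> (z - \<rho>)"
    then obtain x where "z - \<rho> \<le> x" "x \<le> z + \<rho>" "\<phi> x = y"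
      using IVT2'[of \<phi> "z + \<rho>" y "z - \<rho>"] cont \<open>\<rho> \<ge> 0\<close> by auto
    then show ?thesis by auto
  qed
qed

lemma mvt_abs_bounds:
  fixes F :: "real \<Rightarrow> real"
  assumes "\<And>w. w \<in> {l..r} \<Longrightarrow> (F has_real_derivative g w) (at w)"
    and "\<And>w. w \<in> {l..r} \<Longrightarrow> m \<le> \<bar>g w\<bar> \<and> \<bar>g w\<bar> \<le> M" and uv: "u \<in> {l..r}" "v \<in> {l..r}"
  shows "m * \<bar>u - v\<bar> \<le> \<bar>F u - F v\<bar> \<and> \<bar>F u - F v\<bar> \<le> M * \<bar>u - v\<bar>"
proof -
  have *: "m * \<bar>u - v\<bar> \<le> \<bar>F u - F v\<bar> \<and> \<bar>F u - F v\<bar> \<le> M * \<bar>u - v\<bar>"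
    if "u < v" "u \<in> {l..r}" "v \<in> {l..r}" for u v
  proof -
    have "(F has_real_derivative g w) (at w)" if "u \<le> w" "w \<le> v" for w
      using that \<open>u \<in> {l..r}\<close> \<open>v \<in> {l..r}\<close> by (intro assms(1)) auto
    then obtain w where "u < w" "w < v" "F v - F u = (v - u) * g w"
      using MVT2[OF \<open>u < v\<close>] by blast
    moreover have "\<bar>g w\<bar> * \<bar>u - v\<bar> \<le> M * \<bar>u - v\<bar>" "m * \<bar>u - v\<bar> \<le> \<bar>g w\<bar> * \<bar>u - v\<bar>"
      using assms(2)[of w] that calculation by (auto intro!: mult_right_mono)
    moreover have "\<bar>F u - F v\<bar> = \<bar>g w\<bar> * \<bar>u - v\<bar>"
      using calculation by (metis abs_minus_commute abs_mult mult.commute)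
    ultimately show ?thesis by simp
  qed
  consider "u < v" | "v < u" | "u = v" by linarith
  then show ?thesis
  proof cases
    case 1 then show ?thesis using * uv by blast
  next
    case 2 then show ?thesis using *[of v u] uv by (simp add: abs_minus_commute)
  qed simp
qed

section \<open>Distance to the critical set and distortion at hyperbolic times\<close>

locale hyperbolic_circle_map =
  fixes f :: "circle \<Rightarrow> circle" and B \<beta> \<sigma> \<delta> :: real
  assumes has_deriv: "has_circle_deriv f (circle_deriv f x) x"
    and closed_critical: "closed (critical_set f)"
    and nondeg: "nondegenerate_critical_set f B \<beta>"
    and \<sigma>: "0 < \<sigma>" "\<sigma> < 1" and \<delta>: "0 < \<delta>" "\<delta> < 1"
begin

lemma B: "B > 1" and \<beta>: "\<beta> > 0"
  using nondeg by (auto simp: nondegenerate_critical_set_def)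

lemma critical_iff: "x \<in> critical_set f \<longleftrightarrow> circle_deriv f x = 0"
  unfolding critical_set_def mem_Collect_eq
  using has_deriv[of x] has_circle_deriv_imp_circle_deriv by metis

lemma continuous_f: "continuous_on UNIV f"
  unfolding continuous_on_eq_continuous_at[OF open_UNIV]
proof safe
  fix x
  have "isCont (\<lambda>h. circle_rep (f (x + to_circle h) - f x)) 0"
    using has_deriv[of x] unfolding has_circle_deriv_def by (rule DERIV_isCont)
  then have "(\<lambda>h. circle_rep (f (x + to_circle h) - f x)) \<midarrow>0\<rightarrow> 0"
    using circle_rep_to_circle[of 0] by (simp add: isCont_def to_circle_0)
  then have lim: "\<forall>e>0. \<exists>d>0. \<forall>h. h \<noteq> 0 \<and> \<bar>h\<bar> < d \<longrightarrow> \<bar>circle_rep (f (x + to_circle h) - f x)\<bar> < e"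
    by (simp add: LIM_def dist_real_def)
  show "isCont f x"
    unfolding continuous_at_eps_delta
  proof safe
    fix e :: real assume "e > 0"
    then obtain d where d: "d > 0" "\<And>h. h \<noteq> 0 \<Longrightarrow> \<bar>h\<bar> < d \<Longrightarrow> \<bar>circle_rep (f (x + to_circle h) - f x)\<bar> < e"
      using lim by metis
    have "dist (f y) (f x) < e" if "dist y x < d" for y
    proof (cases "y = x")
      case False
      have "circle_rep (y - x) \<noteq> 0"
        using False by (metis to_circle_rep to_circle_0 right_minus_eq)
      moreover have "x + to_circle (circle_rep (y - x)) = y" by (simp add: to_circle_rep)
      ultimately show ?thesis
        using d(2)[of "circle_rep (y - x)"] that unfolding dist_circle_def by metis
    qed (simp add: \<open>e > 0\<close>)
    then show "\<exists>d>0. \<forall>x'. dist x' x < d \<longrightarrow> dist (f x') (f x) < e" using d(1) by blast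
  qed
qed

lemma crit_dist_pos: "x \<notin> critical_set f \<Longrightarrow> crit_dist f x > 0"
  unfolding crit_dist_def using closed_critical
  by (metis in_closed_iff_infdist_zero infdist_nonneg less_eq_real_def zero_less_one)

text \<open>A point closer to \<open>z\<close> than the critical set cannot be critical, so (S2)
  applies to the pair. Passing from the inverse derivative to the derivative only changes the sign
  of the logarithms.\<close>

lemma distortion_step:
  assumes z: "to_circle z \<notin> critical_set f" and w: "\<bar>w - z\<bar> < crit_dist f (to_circle z) / 2"
  shows "circle_deriv f (to_circle w) \<noteq> 0"
    and "\<bar>(ln \<bar>circle_deriv f (to_circle z)\<bar>) - (ln \<bar>circle_deriv f (to_circle w)\<bar>)\<bar>
      \<le> B * (\<bar>w - z\<bar> / crit_dist f (to_circle z) powr \<beta>)"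
proof -
  have d: "dist (to_circle z) (to_circle w) \<le> \<bar>w - z\<bar>"
    using dist_to_circle_le[of z w] by (simp add: dist_real_def abs_minus_commute)
  have wC: "to_circle w \<notin> critical_set f"
  proof
    assume "to_circle w \<in> critical_set f"
    then have "crit_dist f (to_circle z) \<le> dist (to_circle z) (to_circle w)"
      unfolding crit_dist_def by (auto intro: infdist_le)
    then show False using d w by linarith
  qed
  then show "circle_deriv f (to_circle w) \<noteq> 0" using critical_iff by blast
  have "\<bar>(ln \<bar>inverse (circle_deriv f (to_circle z))\<bar>) - (ln \<bar>inverse (circle_deriv f (to_circle w))\<bar>)\<bar>
      \<le> B * (dist (to_circle z) (to_circle w) / crit_dist f (to_circle z) powr \<beta>)"
    using nondeg z wC d w unfolding nondegenerate_critical_set_def by (meson ComplI le_less_trans)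
  also have "\<dots> \<le> B * (\<bar>w - z\<bar> / crit_dist f (to_circle z) powr \<beta>)"
    using d B by (intro mult_left_mono divide_right_mono) auto
  finally show "\<bar>(ln \<bar>circle_deriv f (to_circle z)\<bar>) - (ln \<bar>circle_deriv f (to_circle w)\<bar>)\<bar>
      \<le> B * (\<bar>w - z\<bar> / crit_dist f (to_circle z) powr \<beta>)"
    using z wC critical_iff by (simp add: abs_inverse ln_inverse)
qed

text \<open>Of the contraction \<open>\<sigma> ^ k = q ^ (4 * k)\<close>, two factors \<open>q ^ k\<close> pay for the closeness to the critical
  set, as both \<open>b\<close> and \<open>b * \<beta>\<close> are at most \<open>1 / 2\<close>. A third one absorbs the accumulated distortion
  \<open>exp (s\<^sub>1 k)\<close>, and the last one makes the distortions \<open>c\<^sub>1 * q ^ k\<close> summable.\<close>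

definition q :: real where "q = \<sigma> powr (1 / 4)"

definition \<delta>\<^sub>1 :: real where "\<delta>\<^sub>1 = min (\<delta> / 4) (- ln q * \<delta> powr \<beta> / B)"

definition c\<^sub>1 :: real where "c\<^sub>1 = B * \<delta>\<^sub>1 / \<delta> powr \<beta>"

lemma q: "0 < q" "q < 1"
  unfolding q_def using \<sigma> powr_less_mono2[of "1/4" \<sigma> 1] by simp_all

lemma ln_q: "ln q < 0" using q by simp

lemma q_power: "q ^ (4 * k) = \<sigma> ^ k"
proof -
  have "q ^ 4 = \<sigma>"
    using \<sigma> unfolding q_def by (simp add: powr_power)
  then show ?thesis by (simp add: power_mult)
qed

lemma q_powr: "q ^ (2 * k) = \<sigma> powr (real k / 2)"
  using \<sigma> unfolding q_def by (simp add: powr_power)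

lemma \<delta>\<^sub>1: "0 < \<delta>\<^sub>1" "\<delta>\<^sub>1 \<le> \<delta> / 4"
  unfolding \<delta>\<^sub>1_def using \<delta> B ln_q by (auto simp: min_def mult_neg_pos divide_neg_pos)

lemma c\<^sub>1: "0 < c\<^sub>1" "c\<^sub>1 \<le> - ln q"
proof -
  show "0 < c\<^sub>1" unfolding c\<^sub>1_def using \<delta>\<^sub>1 \<delta> B by simp
  have "\<delta>\<^sub>1 \<le> - ln q * \<delta> powr \<beta> / B" unfolding \<delta>\<^sub>1_def by simp
  then show "c\<^sub>1 \<le> - ln q" unfolding c\<^sub>1_def using B \<delta> by (simp add: field_simps)
qed

text \<open>A truncated distance of 1 only says that the distance is at least
  \<open>\<delta>\<close>; this is where the factors \<open>\<delta>\<close> and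
  \<open>\<delta> powr \<beta>\<close> come from. The exponents combine \<open>b \<le> 1 / 2\<close>
  and \<open>b * \<beta> \<le> 1 / 2\<close> with
  \<open>q ^ (2 * k) = \<sigma> powr (k / 2)\<close>.\<close>

lemma hyperbolic_time_crit_dist:
  assumes h: "hyperbolic_time f \<beta> \<sigma> \<delta> x n" and k: "1 \<le> k" "k \<le> n"
  defines "z \<equiv> (f ^^ (n - k)) x"
  shows "z \<notin> critical_set f" "crit_dist f z \<ge> \<delta> * q ^ (2 * k)" "crit_dist f z powr \<beta> \<ge> \<delta> powr \<beta> * q ^ (2 * k)"
proof -
  let ?b = "min (1 / 2) (1 / (2 * \<beta>))"
  have t: "trunc_crit_dist f \<delta> z \<ge> \<sigma> powr (?b * real k)"
    using h k unfolding hyperbolic_time_def z_def by auto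
  have pos: "\<sigma> powr (?b * real k) > 0" using \<sigma> by simp
  show "z \<notin> critical_set f"
  proof
    assume "z \<in> critical_set f"
    then have "crit_dist f z = 0" unfolding crit_dist_def by auto
    then show False using t pos \<delta> unfolding trunc_crit_dist_def by auto
  qed
  have le1: "\<sigma> powr (?b * real k) \<le> 1" using \<sigma> \<beta> by (intro powr_le1) auto
  have cd: "crit_dist f z \<ge> \<delta> * \<sigma> powr (?b * real k)"
  proof (cases "crit_dist f z < \<delta>")
    case True
    then have "crit_dist f z \<ge> \<sigma> powr (?b * real k)" using t unfolding trunc_crit_dist_def by simp
    then show ?thesis using \<delta> pos by (smt (verit) mult_left_le_one_le)
  next
    case False
    then show ?thesis using \<delta> pos le1 by (smt (verit) mult_left_le)
  qed
  have "?b * real k \<le> 1 / 2 * real k" by (intro mult_right_mono) auto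
  then have "\<sigma> powr (?b * real k) \<ge> \<sigma> powr (real k / 2)"
    using \<sigma> by (intro powr_mono') auto
  then have "\<delta> * q ^ (2 * k) \<le> \<delta> * \<sigma> powr (?b * real k)"
    using \<delta> unfolding q_powr by (intro mult_left_mono) auto
  with cd show "crit_dist f z \<ge> \<delta> * q ^ (2 * k)" by linarith
  have "?b * \<beta> \<le> 1 / 2"
    using \<beta> by (simp add: min_def field_simps)
  then have "?b * \<beta> * real k \<le> 1 / 2 * real k" by (intro mult_right_mono) auto
  then have "\<sigma> powr (real k / 2) \<le> \<sigma> powr (?b * real k * \<beta>)"
    using \<sigma> by (intro powr_mono') (auto simp: mult_ac)
  then have "\<delta> powr \<beta> * q ^ (2 * k) \<le> (\<delta> * \<sigma> powr (?b * real k)) powr \<beta>"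
    using \<delta> \<sigma> unfolding q_powr by (simp add: powr_mult powr_powr mult_left_mono)
  also have "\<dots> \<le> crit_dist f z powr \<beta>"
    using cd \<beta> \<delta> pos by (intro powr_mono2) auto
  finally show "crit_dist f z powr \<beta> \<ge> \<delta> powr \<beta> * q ^ (2 * k)" .
qed

lemma hyperbolic_time_prod:
  assumes h: "hyperbolic_time f \<beta> \<sigma> \<delta> x n" and k: "k \<le> n"
  shows "(\<Prod>j\<in>{n - k..<n}. \<bar>circle_deriv f ((f ^^ j) x)\<bar>) \<ge> 1 / q ^ (4 * k)"
proof (cases "k = 0")
  case False
  let ?P = "\<Prod>j\<in>{n - k..<n}. \<bar>circle_deriv f ((f ^^ j) x)\<bar>"
  have "circle_deriv f ((f ^^ j) x) \<noteq> 0" if "j \<in> {n - k..<n}" for j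
    using hyperbolic_time_crit_dist(1)[OF h, of "n - j"] that critical_iff
    by (auto simp: Suc_le_eq)
  then have pos: "?P > 0" by (intro prod_pos) auto
  have "inverse ?P = (\<Prod>j\<in>{n - k..<n}. \<bar>inverse (circle_deriv f ((f ^^ j) x))\<bar>)"
    by (simp add: prod_inversef abs_inverse flip: prod_inversef)
  also have "\<dots> \<le> q ^ (4 * k)"
    using h k False unfolding hyperbolic_time_def q_power by auto
  finally show ?thesis
    using pos q(1) by (simp add: field_simps)
qed simp

definition s\<^sub>1 :: "nat \<Rightarrow> real" where "s\<^sub>1 k = (\<Sum>i\<in>{1..k}. c\<^sub>1 * q ^ i)"

definition S\<^sub>1 :: real where "S\<^sub>1 = c\<^sub>1 / (1 - q)"

lemma s\<^sub>1_Suc: "s\<^sub>1 (Suc k) = s\<^sub>1 k + c\<^sub>1 * q ^ Suc k"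
  by (simp add: s\<^sub>1_def)

text \<open>Every summand is at most \<open>c\<^sub>1 \<le> - ln q\<close>, so each step multiplies
  the distortion by at most \<open>1 / q\<close>. This is what the second bound in
  \<open>\<delta>\<^sub>1\<close> provides.\<close>

lemma exp_s\<^sub>1_le: "exp (s\<^sub>1 k) \<le> 1 / q ^ k"
proof (induction k)
  case 0
  then show ?case by (simp add: s\<^sub>1_def)
next
  case (Suc k)
  have "c\<^sub>1 * q ^ Suc k \<le> c\<^sub>1" using c\<^sub>1 q power_le_one[of q "Suc k"] by (simp add: mult_left_le del: power_Suc)
  then have "c\<^sub>1 * q ^ Suc k \<le> - ln q" using c\<^sub>1 by linarith
  then have "exp (c\<^sub>1 * q ^ Suc k) \<le> exp (- ln q)" by simp
  also have "\<dots> = 1 / q" using q by (simp add: exp_minus divide_inverse)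
  finally have "exp (s\<^sub>1 k) * exp (c\<^sub>1 * q ^ Suc k) \<le> (1 / q ^ k) * (1 / q)"
    using Suc q by (intro mult_mono) auto
  then show ?case by (simp add: s\<^sub>1_Suc exp_add mult.commute del: power_Suc) (simp add: mult.commute)
qed

lemma s\<^sub>1_le: "s\<^sub>1 k \<le> S\<^sub>1"
proof -
  have "s\<^sub>1 k \<le> (\<Sum>i<Suc k. c\<^sub>1 * q ^ i)"
    unfolding s\<^sub>1_def using c\<^sub>1 q by (intro sum_mono2) auto
  also have "\<dots> = c\<^sub>1 * ((1 - q ^ Suc k) / (1 - q))"
    using q by (simp add: sum_distrib_left[symmetric] sum_gp_strict del: power_Suc sum.lessThan_Suc)
  also have "\<dots> \<le> c\<^sub>1 * (1 / (1 - q))"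
    using c\<^sub>1 q by (intro mult_left_mono divide_right_mono) auto
  finally show ?thesis by (simp add: S\<^sub>1_def)
qed

end

section \<open>Pulling intervals back from a hyperbolic time\<close>

locale hyperbolic_lift = hyperbolic_circle_map +
  fixes F :: "real \<Rightarrow> real"
  assumes contF: "continuous_on UNIV F" and lift: "to_circle (F t) = f (to_circle t)"
begin

lemma lift_deriv: "(F has_real_derivative circle_deriv f (to_circle t)) (at t)"
  using contF by (intro lift_has_derivative[OF _ lift has_deriv]) (simp add: continuous_on_eq_continuous_at)

lemma lift_funpow: "to_circle ((F ^^ k) t) = (f ^^ k) (to_circle t)"
  by (induction k) (simp_all add: lift)

lemma continuous_lift_funpow: "continuous_on A (F ^^ k)"
proof (induction k)
  case (Suc k)
  then show ?case
    unfolding funpow.simps using continuous_on_subset[OF contF subset_UNIV]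
    by (intro continuous_on_compose)
qed (simp add: continuous_on_id id_def)

lemma lift_bilipschitz:
  assumes z: "to_circle z \<notin> critical_set f" and \<rho>: "0 \<le> \<rho>" "\<rho> < crit_dist f (to_circle z) / 2"
    and c: "B * (\<rho> / crit_dist f (to_circle z) powr \<beta>) \<le> c"
    and uv: "u \<in> {z - \<rho>..z + \<rho>}" "v \<in> {z - \<rho>..z + \<rho>}"
  defines "m \<equiv> \<bar>circle_deriv f (to_circle z)\<bar>"
  shows "exp (- c) * m * \<bar>u - v\<bar> \<le> \<bar>F u - F v\<bar> \<and> \<bar>F u - F v\<bar> \<le> exp c * m * \<bar>u - v\<bar>"
proof (rule mvt_abs_bounds[OF lift_deriv _ uv])
  fix w assume w: "w \<in> {z - \<rho>..z + \<rho>}"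
  have m: "m > 0" using z critical_iff by (auto simp: m_def)
  have wz: "\<bar>w - z\<bar> \<le> \<rho>" using w by auto
  then have wz': "\<bar>w - z\<bar> < crit_dist f (to_circle z) / 2" using \<rho> by simp
  let ?g = "circle_deriv f (to_circle w)"
  have g: "\<bar>?g\<bar> > 0" using distortion_step(1)[OF z wz'] by simp
  have "\<bar>(ln m) - ln \<bar>?g\<bar>\<bar> \<le> B * (\<bar>w - z\<bar> / crit_dist f (to_circle z) powr \<beta>)"
    using distortion_step(2)[OF z wz'] by (simp add: m_def)
  also have "\<dots> \<le> B * (\<rho> / crit_dist f (to_circle z) powr \<beta>)"
    using wz B by (intro mult_left_mono divide_right_mono) auto
  also have "\<dots> \<le> c" by (rule c)
  finally have "- c + ln m \<le> ln \<bar>?g\<bar>" "ln \<bar>?g\<bar> \<le> c + ln m" by linarith+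
  then have "exp (- c + ln m) \<le> exp (ln \<bar>?g\<bar>)" "exp (ln \<bar>?g\<bar>) \<le> exp (c + ln m)" by simp_all
  then show "exp (- c) * m \<le> \<bar>?g\<bar> \<and> \<bar>?g\<bar> \<le> exp c * m"
    using g m unfolding exp_add by simp
qed

text \<open>Backward induction from time \<open>n\<close>: the interval of radius
  \<open>\<delta>\<^sub>1\<close> about \<open>(F ^^ n) t\<close> is pulled back along one branch of
  \<open>F\<close> at a time. By the inductive expansion bound the current preimage is so short that
  it lies in the image of a window about the orbit point, and this window is small compared with the
  distance to the critical set. The distortion \<open>c\<^sub>1 * q ^ Suc k\<close> of the new step
  is added to \<open>s\<^sub>1 k\<close>.\<close>

lemma hyperbolic_pull_back:
  assumes h: "hyperbolic_time f \<beta> \<sigma> \<delta> (to_circle t) n" and k: "k \<le> n"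
  defines "P \<equiv> \<lambda>k. \<Prod>j\<in>{n - k..<n}. \<bar>circle_deriv f ((f ^^ j) (to_circle t))\<bar>"
  shows "\<exists>a b. (F ^^ (n - k)) t \<in> {a..b} \<and> (F ^^ k) ` {a..b} = {(F ^^ n) t - \<delta>\<^sub>1..(F ^^ n) t + \<delta>\<^sub>1} \<and>
    (\<forall>u\<in>{a..b}. \<forall>v\<in>{a..b}. exp (- s\<^sub>1 k) * P k * \<bar>u - v\<bar> \<le> \<bar>(F ^^ k) u - (F ^^ k) v\<bar> \<and>
       \<bar>(F ^^ k) u - (F ^^ k) v\<bar> \<le> exp (s\<^sub>1 k) * P k * \<bar>u - v\<bar>)"
  using k
proof (induction k)
  case 0
  show ?case
    using \<delta>\<^sub>1 by (intro exI[of _ "(F ^^ n) t - \<delta>\<^sub>1"] exI[of _ "(F ^^ n) t + \<delta>\<^sub>1"]) (simp add: P_def s\<^sub>1_def)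
next
  case (Suc k)
  define z where "z = (F ^^ (n - Suc k)) t"
  \<comment> \<open>The window radius. Two of the three factors \<open>q ^ Suc k\<close> match the
    lower bounds for the critical distance and its power, the third makes the distortion on the
    window at most \<open>c\<close>. The preimage still fits, since
    \<open>exp (s\<^sub>1 (Suc k)) / P (Suc k) \<le> q ^ (3 * Suc k)\<close>.\<close>
  define \<rho> where "\<rho> = \<delta>\<^sub>1 * q ^ (3 * Suc k)"
  define c where "c = c\<^sub>1 * q ^ Suc k"
  define m where "m = \<bar>circle_deriv f (to_circle z)\<bar>"
  have nk: "n - k = Suc (n - Suc k)" using Suc.prems by simp
  have Fz: "F z = (F ^^ (n - k)) t" unfolding z_def nk by simp
  have iter: "(F ^^ Suc k) u = (F ^^ k) (F u)" for u by (simp only: funpow_Suc_right o_apply)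
  have zf: "to_circle z = (f ^^ (n - Suc k)) (to_circle t)" unfolding z_def by (rule lift_funpow)
  note cd = hyperbolic_time_crit_dist[OF h, of "Suc k", folded zf]
  have zC: "to_circle z \<notin> critical_set f" using cd(1) Suc.prems by simp
  have m: "m > 0" using zC critical_iff by (auto simp: m_def)
  have "{n - Suc k..<n} = insert (n - Suc k) {n - k..<n}" using Suc.prems by auto
  then have PS: "P (Suc k) = m * P k"
    unfolding P_def m_def zf using nk by simp
  have PS_ge: "P (Suc k) \<ge> 1 / q ^ (4 * Suc k)" "P k \<ge> 1 / q ^ (4 * k)"
    unfolding P_def using hyperbolic_time_prod[OF h, of "Suc k"] hyperbolic_time_prod[OF h, of k]
      Suc.prems by simp_all
  then have Pk: "P k > 0" using q by (smt (verit) zero_less_divide_1_iff zero_less_power)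
  have q3: "q ^ (3 * Suc k) = q ^ (2 * Suc k) * q ^ Suc k"
  proof -
    have "3 * Suc k = 2 * Suc k + Suc k" by simp
    then show ?thesis by (simp only: power_add)
  qed
  have \<rho>0: "0 \<le> \<rho>" unfolding \<rho>_def using \<delta>\<^sub>1 q by simp
  have "\<rho> \<le> \<delta>\<^sub>1 * q ^ (2 * Suc k)"
    unfolding \<rho>_def q3 using \<delta>\<^sub>1 q by (intro mult_left_mono) (auto simp: mult_left_le power_le_one simp del: power_Suc)
  also have "\<dots> \<le> \<delta> / 4 * q ^ (2 * Suc k)" using \<delta>\<^sub>1 q by (intro mult_right_mono) auto
  also have "\<dots> < \<delta> * q ^ (2 * Suc k) / 2" using \<delta> q by simp
  also have "\<dots> \<le> crit_dist f (to_circle z) / 2" using cd(2) Suc.prems by simp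
  finally have \<rho>: "\<rho> < crit_dist f (to_circle z) / 2" .
  have "\<rho> / crit_dist f (to_circle z) powr \<beta> \<le> \<rho> / (\<delta> powr \<beta> * q ^ (2 * Suc k))"
    using cd(3) Suc.prems \<rho>0 \<delta> q by (intro frac_le) (simp_all del: power_Suc mult_Suc_right)
  also have "\<dots> = \<delta>\<^sub>1 / \<delta> powr \<beta> * q ^ Suc k"
    unfolding \<rho>_def q3 using q by (simp add: field_simps del: power_Suc)
  finally have "B * (\<rho> / crit_dist f (to_circle z) powr \<beta>) \<le> B * (\<delta>\<^sub>1 / \<delta> powr \<beta> * q ^ Suc k)"
    using B by (intro mult_left_mono) auto
  also have "\<dots> = c" by (simp add: c_def c\<^sub>1_def)
  finally have c: "B * (\<rho> / crit_dist f (to_circle z) powr \<beta>) \<le> c" .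
  note bl = lift_bilipschitz[OF zC \<rho>0 \<rho> c, folded m_def]
  have inj: "inj_on F {z - \<rho>..z + \<rho>}"
  proof (rule inj_onI)
    fix u v assume uv: "u \<in> {z - \<rho>..z + \<rho>}" "v \<in> {z - \<rho>..z + \<rho>}" "F u = F v"
    then have "exp (- c) * m * \<bar>u - v\<bar> \<le> 0" using bl[OF uv(1,2)] by simp
    then show "u = v" using m by (simp add: mult_le_0_iff)
  qed
  \<comment> \<open>By the lower Lipschitz bound the image of the window contains the interval of
    this radius about \<open>F z\<close>.\<close>
  define r where "r = exp (- c) * m * \<rho>"
  have ball: "{F z - r..F z + r} \<subseteq> F ` {z - \<rho>..z + \<rho>}"
    using bl[of "z - \<rho>" z] bl[of "z + \<rho>" z] \<rho>0
    by (intro Icc_subset_image[OF continuous_on_subset[OF contF subset_UNIV] inj]) (auto simp: r_def)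
  from Suc obtain a b where ab: "(F ^^ (n - k)) t \<in> {a..b}"
    "(F ^^ k) ` {a..b} = {(F ^^ n) t - \<delta>\<^sub>1..(F ^^ n) t + \<delta>\<^sub>1}"
    "\<And>u v. u \<in> {a..b} \<Longrightarrow> v \<in> {a..b} \<Longrightarrow> exp (- s\<^sub>1 k) * P k * \<bar>u - v\<bar> \<le> \<bar>(F ^^ k) u - (F ^^ k) v\<bar> \<and>
       \<bar>(F ^^ k) u - (F ^^ k) v\<bar> \<le> exp (s\<^sub>1 k) * P k * \<bar>u - v\<bar>"
    by (auto simp del: atLeastAtMost_iff)
  have "{a..b} \<subseteq> {F z - r..F z + r}"
  proof
    fix u assume u: "u \<in> {a..b}"
    have "(F ^^ k) (F z) = (F ^^ n) t"
      unfolding Fz using Suc.prems by (simp add: funpow_add[symmetric, THEN fun_cong, unfolded o_apply])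
    moreover have "(F ^^ k) u \<in> {(F ^^ n) t - \<delta>\<^sub>1..(F ^^ n) t + \<delta>\<^sub>1}" using ab(2) u by blast
    ultimately have "\<bar>(F ^^ k) u - (F ^^ k) (F z)\<bar> \<le> \<delta>\<^sub>1" by auto
    then have "exp (- s\<^sub>1 k) * P k * \<bar>u - F z\<bar> \<le> \<delta>\<^sub>1"
      using ab(3)[OF u, of "F z"] ab(1) Fz by simp
    then have *: "\<bar>u - F z\<bar> \<le> \<delta>\<^sub>1 * exp (s\<^sub>1 k) / P k"
      using Pk by (simp add: field_simps exp_minus)
    have "exp (s\<^sub>1 k) * exp c = exp (s\<^sub>1 (Suc k))" by (simp add: s\<^sub>1_Suc c_def exp_add)
    also have "\<dots> \<le> 1 / q ^ Suc k" by (rule exp_s\<^sub>1_le)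
    also have "\<dots> = (1 / q ^ (4 * Suc k)) * q ^ (3 * Suc k)"
    proof -
      have "4 * Suc k = Suc k + 3 * Suc k" by simp
      then show ?thesis using q by (simp only: power_add) simp
    qed
    also have "\<dots> \<le> P (Suc k) * q ^ (3 * Suc k)"
      using PS_ge(1) q by (intro mult_right_mono) auto
    finally have "exp (s\<^sub>1 k) / P k \<le> exp (- c) * m * q ^ (3 * Suc k)"
      using Pk by (simp add: PS exp_minus field_simps del: power_Suc mult_Suc_right)
    then have "\<delta>\<^sub>1 * (exp (s\<^sub>1 k) / P k) \<le> \<delta>\<^sub>1 * (exp (- c) * m * q ^ (3 * Suc k))"
      using \<delta>\<^sub>1 by (intro mult_left_mono) auto
    then have "\<delta>\<^sub>1 * (exp (s\<^sub>1 k) / P k) \<le> r"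
      unfolding r_def \<rho>_def by (simp only: mult_ac)
    then show "u \<in> {F z - r..F z + r}" using * by auto
  qed
  with ball have "{a..b} \<subseteq> F ` {z - \<rho>..z + \<rho>}" by blast
  then obtain a' b' where ab': "{z - \<rho>..z + \<rho>} \<inter> F -` {a..b} = {a'..b'}" "F ` {a'..b'} = {a..b}"
    by (rule vimage_Icc_inj[OF continuous_on_subset[OF contF subset_UNIV] inj])
  show ?case
  proof (intro exI conjI ballI)
    show "(F ^^ (n - Suc k)) t \<in> {a'..b'}"
    proof -
      have "z \<in> {z - \<rho>..z + \<rho>} \<inter> F -` {a..b}" using ab(1) \<rho>0 unfolding Fz[symmetric] by simp
      then show ?thesis using ab'(1) by (simp only: z_def)
    qed
    show "(F ^^ Suc k) ` {a'..b'} = {(F ^^ n) t - \<delta>\<^sub>1..(F ^^ n) t + \<delta>\<^sub>1}"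
      unfolding funpow_Suc_right image_comp[symmetric] ab'(2) by (rule ab(2))
    fix u v assume uv: "u \<in> {a'..b'}" "v \<in> {a'..b'}"
    have W: "u \<in> {z - \<rho>..z + \<rho>}" "v \<in> {z - \<rho>..z + \<rho>}" "F u \<in> {a..b}" "F v \<in> {a..b}"
      using uv ab'(1) by blast+
    note b1 = bl[OF W(1,2)] and b2 = ab(3)[OF W(3,4)]
    have "exp (- s\<^sub>1 (Suc k)) * P (Suc k) * \<bar>u - v\<bar> = exp (- s\<^sub>1 k) * P k * (exp (- c) * m * \<bar>u - v\<bar>)"
      unfolding PS s\<^sub>1_Suc c_def[symmetric] by (simp add: exp_add exp_diff exp_minus field_simps)
    also have "\<dots> \<le> exp (- s\<^sub>1 k) * P k * \<bar>F u - F v\<bar>"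
      using b1 Pk by (intro mult_left_mono) auto
    also have "\<dots> \<le> \<bar>(F ^^ Suc k) u - (F ^^ Suc k) v\<bar>" unfolding iter using b2 by blast
    finally show "exp (- s\<^sub>1 (Suc k)) * P (Suc k) * \<bar>u - v\<bar> \<le> \<bar>(F ^^ Suc k) u - (F ^^ Suc k) v\<bar>" .
    have "\<bar>(F ^^ Suc k) u - (F ^^ Suc k) v\<bar> \<le> exp (s\<^sub>1 k) * P k * \<bar>F u - F v\<bar>"
      unfolding iter using b2 by blast
    also have "\<dots> \<le> exp (s\<^sub>1 k) * P k * (exp c * m * \<bar>u - v\<bar>)"
      using b1 Pk by (intro mult_left_mono) auto
    also have "\<dots> = exp (s\<^sub>1 (Suc k)) * P (Suc k) * \<bar>u - v\<bar>"
      unfolding PS s\<^sub>1_Suc c_def[symmetric] by (simp add: exp_add)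
    finally show "\<bar>(F ^^ Suc k) u - (F ^^ Suc k) v\<bar> \<le> exp (s\<^sub>1 (Suc k)) * P (Suc k) * \<bar>u - v\<bar>" .
  qed
qed

text \<open>The case \<open>k = n\<close>, with the partial sums replaced by
  \<open>S\<^sub>1\<close> so that the distortion constant does not depend on \<open>n\<close>. Of
  the four factors \<open>q ^ n\<close> of contraction one is spent on distortion, which leaves
  three.\<close>

lemma hyperbolic_preball:
  assumes h: "hyperbolic_time f \<beta> \<sigma> \<delta> (to_circle t) n"
  obtains a b P where "t \<in> {a..b}" "P > 0" "b - a \<le> 2 * \<delta>\<^sub>1 * q ^ (3 * n)"
    "(F ^^ n) ` {a..b} = {(F ^^ n) t - \<delta>\<^sub>1..(F ^^ n) t + \<delta>\<^sub>1}"
    "\<forall>u\<in>{a..b}. \<forall>v\<in>{a..b}. exp (- S\<^sub>1) * P * \<bar>u - v\<bar> \<le> \<bar>(F ^^ n) u - (F ^^ n) v\<bar>"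
    "\<forall>u\<in>{a..b}. \<forall>v\<in>{a..b}. \<bar>(F ^^ n) u - (F ^^ n) v\<bar> \<le> exp S\<^sub>1 * P * \<bar>u - v\<bar>"
proof -
  define P where "P = (\<Prod>j\<in>{n - n..<n}. \<bar>circle_deriv f ((f ^^ j) (to_circle t))\<bar>)"
  obtain a b where ab: "t \<in> {a..b}" "(F ^^ n) ` {a..b} = {(F ^^ n) t - \<delta>\<^sub>1..(F ^^ n) t + \<delta>\<^sub>1}"
    "\<And>u v. u \<in> {a..b} \<Longrightarrow> v \<in> {a..b} \<Longrightarrow> exp (- s\<^sub>1 n) * P * \<bar>u - v\<bar> \<le> \<bar>(F ^^ n) u - (F ^^ n) v\<bar> \<and>
       \<bar>(F ^^ n) u - (F ^^ n) v\<bar> \<le> exp (s\<^sub>1 n) * P * \<bar>u - v\<bar>"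
    using hyperbolic_pull_back[OF h order_refl] unfolding P_def
    by (auto simp del: atLeastAtMost_iff)
  have Pge: "P \<ge> 1 / q ^ (4 * n)" unfolding P_def by (rule hyperbolic_time_prod[OF h order_refl])
  then have P: "P > 0" using q by (smt (verit) zero_less_divide_1_iff zero_less_power)
  show ?thesis
  proof
    show "t \<in> {a..b}" "P > 0" "(F ^^ n) ` {a..b} = {(F ^^ n) t - \<delta>\<^sub>1..(F ^^ n) t + \<delta>\<^sub>1}" by fact+
    have "(F ^^ n) a \<in> {(F ^^ n) t - \<delta>\<^sub>1..(F ^^ n) t + \<delta>\<^sub>1}" "(F ^^ n) b \<in> {(F ^^ n) t - \<delta>\<^sub>1..(F ^^ n) t + \<delta>\<^sub>1}"
      using ab(1) unfolding ab(2)[symmetric] by auto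
    then have "\<bar>(F ^^ n) a - (F ^^ n) b\<bar> \<le> 2 * \<delta>\<^sub>1" by auto
    then have "exp (- s\<^sub>1 n) * P * (b - a) \<le> 2 * \<delta>\<^sub>1"
    proof -
      have "a \<le> b" using ab(1) by auto
      then have "exp (- s\<^sub>1 n) * P * \<bar>a - b\<bar> \<le> \<bar>(F ^^ n) a - (F ^^ n) b\<bar>"
        using ab(3)[of a b] by simp
      then show ?thesis
        using \<open>a \<le> b\<close> \<open>\<bar>(F ^^ n) a - (F ^^ n) b\<bar> \<le> 2 * \<delta>\<^sub>1\<close> by simp
    qed
    then have "b - a \<le> 2 * \<delta>\<^sub>1 * (exp (s\<^sub>1 n) / P)" using P by (simp add: field_simps exp_minus)
    also have "exp (s\<^sub>1 n) / P \<le> (1 / q ^ n) / (1 / q ^ (4 * n))"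
      using exp_s\<^sub>1_le Pge P q by (intro frac_le) auto
    also have "\<dots> = q ^ (3 * n)"
    proof -
      have "4 * n = n + 3 * n" by simp
      then show ?thesis using q by (simp only: power_add) simp
    qed
    finally show "b - a \<le> 2 * \<delta>\<^sub>1 * q ^ (3 * n)" using \<delta>\<^sub>1 by simp
    have "exp (- S\<^sub>1) * P * \<bar>u - v\<bar> \<le> \<bar>(F ^^ n) u - (F ^^ n) v\<bar> \<and>
        \<bar>(F ^^ n) u - (F ^^ n) v\<bar> \<le> exp S\<^sub>1 * P * \<bar>u - v\<bar>"
      if uv: "u \<in> {a..b}" "v \<in> {a..b}" for u v
    proof
    have "exp (- S\<^sub>1) * P * \<bar>u - v\<bar> \<le> exp (- s\<^sub>1 n) * P * \<bar>u - v\<bar>"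
      using s\<^sub>1_le P by (intro mult_right_mono) auto
    then show "exp (- S\<^sub>1) * P * \<bar>u - v\<bar> \<le> \<bar>(F ^^ n) u - (F ^^ n) v\<bar>" using ab(3)[OF uv] by linarith
    have "exp (s\<^sub>1 n) * P * \<bar>u - v\<bar> \<le> exp S\<^sub>1 * P * \<bar>u - v\<bar>"
      using s\<^sub>1_le P by (intro mult_right_mono) auto
    then show "\<bar>(F ^^ n) u - (F ^^ n) v\<bar> \<le> exp S\<^sub>1 * P * \<bar>u - v\<bar>" using ab(3)[OF uv] by linarith
    qed
    then show "\<forall>u\<in>{a..b}. \<forall>v\<in>{a..b}. exp (- S\<^sub>1) * P * \<bar>u - v\<bar> \<le> \<bar>(F ^^ n) u - (F ^^ n) v\<bar>"
      "\<forall>u\<in>{a..b}. \<forall>v\<in>{a..b}. \<bar>(F ^^ n) u - (F ^^ n) v\<bar> \<le> exp S\<^sub>1 * P * \<bar>u - v\<bar>" by blast+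
  qed
qed

end

text \<open>Sublevel sets are images of the compact intervals \<open>{- 1 / 2..a}\<close>. Borel
  measurability can thus be carried over from functions on the line.\<close>

lemma borel_measurable_circle_rep [measurable]: "circle_rep \<in> borel_measurable borel"
  unfolding borel_measurable_iff_le
proof safe
  fix a :: real
  have "closed {x. circle_rep x \<le> a}"
  proof (cases "a < 1 / 2")
    case True
    have "{x. circle_rep x \<le> a} = to_circle ` {- 1 / 2..a}"
    proof safe
      fix x assume "circle_rep x \<le> a"
      then show "x \<in> to_circle ` {- 1 / 2..a}"
        by (intro image_eqI[of _ _ "circle_rep x"]) (use circle_rep_ge in \<open>auto simp: to_circle_rep\<close>)
    next
      fix t assume "t \<in> {- 1 / 2..a}"
      then show "circle_rep (to_circle t) \<le> a"
        using True circle_rep_to_circle[of t] by auto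
    qed
    then show ?thesis
      by (metis compact_Icc compact_continuous_image compact_imp_closed continuous_on_to_circle)
  next
    case False
    then have "{x. circle_rep x \<le> a} = UNIV"
      using order.trans[OF less_imp_le[OF circle_rep_less]] by auto
    then show ?thesis by simp
  qed
  then show "{x \<in> space borel. circle_rep x \<le> a} \<in> sets borel" by simp
qed

section \<open>Hyperbolic cells over a grid and images of Lebesgue measure\<close>

context hyperbolic_lift
begin

lemma borel_measurable_f [measurable]: "f \<in> borel_measurable borel"
  by (rule borel_measurable_continuous_onI[OF continuous_f])

lemma borel_measurable_funpow [measurable]: "(f ^^ n) \<in> borel_measurable borel"
  by (induction n) (simp_all add: id_def o_def)

text \<open>On the line the derivative is a pointwise limit of difference quotients of the
  continuous lift.\<close>

lemma borel_measurable_circle_deriv [measurable]: "circle_deriv f \<in> borel_measurable borel"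
proof -
  have [measurable]: "F \<in> borel_measurable borel"
    by (rule borel_measurable_continuous_onI[OF contF])
  have "(\<lambda>t. circle_deriv f (to_circle t)) \<in> borel_measurable borel"
  proof (rule borel_measurable_LIMSEQ_real)
    fix t :: real
    have "(\<lambda>h. (F (t + h) - F t) / h) \<midarrow>0\<rightarrow> circle_deriv f (to_circle t)"
      using lift_deriv[of t] by (simp add: DERIV_def)
    moreover have "filterlim (\<lambda>n. 1 / real (Suc n)) (at 0) sequentially"
      unfolding filterlim_at using LIMSEQ_Suc[OF lim_const_over_n[of "1 :: real"]] by auto
    ultimately show "(\<lambda>n. (F (t + 1 / real (Suc n)) - F t) / (1 / real (Suc n))) \<longlonglongrightarrow> circle_deriv f (to_circle t)"
      by (rule filterlim_compose)
  qed measurable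
  then have "(\<lambda>x. circle_deriv f (to_circle (circle_rep x))) \<in> borel_measurable borel"
    by (rule measurable_compose[OF borel_measurable_circle_rep])
  then show ?thesis by (simp add: to_circle_rep)
qed

lemma borel_measurable_trunc_crit_dist [measurable]: "trunc_crit_dist f \<delta> \<in> borel_measurable borel"
proof -
  have [measurable]: "crit_dist f \<in> borel_measurable borel"
    unfolding crit_dist_def
    by (cases "critical_set f = {}") (auto intro!: borel_measurable_continuous_onI continuous_intros)
  show ?thesis unfolding trunc_crit_dist_def by measurable
qed

definition H :: "nat \<Rightarrow> circle set" where "H n = {x. hyperbolic_time f \<beta> \<sigma> \<delta> x n}"

lemma H_borel [measurable]: "H n \<in> sets borel"
  unfolding H_def hyperbolic_time_def by measurable

text \<open>The grid width. As the reciprocal of an integer it makes the grid invariant under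
  integer translations; being less than \<open>\<delta>\<^sub>1\<close> it keeps the grid arc of
  \<open>(F ^^ n) t\<close> inside the interval of radius \<open>\<delta>\<^sub>1\<close> obtained
  at a hyperbolic time.\<close>

definition \<theta> :: real where "\<theta> = 1 / real (Suc (nat \<lceil>1 / \<delta>\<^sub>1\<rceil>))"

lemma \<theta>: "0 < \<theta>" "\<theta> < \<delta>\<^sub>1" "\<theta> \<le> 1"
proof -
  show "0 < \<theta>" "\<theta> \<le> 1" by (simp_all add: \<theta>_def)
  have "1 / \<delta>\<^sub>1 < real (Suc (nat \<lceil>1 / \<delta>\<^sub>1\<rceil>))" by linarith
  then have "1 / real (Suc (nat \<lceil>1 / \<delta>\<^sub>1\<rceil>)) < 1 / (1 / \<delta>\<^sub>1)"
    using \<delta>\<^sub>1(1) by (intro frac_less2) auto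
  then show "\<theta> < \<delta>\<^sub>1" unfolding \<theta>_def by simp
qed

definition grid_arc :: "int \<Rightarrow> real set" where "grid_arc i = {of_int i * \<theta>..<of_int (i + 1) * \<theta>}"

lemma mem_grid_arc: "y \<in> grid_arc i \<longleftrightarrow> i = \<lfloor>y / \<theta>\<rfloor>"
  unfolding grid_arc_def using \<theta>(1) by (auto simp: field_simps floor_eq_iff eq_commute[of i])

lemma emeasure_grid_arc: "emeasure lborel (grid_arc i) = ennreal \<theta>"
  unfolding grid_arc_def using \<theta>(1) by (simp add: algebra_simps)

lemma grid_arc_borel [measurable]: "grid_arc i \<in> sets borel"
  by (simp add: grid_arc_def)

text \<open>The intervals of \<open>hyperbolic_preball\<close> may overlap in an uncontrolled way.
  Components of preimages of fixed grid arcs are equal or disjoint, so their lengths can be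
  summed.\<close>

definition cell :: "nat \<Rightarrow> real \<Rightarrow> real set" where
  "cell n t = connected_component_set ((F ^^ n) -` grid_arc \<lfloor>(F ^^ n) t / \<theta>\<rfloor>) t"

lemma cell_disjoint: "cell n s = cell n t \<or> cell n s \<inter> cell n t = {}"
proof (cases "cell n s \<inter> cell n t = {}")
  case False
  then obtain u where u: "u \<in> cell n s" "u \<in> cell n t" by blast
  then have "(F ^^ n) u \<in> grid_arc \<lfloor>(F ^^ n) s / \<theta>\<rfloor>" "(F ^^ n) u \<in> grid_arc \<lfloor>(F ^^ n) t / \<theta>\<rfloor>"
    using connected_component_in unfolding cell_def by blast+
  then have eq: "\<lfloor>(F ^^ n) s / \<theta>\<rfloor> = \<lfloor>(F ^^ n) t / \<theta>\<rfloor>" unfolding mem_grid_arc by simp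
  then show ?thesis
    using u connected_component_eq unfolding cell_def by metis
qed simp

lemma endpoints_image:
  fixes \<phi> :: "real \<Rightarrow> real"
  assumes "continuous_on {a..b} \<phi>" "inj_on \<phi> {a..b}" "\<phi> ` {a..b} = {c..d}" "a \<le> b"
  shows "\<phi> a \<in> {c, d}" "\<phi> b \<in> {c, d}"
proof -
  have ab: "\<phi> a \<in> {c..d}" "\<phi> b \<in> {c..d}" using assms(3,4) by auto
  then obtain x y where xy: "x \<in> {a..b}" "y \<in> {a..b}" "\<phi> x = c" "\<phi> y = d"
  proof -
    have "c \<in> \<phi> ` {a..b}" "d \<in> \<phi> ` {a..b}" unfolding assms(3) using ab by auto
    then show ?thesis using that by blast
  qed
  have "strict_mono_on {a..b} \<phi> \<or> strict_antimono_on {a..b} \<phi>"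
    using injective_eq_monotone_map[of "{a..b}" \<phi>] assms by (simp add: is_interval_cc)
  then have "(\<forall>x\<in>{a..b}. \<phi> a \<le> \<phi> x \<and> \<phi> x \<le> \<phi> b) \<or> (\<forall>x\<in>{a..b}. \<phi> b \<le> \<phi> x \<and> \<phi> x \<le> \<phi> a)"
  proof
    assume m: "strict_mono_on {a..b} \<phi>"
    have "\<phi> u \<le> \<phi> v" if "u \<in> {a..b}" "v \<in> {a..b}" "u \<le> v" for u v
    proof (cases "u = v")
      case False
      then have "u < v" using that(3) by simp
      from monotone_onD[OF m that(1,2) this] show ?thesis by simp
    qed simp
    then show ?thesis using \<open>a \<le> b\<close> by simp
  next
    assume m: "strict_antimono_on {a..b} \<phi>"
    have "\<phi> v \<le> \<phi> u" if "u \<in> {a..b}" "v \<in> {a..b}" "u \<le> v" for u v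
    proof (cases "u = v")
      case False
      then have "u < v" using that(3) by simp
      from monotone_onD[OF m that(1,2) this] show ?thesis by simp
    qed simp
    then show ?thesis using \<open>a \<le> b\<close> by simp
  qed
  then have "\<phi> a \<le> c \<and> d \<le> \<phi> b \<or> \<phi> b \<le> c \<and> d \<le> \<phi> a" using xy by metis
  then show "\<phi> a \<in> {c, d}" "\<phi> b \<in> {c, d}" using ab by auto
qed

text \<open>Under the \<open>n\<close>th iterate the end points of \<open>{a..b}\<close> land at
  distance \<open>\<delta>\<^sub>1 > \<theta>\<close> from \<open>(F ^^ n) t\<close>, hence outside
  its grid arc. The component of \<open>t\<close> therefore cannot leave \<open>{a..b}\<close>,
  where the iterate is injective with bounded distortion.\<close>

lemma hyperbolic_cell:
  assumes h: "hyperbolic_time f \<beta> \<sigma> \<delta> (to_circle t) n"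
  obtains P where "P > 0" "t \<in> cell n t" "connected (cell n t)" "cell n t \<in> sets borel"
    "cell n t \<subseteq> cball t (2 * \<delta>\<^sub>1 * q ^ (3 * n))"
    "(F ^^ n) ` cell n t = grid_arc \<lfloor>(F ^^ n) t / \<theta>\<rfloor>"
    "\<forall>u\<in>cell n t. \<forall>v\<in>cell n t. exp (- S\<^sub>1) * P * \<bar>u - v\<bar> \<le> \<bar>(F ^^ n) u - (F ^^ n) v\<bar>"
    "\<forall>u\<in>cell n t. \<forall>v\<in>cell n t. \<bar>(F ^^ n) u - (F ^^ n) v\<bar> \<le> exp S\<^sub>1 * P * \<bar>u - v\<bar>"
proof -
  define \<phi> where "\<phi> = F ^^ n"
  define I where "I = grid_arc \<lfloor>\<phi> t / \<theta>\<rfloor>"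
  obtain a b P where P: "t \<in> {a..b}" "P > 0" "b - a \<le> 2 * \<delta>\<^sub>1 * q ^ (3 * n)"
    "\<phi> ` {a..b} = {\<phi> t - \<delta>\<^sub>1..\<phi> t + \<delta>\<^sub>1}"
    "\<forall>u\<in>{a..b}. \<forall>v\<in>{a..b}. exp (- S\<^sub>1) * P * \<bar>u - v\<bar> \<le> \<bar>\<phi> u - \<phi> v\<bar>"
    "\<forall>u\<in>{a..b}. \<forall>v\<in>{a..b}. \<bar>\<phi> u - \<phi> v\<bar> \<le> exp S\<^sub>1 * P * \<bar>u - v\<bar>"
    by (rule hyperbolic_preball[OF h, folded \<phi>_def])
  have cont: "continuous_on A \<phi>" for A unfolding \<phi>_def by (rule continuous_lift_funpow)
  have inj: "inj_on \<phi> {a..b}"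
  proof (rule inj_onI)
    fix u v assume uv: "u \<in> {a..b}" "v \<in> {a..b}" "\<phi> u = \<phi> v"
    then have "exp (- S\<^sub>1) * P * \<bar>u - v\<bar> \<le> 0" using P(5)[rule_format, OF uv(1,2)] by simp
    then show "u = v" using P(2) by (simp add: mult_le_0_iff)
  qed
  have tI: "\<phi> t \<in> I" unfolding I_def mem_grid_arc ..
  have Isub: "I \<subseteq> {\<phi> t - \<theta>..\<phi> t + \<theta>}"
    using tI unfolding I_def grid_arc_def by (auto simp: algebra_simps)
  then have Iim: "I \<subseteq> \<phi> ` {a..b}" unfolding P(4) using \<theta> by auto
  have end_notin: "\<phi> a \<notin> I" "\<phi> b \<notin> I"
    using endpoints_image[OF cont inj P(4)] P(1) Isub \<theta> by auto
  have con: "connected ({a..b} \<inter> \<phi> -` I)"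
  proof -
    let ?g = "the_inv_into {a..b} \<phi>"
    have "continuous_on (\<phi> ` {a..b}) ?g"
      by (rule continuous_on_inv[OF cont]) (auto simp: inj the_inv_into_f_f)
    then have "connected (?g ` I)"
      using continuous_on_subset[OF _ Iim]
      by (intro connected_continuous_image) (auto simp: I_def grid_arc_def)
    moreover have "?g ` I = {a..b} \<inter> \<phi> -` I"
    proof
      show "?g ` I \<subseteq> {a..b} \<inter> \<phi> -` I"
      proof
        fix x assume "x \<in> ?g ` I"
        then obtain y where y: "y \<in> I" "x = ?g y" by blast
        then obtain u where "u \<in> {a..b}" "y = \<phi> u" using Iim by blast
        then show "x \<in> {a..b} \<inter> \<phi> -` I" using y the_inv_into_f_f[OF inj] by auto
      qed
      show "{a..b} \<inter> \<phi> -` I \<subseteq> ?g ` I"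
      proof
        fix u assume u: "u \<in> {a..b} \<inter> \<phi> -` I"
        then have "\<phi> u \<in> I" by blast
        moreover have "u = ?g (\<phi> u)" using u the_inv_into_f_f[OF inj] by simp
        ultimately show "u \<in> ?g ` I" by (rule rev_image_eqI)
      qed
    qed
    ultimately show ?thesis by simp
  qed
  have cell: "cell n t = connected_component_set (\<phi> -` I) t"
    by (simp add: cell_def \<phi>_def I_def)
  have "cell n t \<subseteq> {a..b}"
  proof
    fix u assume u: "u \<in> cell n t"
    have c: "connected (cell n t)" "t \<in> cell n t" "cell n t \<subseteq> \<phi> -` I"
      unfolding cell using tI by (auto simp: connected_component_refl dest: connected_component_in)
    have "{min t u..max t u} \<subseteq> cell n t"
      using c u connected_contains_Icc[OF c(1)] by (auto simp: min_def max_def)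
    then have "a \<notin> {min t u..max t u}" "b \<notin> {min t u..max t u}"
      using c(3) end_notin by auto
    then show "u \<in> {a..b}" using P(1) by auto
  qed
  moreover have "cell n t \<subseteq> \<phi> -` I" unfolding cell by (rule connected_component_subset)
  moreover have "{a..b} \<inter> \<phi> -` I \<subseteq> cell n t"
    unfolding cell using con P(1) tI by (intro connected_component_maximal) auto
  ultimately have eq: "cell n t = {a..b} \<inter> \<phi> -` I" by blast
  show ?thesis
  proof (rule that[OF P(2)])
    show "t \<in> cell n t" using P(1) tI eq by simp
    show "connected (cell n t)" using con eq by simp
    have "\<phi> \<in> borel_measurable borel" by (rule borel_measurable_continuous_onI[OF cont])
    then have "\<phi> -` I \<in> sets borel" unfolding I_def by (metis grid_arc_borel measurable_sets_borel)
    then show "cell n t \<in> sets borel" unfolding eq by simp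
    show "cell n t \<subseteq> cball t (2 * \<delta>\<^sub>1 * q ^ (3 * n))"
      unfolding eq using P(1,3) by (auto simp: dist_real_def)
    show "(F ^^ n) ` cell n t = grid_arc \<lfloor>(F ^^ n) t / \<theta>\<rfloor>"
      unfolding eq I_def[symmetric] \<phi>_def[symmetric] using Iim by blast
    show "\<forall>u\<in>cell n t. \<forall>v\<in>cell n t. exp (- S\<^sub>1) * P * \<bar>u - v\<bar> \<le> \<bar>(F ^^ n) u - (F ^^ n) v\<bar>"
      using P(5) unfolding eq \<phi>_def by blast
    show "\<forall>u\<in>cell n t. \<forall>v\<in>cell n t. \<bar>(F ^^ n) u - (F ^^ n) v\<bar> \<le> exp S\<^sub>1 * P * \<bar>u - v\<bar>"
      using P(6) unfolding eq \<phi>_def by blast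
  qed
qed

text \<open>The iterate stretches \<open>K\<close> by factors between
  \<open>exp (- S\<^sub>1) * P\<close> and \<open>exp S\<^sub>1 * P\<close>. Applied to all of
  \<open>I\<close>, which has length \<open>\<theta>\<close>, this determines \<open>P\<close> up to
  \<open>exp S\<^sub>1\<close> from the length of \<open>K\<close>; substituting removes
  \<open>P\<close> and leaves \<open>exp (2 * S\<^sub>1)\<close>.\<close>

lemma hyperbolic_cell_measure:
  assumes h: "hyperbolic_time f \<beta> \<sigma> \<delta> (to_circle t) n" and Q: "Q \<in> sets borel"
  defines "K \<equiv> cell n t" and "I \<equiv> grid_arc \<lfloor>(F ^^ n) t / \<theta>\<rfloor>"
  shows "emeasure lborel (K \<inter> (F ^^ n) -` Q) \<le> ennreal (exp (2 * S\<^sub>1) / \<theta>) * emeasure lborel K * emeasure lborel (Q \<inter> I)"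
    and "emeasure lborel K * emeasure lborel (Q \<inter> I) \<le> ennreal (exp (2 * S\<^sub>1) * \<theta>) * emeasure lborel (K \<inter> (F ^^ n) -` Q)"
proof -
  define \<phi> where "\<phi> = F ^^ n"
  obtain P where P: "P > 0" "t \<in> K" "connected K" "K \<in> sets borel"
    "K \<subseteq> cball t (2 * \<delta>\<^sub>1 * q ^ (3 * n))" "\<phi> ` K = I"
    "\<forall>u\<in>K. \<forall>v\<in>K. exp (- S\<^sub>1) * P * \<bar>u - v\<bar> \<le> \<bar>\<phi> u - \<phi> v\<bar>"
    "\<forall>u\<in>K. \<forall>v\<in>K. \<bar>\<phi> u - \<phi> v\<bar> \<le> exp S\<^sub>1 * P * \<bar>u - v\<bar>"
    by (rule hyperbolic_cell[OF h, folded K_def I_def \<phi>_def])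
  have bK: "bounded K" using P(5) bounded_cball bounded_subset by blast
  have \<phi>m: "\<phi> \<in> borel_measurable borel"
    unfolding \<phi>_def by (rule borel_measurable_continuous_onI[OF continuous_lift_funpow])
  have KQ: "K \<inter> \<phi> -` Q' \<in> sets borel" if "Q' \<in> sets borel" for Q'
    using P(4) measurable_sets_borel[OF \<phi>m that] by simp
  have Ib: "I \<in> sets borel" "bounded I" by (auto simp: I_def grid_arc_def)
  have inj: "inj_on \<phi> K"
  proof (rule inj_onI)
    fix u v assume uv: "u \<in> K" "v \<in> K" "\<phi> u = \<phi> v"
    then have "exp (- S\<^sub>1) * P * \<bar>u - v\<bar> \<le> 0" using P(7)[rule_format, OF uv(1,2)] by simp
    then show "u = v" using P(1) by (simp add: mult_le_0_iff)
  qed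
  have up: "emeasure lborel (K \<inter> \<phi> -` Q') \<le> ennreal (exp S\<^sub>1 / P) * emeasure lborel (Q' \<inter> I)"
    if Q': "Q' \<in> sets borel" for Q'
  proof (rule emeasure_Lipschitz_image_le)
    let ?g = "the_inv_into K \<phi>"
    show "K \<inter> \<phi> -` Q' \<subseteq> ?g ` (Q' \<inter> I)"
    proof
      fix u assume u: "u \<in> K \<inter> \<phi> -` Q'"
      then have "\<phi> u \<in> Q' \<inter> I" using P(6) by blast
      moreover have "u = ?g (\<phi> u)" using u the_inv_into_f_f[OF inj] by simp
      ultimately show "u \<in> ?g ` (Q' \<inter> I)" by (rule rev_image_eqI)
    qed
    fix y y' assume "y \<in> Q' \<inter> I" "y' \<in> Q' \<inter> I"
    then obtain u v where uv: "u \<in> K" "v \<in> K" "y = \<phi> u" "y' = \<phi> v" using P(6) by blast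
    then show "\<bar>?g y - ?g y'\<bar> \<le> exp S\<^sub>1 / P * \<bar>y - y'\<bar>"
      using P(1) P(7)[rule_format, OF uv(1,2)] by (simp add: the_inv_into_f_f[OF inj] exp_minus field_simps)
  next
    show "Q' \<inter> I \<in> sets borel" "bounded (Q' \<inter> I)" using Q' Ib by (auto intro: bounded_subset)
    show "K \<inter> \<phi> -` Q' \<in> sets borel" by (rule KQ[OF Q'])
    show "0 \<le> exp S\<^sub>1 / P" using P(1) by simp
  qed
  have down: "emeasure lborel (Q' \<inter> I) \<le> ennreal (exp S\<^sub>1 * P) * emeasure lborel (K \<inter> \<phi> -` Q')"
    if Q': "Q' \<in> sets borel" for Q'
  proof (rule emeasure_Lipschitz_image_le)
    show "Q' \<inter> I \<subseteq> \<phi> ` (K \<inter> \<phi> -` Q')" using P(6) by blast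
    show "K \<inter> \<phi> -` Q' \<in> sets borel" by (rule KQ[OF Q'])
    show "bounded (K \<inter> \<phi> -` Q')" using bK by (rule bounded_subset) blast
    show "Q' \<inter> I \<in> sets borel" using Q' Ib by blast
    show "0 \<le> exp S\<^sub>1 * P" using P(1) by simp
    fix u v assume "u \<in> K \<inter> \<phi> -` Q'" "v \<in> K \<inter> \<phi> -` Q'"
    then show "\<bar>\<phi> u - \<phi> v\<bar> \<le> exp S\<^sub>1 * P * \<bar>u - v\<bar>" using P(8) by blast
  qed
  obtain k where k: "emeasure lborel K = ennreal k" "k \<ge> 0"
    using emeasure_bounded_finite[OF bK] by (cases "emeasure lborel K") auto
  have eI: "emeasure lborel I = ennreal \<theta>" unfolding I_def by (rule emeasure_grid_arc)
  have k1: "\<theta> \<le> exp S\<^sub>1 * P * k"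
    using down[of UNIV] P(1) \<theta> k by (simp add: eI ennreal_mult''[symmetric])
  have k2: "k \<le> exp S\<^sub>1 / P * \<theta>"
    using up[of UNIV] P(1) \<theta> k by (simp add: eI ennreal_mult''[symmetric])
  have e2: "exp (2 * S\<^sub>1) = exp S\<^sub>1 * exp S\<^sub>1" by (simp add: exp_double power2_eq_square)
  have "exp S\<^sub>1 / P \<le> exp (2 * S\<^sub>1) / \<theta> * k"
    using k1 P(1) \<theta> unfolding e2 by (simp add: field_simps)
  then have "ennreal (exp S\<^sub>1 / P) \<le> ennreal (exp (2 * S\<^sub>1) / \<theta>) * emeasure lborel K"
    using k \<theta> by (simp add: ennreal_mult''[symmetric] ennreal_leI)
  then have "ennreal (exp S\<^sub>1 / P) * emeasure lborel (Q \<inter> I)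
      \<le> ennreal (exp (2 * S\<^sub>1) / \<theta>) * emeasure lborel K * emeasure lborel (Q \<inter> I)"
    by (rule mult_right_mono) simp
  with up[OF Q] show "emeasure lborel (K \<inter> (F ^^ n) -` Q) \<le> ennreal (exp (2 * S\<^sub>1) / \<theta>) * emeasure lborel K * emeasure lborel (Q \<inter> I)"
    unfolding \<phi>_def by (rule order.trans)
  have "k * (exp S\<^sub>1 * P) \<le> exp (2 * S\<^sub>1) * \<theta>"
    using k2 P(1) unfolding e2 by (simp add: field_simps)
  then have *: "emeasure lborel K * ennreal (exp S\<^sub>1 * P) \<le> ennreal (exp (2 * S\<^sub>1) * \<theta>)"
    using k P(1) by (simp add: ennreal_mult''[symmetric] ennreal_leI)
  have "emeasure lborel K * emeasure lborel (Q \<inter> I)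
      \<le> emeasure lborel K * (ennreal (exp S\<^sub>1 * P) * emeasure lborel (K \<inter> \<phi> -` Q))"
    using down[OF Q] by (intro mult_left_mono) auto
  also have "\<dots> \<le> ennreal (exp (2 * S\<^sub>1) * \<theta>) * emeasure lborel (K \<inter> \<phi> -` Q)"
    using * by (simp add: mult.assoc[symmetric] mult_right_mono)
  finally show "emeasure lborel K * emeasure lborel (Q \<inter> I) \<le> ennreal (exp (2 * S\<^sub>1) * \<theta>) * emeasure lborel (K \<inter> (F ^^ n) -` Q)"
    unfolding \<phi>_def .
qed

text \<open>A cell is an interval, and it is not a single point as its image has length
  \<open>\<theta> > 0\<close>. The nonempty interior makes disjoint families of cells
  countable.\<close>

lemma cell_interior:
  assumes h: "hyperbolic_time f \<beta> \<sigma> \<delta> (to_circle t) n"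
  obtains u v where "u < v" "{u<..<v} \<subseteq> cell n t" "cell n t \<subseteq> {u..v}"
    "emeasure lborel (cell n t) = ennreal (v - u)"
proof -
  obtain P where P: "connected (cell n t)" "cell n t \<in> sets borel" "cell n t \<subseteq> cball t (2 * \<delta>\<^sub>1 * q ^ (3 * n))"
    "(F ^^ n) ` cell n t = grid_arc \<lfloor>(F ^^ n) t / \<theta>\<rfloor>" "t \<in> cell n t"
    by (rule hyperbolic_cell[OF h])
  define K where "K = cell n t"
  have bK: "bounded K" using P(3) bounded_cball bounded_subset unfolding K_def by blast
  then have bdd: "bdd_above K" "bdd_below K" by (simp_all add: bounded_imp_bdd_above bounded_imp_bdd_below)
  have "\<not> K \<subseteq> {t}"
  proof
    assume "K \<subseteq> {t}"
    then have "finite ((F ^^ n) ` K)" using finite_subset by blast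
    then have "finite (grid_arc \<lfloor>(F ^^ n) t / \<theta>\<rfloor>)" using P(4) by (simp add: K_def)
    then have "emeasure lborel (grid_arc \<lfloor>(F ^^ n) t / \<theta>\<rfloor>) = 0" by (rule emeasure_lborel_countable[OF countable_finite])
    then show False using emeasure_grid_arc \<theta>(1) by simp
  qed
  then obtain s where s: "s \<in> K" "s \<noteq> t" by blast
  have t: "t \<in> K" using P(5) by (simp add: K_def)
  define u v where "u = Inf K" and "v = Sup K"
  have uv: "x \<in> {u..v}" if "x \<in> K" for x
    using that cInf_lower[OF that bdd(2)] cSup_upper[OF that bdd(1)] by (simp add: u_def v_def)
  have "u < v" using uv[OF s(1)] uv[OF t] s(2) by auto
  have ioo: "{u<..<v} \<subseteq> K"
  proof
    fix x assume x: "x \<in> {u<..<v}"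
    then obtain k1 where k1: "k1 \<in> K" "k1 < x"
      using cInf_lessD[of K x] t unfolding u_def by auto
    obtain k2 where k2: "k2 \<in> K" "x < k2"
      using x less_cSupD[of K x] t unfolding v_def by auto
    have "{k1..k2} \<subseteq> K" using connected_contains_Icc P(1) k1 k2 unfolding K_def by blast
    then show "x \<in> K" using k1 k2 by auto
  qed
  have "emeasure lborel K \<le> emeasure lborel {u..v}" using uv by (intro emeasure_mono) auto
  moreover have "emeasure lborel {u<..<v} \<le> emeasure lborel K"
    using ioo P(2) by (intro emeasure_mono) (auto simp: K_def)
  ultimately have "emeasure lborel K = ennreal (v - u)" using \<open>u < v\<close> by simp
  then show ?thesis using that[of u v] \<open>u < v\<close> ioo uv unfolding K_def by blast
qed

lemma emeasure_vimage_grid_arc_le: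
  assumes "A \<in> sets borel"
  shows "emeasure lborel (to_circle -` A \<inter> grid_arc i) \<le> emeasure circle_lebesgue A"
proof -
  have "grid_arc i \<subseteq> {of_int i * \<theta>..<of_int i * \<theta> + 1}"
    unfolding grid_arc_def using \<theta> by (auto simp: algebra_simps)
  then have "emeasure lborel (to_circle -` A \<inter> grid_arc i)
      \<le> emeasure lborel ({of_int i * \<theta>..<of_int i * \<theta> + 1} \<inter> to_circle -` A)"
    using vimage_to_circle_borel[OF assms] by (intro emeasure_mono) auto
  then show ?thesis using emeasure_circle_lebesgue_Ico[OF assms] by simp
qed

text \<open>In each cell the share of the preimage of \<open>A\<close> is at most
  \<open>exp (2 * S\<^sub>1) / \<theta>\<close> times the measure of \<open>A\<close>. The cells of
  points in \<open>[0, 1)\<close> are disjoint or equal and lie in \<open>[-1, 2]\<close>, which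
  explains the factor 3. The bound is uniform in \<open>n\<close>.\<close>

lemma hyperbolic_push_le:
  assumes A: "A \<in> sets borel"
  shows "emeasure circle_lebesgue (H n \<inter> (f ^^ n) -` A) \<le> ennreal (exp (2 * S\<^sub>1) / \<theta>) * 3 * emeasure circle_lebesgue A"
proof -
  define T where "T = {t \<in> {0..<1}. to_circle t \<in> H n}"
  define \<K> where "\<K> = cell n ` T"
  define P where "P = to_circle -` A"
  let ?c = "ennreal (exp (2 * S\<^sub>1) / \<theta>)"
  have h: "hyperbolic_time f \<beta> \<sigma> \<delta> (to_circle t) n" if "t \<in> T" for t
    using that by (simp add: T_def H_def)
  have Pb: "P \<in> sets borel" unfolding P_def by (rule vimage_to_circle_borel[OF A])
  have Fm: "(F ^^ n) \<in> borel_measurable borel"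
    by (rule borel_measurable_continuous_onI[OF continuous_lift_funpow])
  have cellb: "cell n t \<in> sets borel" if "t \<in> T" for t
    by (rule hyperbolic_cell[OF h[OF that]])
  have disj: "disjoint_family_on (\<lambda>K. K) \<K>"
    unfolding disjoint_family_on_def \<K>_def using cell_disjoint by blast
  have count: "countable \<K>"
  proof (rule countable_disjoint_nonempty_interior_subsets)
    show "pairwise disjnt \<K>"
      using disj unfolding disjoint_family_on_def pairwise_def disjnt_def by blast
    fix K assume "K \<in> \<K>" "interior K = {}"
    then obtain t where t: "t \<in> T" "K = cell n t" unfolding \<K>_def by blast
    obtain u v where uv: "u < v" "{u<..<v} \<subseteq> cell n t" by (rule cell_interior[OF h[OF t(1)]])
    then have "{u<..<v} \<subseteq> interior K" unfolding t(2) by (intro interior_maximal) auto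
    then show "K = {}" using uv(1) \<open>interior K = {}\<close> by auto
  qed
  have cell_le: "emeasure lborel (K \<inter> (F ^^ n) -` P) \<le> (?c * emeasure circle_lebesgue A) * emeasure lborel K" if K: "K \<in> \<K>" for K
  proof -
    obtain t where t: "t \<in> T" "K = cell n t" using K unfolding \<K>_def by blast
    have "emeasure lborel (K \<inter> (F ^^ n) -` P) \<le> ?c * emeasure lborel K * emeasure lborel (P \<inter> grid_arc \<lfloor>(F ^^ n) t / \<theta>\<rfloor>)"
      unfolding t(2) by (rule hyperbolic_cell_measure(1)[OF h[OF t(1)] Pb])
    also have "\<dots> \<le> ?c * emeasure lborel K * emeasure circle_lebesgue A"
      unfolding P_def using emeasure_vimage_grid_arc_le[OF A] by (intro mult_left_mono) auto
    finally show ?thesis by (simp add: mult_ac)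
  qed
  have Kb: "K \<in> sets borel" if "K \<in> \<K>" for K using that cellb unfolding \<K>_def by blast
  have KPb: "K \<inter> (F ^^ n) -` P \<in> sets lborel" if "K \<in> \<K>" for K
    using Kb[OF that] measurable_sets_borel[OF Fm Pb] by simp
  have "{0..<1} \<inter> to_circle -` (H n \<inter> (f ^^ n) -` A) \<subseteq> (\<Union>K\<in>\<K>. K \<inter> (F ^^ n) -` P)"
  proof
    fix t assume t: "t \<in> {0..<1} \<inter> to_circle -` (H n \<inter> (f ^^ n) -` A)"
    then have "t \<in> T" by (simp add: T_def)
    moreover have "t \<in> cell n t" by (rule hyperbolic_cell[OF h[OF \<open>t \<in> T\<close>]])
    moreover have "(F ^^ n) t \<in> P" using t by (simp add: P_def lift_funpow)
    ultimately show "t \<in> (\<Union>K\<in>\<K>. K \<inter> (F ^^ n) -` P)" unfolding \<K>_def by blast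
  qed
  moreover have "(\<Union>K\<in>\<K>. K \<inter> (F ^^ n) -` P) \<in> sets lborel"
    using count KPb by (intro sets.countable_UN') auto
  ultimately have "emeasure lborel ({0..<1} \<inter> to_circle -` (H n \<inter> (f ^^ n) -` A))
      \<le> emeasure lborel (\<Union>K\<in>\<K>. K \<inter> (F ^^ n) -` P)" by (rule emeasure_mono)
  also have "\<dots> = (\<integral>\<^sup>+K. emeasure lborel (K \<inter> (F ^^ n) -` P) \<partial>count_space \<K>)"
    by (rule emeasure_UN_countable[OF KPb count]) (use disj in \<open>auto simp: disjoint_family_on_def\<close>)
  also have "\<dots> \<le> (\<integral>\<^sup>+K. (?c * emeasure circle_lebesgue A) * emeasure lborel K \<partial>count_space \<K>)"
    using cell_le by (intro nn_integral_mono) simp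
  also have "\<dots> = (?c * emeasure circle_lebesgue A) * (\<integral>\<^sup>+K. emeasure lborel K \<partial>count_space \<K>)"
    by (rule nn_integral_cmult) simp
  also have "(\<integral>\<^sup>+K. emeasure lborel K \<partial>count_space \<K>) = emeasure lborel (\<Union>K\<in>\<K>. K)"
    by (rule emeasure_UN_countable[symmetric]) (use Kb count disj in auto)
  also have "\<dots> \<le> emeasure lborel {-1..2 :: real}"
  proof (rule emeasure_mono)
    have "q ^ (3 * n) \<le> 1" using q by (simp add: power_le_one)
    then have "2 * \<delta>\<^sub>1 * q ^ (3 * n) \<le> 2 * \<delta>\<^sub>1 * 1" using \<delta>\<^sub>1 by (intro mult_left_mono) auto
    then have le1: "2 * \<delta>\<^sub>1 * q ^ (3 * n) \<le> 1" using \<delta>\<^sub>1 \<delta> by linarith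
    have "cell n t \<subseteq> {-1..2}" if "t \<in> T" for t
    proof -
      have "cell n t \<subseteq> cball t (2 * \<delta>\<^sub>1 * q ^ (3 * n))" by (rule hyperbolic_cell[OF h[OF that]])
      also have "\<dots> \<subseteq> cball t 1" using le1 by (rule subset_cball)
      also have "\<dots> \<subseteq> {-1..2}" using that by (auto simp: T_def cball_eq_atLeastAtMost)
      finally show ?thesis .
    qed
    then show "(\<Union>K\<in>\<K>. K) \<subseteq> {-1..2}" unfolding \<K>_def by blast
  qed simp
  finally have "emeasure lborel ({0..<1} \<inter> to_circle -` (H n \<inter> (f ^^ n) -` A))
      \<le> (?c * emeasure circle_lebesgue A) * 3" by (simp add: mult_left_mono)
  moreover have "H n \<inter> (f ^^ n) -` A \<in> sets borel"
    using measurable_sets_borel[OF borel_measurable_funpow A] by simp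
  ultimately show ?thesis by (simp add: emeasure_circle_lebesgue mult_ac)
qed

text \<open>Near a noncritical point \<open>F\<close> has a Lipschitz inverse, which maps null sets
  to null sets. Local negligibility then gives negligibility off the critical set.\<close>

lemma null_vimage_f:
  assumes A: "A \<in> sets borel" "emeasure circle_lebesgue A = 0"
    and C: "emeasure circle_lebesgue (critical_set f) = 0"
  shows "emeasure circle_lebesgue (f -` A) = 0"
proof -
  define P where "P = to_circle -` A"
  have Pb: "P \<in> sets borel" unfolding P_def by (rule vimage_to_circle_borel[OF A(1)])
  have Fm: "F \<in> borel_measurable borel"
    by (rule borel_measurable_continuous_onI[OF contF])
  have fB: "f -` A \<in> sets borel" using measurable_sets_borel[OF borel_measurable_f A(1)] .
  have CB: "critical_set f \<in> sets borel" using closed_critical by simp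
  define S where "S = {t. to_circle t \<in> f -` A - critical_set f}"
  have Sb: "S \<in> sets borel"
    using vimage_to_circle_borel[of "f -` A - critical_set f"] fB CB by (simp add: S_def vimage_def)
  have "negligible S"
  proof (rule locally_negligible_alt[THEN iffD2], rule ballI)
    fix z assume z: "z \<in> S"
    then have zC: "to_circle z \<notin> critical_set f" by (simp add: S_def)
    define d where "d = crit_dist f (to_circle z)"
    have d: "d > 0" unfolding d_def by (rule crit_dist_pos[OF zC])
    define \<rho> where "\<rho> = d / 4"
    define m where "m = exp (- (B * (\<rho> / d powr \<beta>))) * \<bar>circle_deriv f (to_circle z)\<bar>"
    have m: "m > 0" unfolding m_def using zC critical_iff by simp
    define J where "J = {z - \<rho>..z + \<rho>}"
    have bl: "m * \<bar>u - v\<bar> \<le> \<bar>F u - F v\<bar>" if "u \<in> J" "v \<in> J" for u v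
      using lift_bilipschitz[OF zC, of \<rho> _ u v, folded d_def, OF _ _ order_refl] that d
      unfolding m_def J_def \<rho>_def by simp
    have inj: "inj_on F J"
    proof (rule inj_onI)
      fix u v assume uv: "u \<in> J" "v \<in> J" "F u = F v"
      then have "m * \<bar>u - v\<bar> \<le> 0" using bl[OF uv(1,2)] by simp
      then show "u = v" using m by (simp add: mult_le_0_iff)
    qed
    have comp: "compact (F ` J)"
      using continuous_on_subset[OF contF] by (intro compact_continuous_image) (auto simp: J_def)
    then obtain a where a: "F ` J \<subseteq> cbox (- a) a"
      using bounded_subset_cbox_symmetric compact_imp_bounded by blast
    define b where "b = \<bar>a\<bar> + 1"
    have sub: "P \<inter> F ` J \<subseteq> {- b..<b} \<inter> to_circle -` A"
      using a unfolding P_def b_def by auto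
    have "emeasure lborel (P \<inter> F ` J) \<le> emeasure lborel ({- b..<b} \<inter> to_circle -` A)"
      using sub Pb by (intro emeasure_mono) (auto simp: P_def)
    also have "\<dots> \<le> ennreal (b - (- b) + 1) * emeasure circle_lebesgue A"
      by (rule emeasure_lborel_Ico_le[OF A(1)]) (simp add: b_def)
    finally have null: "emeasure lborel (P \<inter> F ` J) = 0" using A(2) by simp
    have JP: "J \<inter> F -` P \<in> sets borel"
      using measurable_sets_borel[OF Fm Pb] by (simp add: J_def)
    have "emeasure lborel (J \<inter> F -` P) \<le> ennreal (1 / m) * emeasure lborel (P \<inter> F ` J)"
    proof (rule emeasure_Lipschitz_image_le)
      let ?g = "the_inv_into J F"
      show "P \<inter> F ` J \<in> sets borel" using Pb borel_compact[OF comp] by blast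
      show "bounded (P \<inter> F ` J)" using compact_imp_bounded[OF comp] by (rule bounded_subset) blast
      show "J \<inter> F -` P \<in> sets borel" by (rule JP)
      show "0 \<le> 1 / m" using m by simp
      show "J \<inter> F -` P \<subseteq> ?g ` (P \<inter> F ` J)"
      proof
        fix u assume u: "u \<in> J \<inter> F -` P"
        then have "F u \<in> P \<inter> F ` J" by blast
        moreover have "u = ?g (F u)" using u the_inv_into_f_f[OF inj] by simp
        ultimately show "u \<in> ?g ` (P \<inter> F ` J)" by (rule rev_image_eqI)
      qed
      fix y y' assume "y \<in> P \<inter> F ` J" "y' \<in> P \<inter> F ` J"
      then obtain u v where uv: "u \<in> J" "v \<in> J" "y = F u" "y' = F v" by blast
      then show "\<bar>?g y - ?g y'\<bar> \<le> 1 / m * \<bar>y - y'\<bar>"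
        using m bl[OF uv(1,2)] by (simp add: the_inv_into_f_f[OF inj] field_simps)
    qed
    then have "emeasure lebesgue (J \<inter> F -` P) = 0" using null JP by simp
    then have "negligible (J \<inter> F -` P)"
      using JP by (subst negligible_iff_emeasure0) auto
    moreover have "S \<inter> ball z \<rho> \<subseteq> J \<inter> F -` P"
      by (auto simp: S_def P_def J_def lift dist_real_def)
    ultimately have "negligible (S \<inter> ball z \<rho>)" by (rule negligible_subset)
    moreover have "z \<in> S \<inter> ball z \<rho>" using z d by (simp add: \<rho>_def)
    ultimately show "\<exists>U. openin (top_of_set S) U \<and> z \<in> U \<and> negligible U"
      by (intro exI[of _ "S \<inter> ball z \<rho>"]) (auto intro: openin_open_Int)
  qed
  then have "emeasure lborel S = 0" using Sb negligible_iff_emeasure0[of S] by simp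
  moreover have "emeasure circle_lebesgue (f -` A - critical_set f) \<le> emeasure lborel S"
  proof -
    have "f -` A - critical_set f \<in> sets borel" using fB CB by blast
    then show ?thesis
      unfolding emeasure_circle_lebesgue[OF \<open>f -` A - critical_set f \<in> sets borel\<close>]
      using Sb by (intro emeasure_mono) (auto simp: S_def)
  qed
  ultimately have "emeasure circle_lebesgue (f -` A - critical_set f) = 0" by simp
  moreover have "emeasure circle_lebesgue (f -` A) \<le> emeasure circle_lebesgue ((f -` A - critical_set f) \<union> critical_set f)"
    using fB CB by (intro emeasure_mono) auto
  moreover have "\<dots> \<le> emeasure circle_lebesgue (f -` A - critical_set f) + emeasure circle_lebesgue (critical_set f)"
    using fB CB by (intro emeasure_subadditive) auto
  ultimately show ?thesis using C by simp
qed

end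

section \<open>Almost sure hyperbolic times and forward invariant sets\<close>

locale expanding_lift = hyperbolic_lift +
  assumes ae_hyperbolic: "AE x in circle_lebesgue. \<exists>n. x \<in> H n"
    and summable_tail: "(\<Sum>i. emeasure circle_lebesgue {x. \<forall>n\<le>i. x \<notin> H n}) < \<infinity>"
begin

text \<open>The case \<open>k = n\<close> of the distance condition at a hyperbolic time concerns
  the starting point itself, so critical points have no hyperbolic time.\<close>

lemma null_critical: "emeasure circle_lebesgue (critical_set f) = 0"
proof -
  have "x \<notin> critical_set f" if x: "x \<in> H n" for x n
  proof -
    have h: "hyperbolic_time f \<beta> \<sigma> \<delta> x n" and "n \<ge> 1"
      using x unfolding H_def hyperbolic_time_def by auto
    then show ?thesis using hyperbolic_time_crit_dist(1)[OF h, of n] by simp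
  qed
  then have "AE x in circle_lebesgue. x \<notin> critical_set f"
    using ae_hyperbolic by (auto elim!: eventually_mono)
  then show ?thesis
    using closed_critical by (subst (asm) AE_iff_measurable[OF _ refl]) auto
qed

lemma AE_f:
  assumes "AE x in circle_lebesgue. P x"
  shows "AE x in circle_lebesgue. P (f x)"
proof -
  obtain N where N: "{x \<in> space circle_lebesgue. \<not> P x} \<subseteq> N" "emeasure circle_lebesgue N = 0"
      "N \<in> sets circle_lebesgue"
    using assms by (rule AE_E)
  then have N': "N \<in> sets borel" by simp
  show ?thesis
  proof (rule AE_I[of _ _ "f -` N"])
    show "{x \<in> space circle_lebesgue. \<not> P (f x)} \<subseteq> f -` N" using N(1) by auto
    show "emeasure circle_lebesgue (f -` N) = 0" by (rule null_vimage_f[OF N' N(2) null_critical])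
    show "f -` N \<in> sets circle_lebesgue" using measurable_sets_borel[OF borel_measurable_f N'] by simp
  qed
qed

lemma AE_funpow:
  assumes "AE x in circle_lebesgue. P x"
  shows "AE x in circle_lebesgue. P ((f ^^ n) x)"
proof (induction n)
  case (Suc n)
  from AE_f[OF Suc] show ?case by (simp only: funpow_Suc_right o_apply)
qed (use assms in simp)

lemma null_vimage_funpow:
  assumes "A \<in> sets borel" "emeasure circle_lebesgue A = 0"
  shows "emeasure circle_lebesgue ((f ^^ n) -` A) = 0"
proof -
  have "AE x in circle_lebesgue. x \<notin> A"
    using assms by (intro AE_I[of _ _ A]) auto
  then have "AE x in circle_lebesgue. (f ^^ n) x \<notin> A" by (rule AE_funpow)
  then show ?thesis
    using measurable_sets_borel[OF borel_measurable_funpow assms(1)]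
    by (subst (asm) AE_iff_measurable[OF _ refl]) (auto simp: vimage_def)
qed

text \<open>For \<open>k > n\<close> the product splits at time \<open>m\<close>, and the distance
  condition for \<open>k - n\<close> implies the one for \<open>k\<close> because
  \<open>\<sigma> < 1\<close>.\<close>

lemma hyperbolic_time_add:
  assumes m: "x \<in> H m" and n: "(f ^^ m) x \<in> H n"
  shows "x \<in> H (m + n)"
  unfolding H_def hyperbolic_time_def mem_Collect_eq
proof (intro conjI ballI)
  have hm: "hyperbolic_time f \<beta> \<sigma> \<delta> x m" and hn: "hyperbolic_time f \<beta> \<sigma> \<delta> ((f ^^ m) x) n"
    using m n by (auto simp: H_def)
  show "m + n \<ge> 1" using hm by (simp add: hyperbolic_time_def)
  let ?b = "min (1 / 2) (1 / (2 * \<beta>))"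
  let ?d = "\<lambda>j. \<bar>inverse (circle_deriv f ((f ^^ j) x))\<bar>"
  have shift: "(f ^^ j) ((f ^^ m) x) = (f ^^ (m + j)) x" for j
    by (simp add: funpow_add[symmetric, THEN fun_cong, unfolded o_apply] add.commute)
  have prod_shift: "(\<Prod>j\<in>{n - k..<n}. \<bar>inverse (circle_deriv f ((f ^^ j) ((f ^^ m) x)))\<bar>) = (\<Prod>j\<in>{m + (n - k)..<m + n}. ?d j)" for k
    unfolding shift using prod.shift_bounds_nat_ivl[of ?d "n - k" m n] by (simp add: add.commute)
  fix k assume k: "k \<in> {1..m + n}"
  have "(\<Prod>j\<in>{m + n - k..<m + n}. ?d j) \<le> \<sigma> ^ k \<and>
      trunc_crit_dist f \<delta> ((f ^^ (m + n - k)) x) \<ge> \<sigma> powr (?b * real k)"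
  proof (cases "k \<le> n")
    case True
    then have eq: "m + n - k = m + (n - k)" by simp
    have "k \<in> {1..n}" using k True by simp
    then have "(\<Prod>j\<in>{n - k..<n}. \<bar>inverse (circle_deriv f ((f ^^ j) ((f ^^ m) x)))\<bar>) \<le> \<sigma> ^ k"
      "trunc_crit_dist f \<delta> ((f ^^ (n - k)) ((f ^^ m) x)) \<ge> \<sigma> powr (?b * real k)"
      using hn unfolding hyperbolic_time_def by blast+
    from this(1)[unfolded prod_shift] this(2)[unfolded shift] show ?thesis unfolding eq by blast
  next
    case False
    then have eq: "m + n - k = m - (k - n)" "k - n \<in> {1..m}" using k by auto
    have n1: "n \<ge> 1" using hn by (simp add: hyperbolic_time_def)
    have "(\<Prod>j\<in>{0..<n}. \<bar>inverse (circle_deriv f ((f ^^ j) ((f ^^ m) x)))\<bar>) \<le> \<sigma> ^ n"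
      using hn n1 unfolding hyperbolic_time_def by (metis atLeastAtMost_iff diff_self_eq_0 order_refl)
    then have p2: "(\<Prod>j\<in>{m..<m + n}. ?d j) \<le> \<sigma> ^ n"
      using prod_shift[of n] by simp
    have p1: "(\<Prod>j\<in>{m - (k - n)..<m}. ?d j) \<le> \<sigma> ^ (k - n)"
      and t: "trunc_crit_dist f \<delta> ((f ^^ (m - (k - n))) x) \<ge> \<sigma> powr (?b * real (k - n))"
      using hm eq(2) unfolding hyperbolic_time_def by auto
    have "(\<Prod>j\<in>{m + n - k..<m + n}. ?d j) = (\<Prod>j\<in>{m - (k - n)..<m}. ?d j) * (\<Prod>j\<in>{m..<m + n}. ?d j)"
      unfolding eq(1) by (rule prod.atLeastLessThan_concat[symmetric]) auto
    also have "\<dots> \<le> \<sigma> ^ (k - n) * \<sigma> ^ n"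
      using p1 p2 \<sigma> by (intro mult_mono prod_nonneg) auto
    also have "\<dots> = \<sigma> ^ k" using False by (simp add: power_add[symmetric])
    finally have 1: "(\<Prod>j\<in>{m + n - k..<m + n}. ?d j) \<le> \<sigma> ^ k" .
    have "\<sigma> powr (?b * real k) \<le> \<sigma> powr (?b * real (k - n))"
      using \<sigma> \<beta> by (intro powr_mono' mult_left_mono) auto
    then show ?thesis using 1 t unfolding eq(1) by simp
  qed
  then show "(\<Prod>j\<in>{m + n - k..<m + n}. ?d j) \<le> \<sigma> ^ k"
    "trunc_crit_dist f \<delta> ((f ^^ (m + n - k)) x) \<ge> \<sigma> powr (?b * real k)" by auto
qed

text \<open>By nonsingularity almost every orbit consists of points with a hyperbolic time, and such
  times concatenate.\<close>

lemma ae_infinitely_hyperbolic: "AE x in circle_lebesgue. \<forall>N. \<exists>n\<ge>N. x \<in> H n"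
proof -
  have "AE x in circle_lebesgue. \<forall>j. \<exists>n. (f ^^ j) x \<in> H n"
    unfolding AE_all_countable using AE_funpow[OF ae_hyperbolic] by blast
  then show ?thesis
  proof (rule AE_mp, intro AE_I2 impI allI)
    fix x N assume ex: "\<forall>j. \<exists>n. (f ^^ j) x \<in> H n"
    show "\<exists>n\<ge>N. x \<in> H n"
    proof (induction N)
      case 0
      then show ?case using ex[rule_format, of 0] by simp
    next
      case (Suc N)
      then obtain m where m: "m \<ge> N" "x \<in> H m" by blast
      obtain n where n: "(f ^^ m) x \<in> H n" using ex by blast
      then have "n \<ge> 1" by (simp add: H_def hyperbolic_time_def)
      then show ?case using hyperbolic_time_add[OF m(2) n] m(1) by (intro exI[of _ "m + n"]) auto
    qed
  qed
qed

end

lemma emeasure_UN_le_nn_integral: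
  assumes "countable I" "\<And>i. i \<in> I \<Longrightarrow> X i \<in> sets M"
  shows "emeasure M (\<Union>i\<in>I. X i) \<le> (\<integral>\<^sup>+i. emeasure M (X i) \<partial>count_space I)"
proof -
  have "(\<Union>i\<in>I. X i) \<in> sets M" using assms by (intro sets.countable_UN') auto
  then have "emeasure M (\<Union>i\<in>I. X i) = (\<integral>\<^sup>+x. indicator (\<Union>i\<in>I. X i) x \<partial>M)" by simp
  also have "\<dots> \<le> (\<integral>\<^sup>+x. (\<integral>\<^sup>+i. indicator (X i) x \<partial>count_space I) \<partial>M)"
  proof (rule nn_integral_mono)
    fix x
    show "indicator (\<Union>i\<in>I. X i) x \<le> (\<integral>\<^sup>+i. indicator (X i) x \<partial>count_space I :: ennreal)"
    proof (cases "x \<in> (\<Union>i\<in>I. X i)")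
      case True
      then obtain i where i: "i \<in> I" "x \<in> X i" by blast
      have "1 = indicator (X i) x * emeasure (count_space I) {i}"
        using i by simp
      also have "\<dots> = (\<integral>\<^sup>+j. indicator (X i) x * indicator {i} j \<partial>count_space I)"
        using i by (subst nn_integral_cmult_indicator) auto
      also have "\<dots> \<le> (\<integral>\<^sup>+j. indicator (X j) x \<partial>count_space I)"
        by (intro nn_integral_mono) (auto split: split_indicator)
      finally show ?thesis using True by simp
    qed simp
  qed
  also have "\<dots> = (\<integral>\<^sup>+i. (\<integral>\<^sup>+x. indicator (X i) x \<partial>M) \<partial>count_space I)"
    using assms by (intro nn_integral_count_space_nn_integral) auto
  also have "\<dots> = (\<integral>\<^sup>+i. emeasure M (X i) \<partial>count_space I)"
    using assms by (intro nn_integral_cong) auto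
  finally show ?thesis .
qed

context expanding_lift
begin

lemma funpow_vimage_borel: "A \<in> sets borel \<Longrightarrow> (f ^^ n) -` A \<in> sets borel"
  using measurable_sets_borel[OF borel_measurable_funpow] by blast

lemma grid_arc_null_imp:
  assumes D: "D \<in> sets borel" and null: "emeasure lborel (grid_arc i - to_circle -` D) = 0"
  shows "\<exists>A. open A \<and> A \<noteq> {} \<and> emeasure circle_lebesgue (A - D) = 0"
proof (intro exI conjI)
  define J where "J = {of_int i * \<theta><..<of_int (i + 1) * \<theta>}"
  show op: "open (to_circle ` J)" unfolding J_def by (intro open_image_to_circle open_greaterThanLessThan)
  show "to_circle ` J \<noteq> {}" unfolding J_def using \<theta>(1) by (simp add: algebra_simps)
  have "{of_int i * \<theta>..<of_int i * \<theta> + 1} \<inter> to_circle -` (to_circle ` J - D) \<subseteq> grid_arc i - to_circle -` D"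
  proof
    fix u assume u: "u \<in> {of_int i * \<theta>..<of_int i * \<theta> + 1} \<inter> to_circle -` (to_circle ` J - D)"
    then obtain w where w: "w \<in> J" "to_circle u = to_circle w" by auto
    then have "u - w \<in> \<int>" by (simp add: to_circle_eq_iff)
    moreover have "\<bar>u - w\<bar> < 1" using u w(1) \<theta> unfolding J_def by (auto simp: algebra_simps)
    ultimately have "u = w" using Ints_eq_abs_less1[of u w] by (metis Ints_0 Ints_nonzero_abs_less1 eq_iff_diff_eq_0)
    then show "u \<in> grid_arc i - to_circle -` D" using u w(1) unfolding J_def grid_arc_def by auto
  qed
  then have "emeasure lborel ({of_int i * \<theta>..<of_int i * \<theta> + 1} \<inter> to_circle -` (to_circle ` J - D))
      \<le> emeasure lborel (grid_arc i - to_circle -` D)"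
    using vimage_to_circle_borel[OF D] by (intro emeasure_mono) auto
  then show "emeasure circle_lebesgue (to_circle ` J - D) = 0"
    using null op D by (subst emeasure_circle_lebesgue_Ico[of _ "of_int i * \<theta>"]) auto
qed

text \<open>With \<open>N = 1 / \<theta>\<close> arcs per period, the measures of the parts of the
  arcs outside \<open>D\<close> take finitely many values only, so they have a positive minimum when
  none vanishes.\<close>

lemma grid_arc_diff_periodic:
  assumes D: "D \<in> sets borel"
  defines "N \<equiv> int (Suc (nat \<lceil>1 / \<delta>\<^sub>1\<rceil>))"
  shows "emeasure lborel (grid_arc i - to_circle -` D) = emeasure lborel (grid_arc (i mod N) - to_circle -` D)"
proof -
  define k where "k = i div N"
  have "N > 0" unfolding N_def by (simp only: of_nat_0_less_iff zero_less_Suc)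
  have "of_int N = real (Suc (nat \<lceil>1 / \<delta>\<^sub>1\<rceil>))" unfolding N_def by (rule of_int_of_nat_eq)
  then have N\<theta>: "of_int N * \<theta> = 1" unfolding \<theta>_def by (simp del: of_nat_Suc)
  have i: "i = k * N + i mod N" unfolding k_def by simp
  have "of_int i * \<theta> = of_int k * (of_int N * \<theta>) + of_int (i mod N) * \<theta>"
    by (subst i) (simp only: of_int_add of_int_mult distrib_right mult.assoc)
  then have eq: "of_int i * \<theta> = of_int k + of_int (i mod N) * \<theta>" by (simp add: N\<theta>)
  have "(\<lambda>x. of_int k + x) -` (grid_arc i - to_circle -` D) = grid_arc (i mod N) - to_circle -` D"
    unfolding grid_arc_def using eq by (auto simp: algebra_simps)
  then show ?thesis
    using emeasure_lborel_shift[of "grid_arc i - to_circle -` D" "of_int k"] vimage_to_circle_borel[OF D]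
    by auto
qed

text \<open>Otherwise every grid arc has a part outside \<open>D\<close> of measure at least
  \<open>m > 0\<close>. At a hyperbolic time of a point of \<open>D\<close>, bounded distortion
  transfers a fixed proportion of this loss to the cell, where it lies outside \<open>D\<close> by
  forward invariance. As cells shrink, they can be chosen inside an open set \<open>U\<close> that
  exceeds \<open>G\<close> by very little, which contradicts the loss collected over a Vitali
  family.\<close>

lemma forward_invariant_contains_arc:
  assumes D: "D \<in> sets borel" and inv: "\<And>x. x \<in> D \<Longrightarrow> f x \<in> D" and pos: "emeasure circle_lebesgue D > 0"
  shows "\<exists>A. open A \<and> A \<noteq> {} \<and> emeasure circle_lebesgue (A - D) = 0"
proof (rule ccontr)
  assume no: "\<not> ?thesis"
  define P where "P = to_circle -` D"
  have Pb [measurable]: "P \<in> sets borel" unfolding P_def by (rule vimage_to_circle_borel[OF D])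
  define a where "a i = emeasure lborel (grid_arc i - P)" for i
  define N where "N = int (Suc (nat \<lceil>1 / \<delta>\<^sub>1\<rceil>))"
  have a_pos: "a i > 0" for i
    using grid_arc_null_imp[OF D] no unfolding a_def P_def by (metis not_gr_zero)
  have a_le: "a i \<le> ennreal \<theta>" for i
    unfolding a_def emeasure_grid_arc[of i, symmetric] by (intro emeasure_mono) auto
  define m where "m = Min (a ` {0..<N})"
  have N: "N > 0" unfolding N_def by (simp only: of_nat_0_less_iff zero_less_Suc)
  then have ne: "{0..<N} \<noteq> {}" by simp
  have m_le: "m \<le> a i" for i
  proof -
    have "a i = a (i mod N)" unfolding a_def P_def N_def by (rule grid_arc_diff_periodic[OF D])
    moreover have "i mod N \<in> {0..<N}" using N by simp
    ultimately show ?thesis unfolding m_def by (metis Min_le finite_atLeastLessThan_int finite_imageI imageI)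
  qed
  have "m \<in> a ` {0..<N}" unfolding m_def using ne by (intro Min_in) auto
  then have m_pos: "m > 0" and "m \<le> ennreal \<theta>" using a_pos a_le by auto
  then obtain m' where m': "m = ennreal m'" "m' > 0"
    by (cases m) (auto simp: top_unique)
  define D' where "D' = {x \<in> D. \<forall>M. \<exists>n\<ge>M. x \<in> H n}"
  have D'b: "D' \<in> sets borel" unfolding D'_def using D by measurable
  have "emeasure circle_lebesgue D' = emeasure circle_lebesgue D"
    using ae_infinitely_hyperbolic D D'b by (intro emeasure_eq_AE) (auto simp: D'_def elim!: eventually_mono)
  define G where "G = {0..<1} \<inter> to_circle -` D'"
  have Gb: "G \<in> sets borel" unfolding G_def using vimage_to_circle_borel[OF D'b] by simp
  have eG: "emeasure lborel G = emeasure circle_lebesgue D"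
    unfolding G_def emeasure_circle_lebesgue[OF D'b, symmetric] by fact
  obtain d where d: "emeasure circle_lebesgue D = ennreal d" "d > 0"
    using pos by (cases "emeasure circle_lebesgue D") (auto simp: circle_lebesgue.emeasure_eq_measure)
  define c where "c = exp (2 * S\<^sub>1) * \<theta>"
  have c: "c > 0" unfolding c_def using \<theta> by simp
  \<comment> \<open>The final inequality is \<open>m' * d \<le> 5 * c * e\<close>, with 5 from the
    Vitali covering; this choice makes its right-hand side \<open>m' * d / 2\<close>.\<close>
  define e where "e = m' * d / (10 * c)"
  have e: "e > 0" unfolding e_def using m' d c by simp
  obtain U where U: "open U" "G \<subseteq> U" "U - G \<in> lmeasurable" "emeasure lebesgue (U - G) < ennreal e"
    using sets_lebesgue_outer_open[of G e] Gb e by auto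
  have UG: "emeasure lborel (U - G) < ennreal e" using U(1,4) Gb by simp
  have "\<exists>n. to_circle t \<in> H n \<and> cell n t \<subseteq> U" if t: "t \<in> G" for t
  proof -
    obtain r where r: "r > 0" "cball t r \<subseteq> U" using t U(1,2) open_contains_cball by blast
    have "(\<lambda>n. 2 * \<delta>\<^sub>1 * (q ^ 3) ^ n) \<longlonglongrightarrow> 2 * \<delta>\<^sub>1 * 0"
      using q by (intro tendsto_mult tendsto_const LIMSEQ_power_zero) (simp add: power_less_one_iff abs_of_pos)
    then have "\<forall>\<^sub>F n in sequentially. 2 * \<delta>\<^sub>1 * (q ^ 3) ^ n < r"
      using r(1) by (simp add: order_tendstoD)
    then obtain M where M: "\<And>n. n \<ge> M \<Longrightarrow> 2 * \<delta>\<^sub>1 * (q ^ 3) ^ n < r"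
      unfolding eventually_sequentially by blast
    obtain n where n: "n \<ge> M" "to_circle t \<in> H n" using t unfolding G_def D'_def by blast
    then have h: "hyperbolic_time f \<beta> \<sigma> \<delta> (to_circle t) n" by (simp add: H_def)
    have "cell n t \<subseteq> cball t (2 * \<delta>\<^sub>1 * q ^ (3 * n))" by (rule hyperbolic_cell[OF h])
    also have "\<dots> \<subseteq> cball t r" using M[OF n(1)] by (intro subset_cball) (simp add: power_mult)
    finally show ?thesis using n(2) r(2) by blast
  qed
  then obtain \<tau> where \<tau>: "\<And>t. t \<in> G \<Longrightarrow> to_circle t \<in> H (\<tau> t) \<and> cell (\<tau> t) t \<subseteq> U" by metis
  define K where "K t = cell (\<tau> t) t" for t
  have h: "hyperbolic_time f \<beta> \<sigma> \<delta> (to_circle t) (\<tau> t)" if "t \<in> G" for t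
    using \<tau>[OF that] by (simp add: H_def)
  have "\<exists>u v. u < v \<and> K t \<subseteq> {u..v} \<and> emeasure lborel (K t) = ennreal (v - u)" if "t \<in> G" for t
    using cell_interior[OF h[OF that]] unfolding K_def by metis
  then obtain u v where uv: "\<And>t. t \<in> G \<Longrightarrow> u t < v t \<and> K t \<subseteq> {u t..v t} \<and> emeasure lborel (K t) = ennreal (v t - u t)"
    by metis
  have Kb: "K t \<in> sets borel" "t \<in> K t" "K t \<subseteq> cball t (2 * \<delta>\<^sub>1 * q ^ (3 * \<tau> t))" if "t \<in> G" for t
    unfolding K_def by (rule hyperbolic_cell[OF h[OF that]], assumption)+
  have uv1: "v t - u t \<le> 2" if t: "t \<in> G" for t
  proof -
    have "q ^ (3 * \<tau> t) \<le> 1" using q by (simp add: power_le_one)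
    then have "2 * \<delta>\<^sub>1 * q ^ (3 * \<tau> t) \<le> 2 * \<delta>\<^sub>1 * 1" using \<delta>\<^sub>1 by (intro mult_left_mono) auto
    then have "2 * \<delta>\<^sub>1 * q ^ (3 * \<tau> t) \<le> 1" using \<delta>\<^sub>1 \<delta> by linarith
    then have "K t \<subseteq> cball t 1" using Kb(3)[OF t] subset_cball by blast
    then have "emeasure lborel (K t) \<le> emeasure lborel (cball t 1)" by (intro emeasure_mono) auto
    also have "\<dots> = ennreal 2" by (simp add: cball_eq_atLeastAtMost)
    finally have "ennreal (v t - u t) \<le> ennreal 2" using uv[OF t] by simp
    then show ?thesis by (subst (asm) ennreal_le_iff) auto
  qed
  define mid where "mid t = (u t + v t) / 2" for t
  define r where "r t = (v t - u t) / 2" for t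
  have cb: "cball (mid t) (r t) = {u t..v t}" for t
    unfolding cball_eq_atLeastAtMost mid_def r_def by (simp add: field_simps)
  have cover: "G \<subseteq> (\<Union>t\<in>G. cball (mid t) (r t))"
    unfolding cb using uv Kb(2) by blast
  have r: "0 < r t \<and> r t \<le> 1" if "t \<in> G" for t
    using uv[OF that] uv1[OF that] unfolding r_def by simp
  obtain C where C: "countable C" "C \<subseteq> G"
    "pairwise (\<lambda>i j. disjnt (cball (mid i) (r i)) (cball (mid j) (r j))) C"
    "G \<subseteq> (\<Union>i\<in>C. cball (mid i) (5 * r i))"
    by (rule Vitali_covering_lemma_cballs[OF cover r])
  have "emeasure lborel G \<le> emeasure lborel (\<Union>i\<in>C. cball (mid i) (5 * r i))"
    using C(1,4) by (intro emeasure_mono sets.countable_UN') auto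
  also have "\<dots> \<le> (\<integral>\<^sup>+i. emeasure lborel (cball (mid i) (5 * r i)) \<partial>count_space C)"
    using C(1) by (intro emeasure_UN_le_nn_integral) auto
  also have "\<dots> = (\<integral>\<^sup>+i. 5 * emeasure lborel (K i) \<partial>count_space C)"
  proof (rule nn_integral_cong)
    fix i assume "i \<in> space (count_space C)"
    then have i: "i \<in> G" using C(2) by auto
    have "emeasure lborel (cball (mid i) (5 * r i)) = ennreal (5 * (v i - u i))"
    proof -
      have "mid i - 5 * r i \<le> mid i + 5 * r i" using r[OF i] by simp
      then have "emeasure lborel (cball (mid i) (5 * r i)) = ennreal ((mid i + 5 * r i) - (mid i - 5 * r i))"
        unfolding cball_eq_atLeastAtMost by (rule emeasure_lborel_Icc)
      also have "(mid i + 5 * r i) - (mid i - 5 * r i) = 5 * (v i - u i)"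
        unfolding r_def by (simp add: field_simps)
      finally show ?thesis .
    qed
    also have "\<dots> = ennreal 5 * ennreal (v i - u i)"
      using uv[OF i] by (intro ennreal_mult) auto
    also have "ennreal (v i - u i) = emeasure lborel (K i)" using uv[OF i] by simp
    finally show "emeasure lborel (cball (mid i) (5 * r i)) = 5 * emeasure lborel (K i)" by simp
  qed
  finally have G_le: "emeasure lborel G \<le> (\<integral>\<^sup>+i. 5 * emeasure lborel (K i) \<partial>count_space C)" .
  have "m * emeasure lborel G \<le> m * (\<integral>\<^sup>+i. 5 * emeasure lborel (K i) \<partial>count_space C)"
    using G_le by (rule mult_left_mono) simp
  also have "\<dots> = (\<integral>\<^sup>+i. 5 * (emeasure lborel (K i) * m) \<partial>count_space C)"
    by (subst nn_integral_cmult[symmetric]) (auto simp: mult_ac)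
  also have "\<dots> \<le> (\<integral>\<^sup>+i. (5 * ennreal c) * emeasure lborel (K i - P) \<partial>count_space C)"
  proof (rule nn_integral_mono)
    fix i assume "i \<in> space (count_space C)"
    then have i: "i \<in> G" using C(2) by auto
    let ?I = "grid_arc \<lfloor>(F ^^ \<tau> i) i / \<theta>\<rfloor>"
    have "m \<le> emeasure lborel ((- P) \<inter> ?I)"
      using m_le[of "\<lfloor>(F ^^ \<tau> i) i / \<theta>\<rfloor>"] unfolding a_def by (simp add: Diff_eq Int_commute)
    then have "emeasure lborel (K i) * m \<le> emeasure lborel (K i) * emeasure lborel ((- P) \<inter> ?I)"
      by (rule mult_left_mono) simp
    also have "\<dots> \<le> ennreal c * emeasure lborel (K i \<inter> (F ^^ \<tau> i) -` (- P))"
      unfolding K_def c_def by (rule hyperbolic_cell_measure(2)[OF h[OF i]]) measurable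
    also have "\<dots> \<le> ennreal c * emeasure lborel (K i - P)"
    proof (intro mult_left_mono emeasure_mono)
      have "(F ^^ n) s \<in> P" if "s \<in> P" for n s
        using that unfolding P_def by (induction n) (auto simp: lift inv)
      then show "K i \<inter> (F ^^ \<tau> i) -` (- P) \<subseteq> K i - P" by blast
      show "K i - P \<in> sets lborel" using Kb(1)[OF i] Pb by simp
    qed simp
    finally show "5 * (emeasure lborel (K i) * m) \<le> (5 * ennreal c) * emeasure lborel (K i - P)"
      by (simp add: mult.assoc mult_left_mono)
  qed
  also have "\<dots> = (5 * ennreal c) * (\<integral>\<^sup>+i. emeasure lborel (K i - P) \<partial>count_space C)"
    by (rule nn_integral_cmult) simp
  also have "(\<integral>\<^sup>+i. emeasure lborel (K i - P) \<partial>count_space C) = emeasure lborel (\<Union>i\<in>C. K i - P)"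
  proof (rule emeasure_UN_countable[symmetric])
    show "K i - P \<in> sets lborel" if "i \<in> C" for i using Kb(1) C(2) Pb that by auto
    show "countable C" by (rule C(1))
    show "disjoint_family_on (\<lambda>i. K i - P) C"
      unfolding disjoint_family_on_def
    proof (intro ballI impI)
      fix i j assume ij: "i \<in> C" "j \<in> C" "i \<noteq> j"
      then have "{u i..v i} \<inter> {u j..v j} = {}"
        using C(3) unfolding pairwise_def cb disjnt_def by blast
      then show "(K i - P) \<inter> (K j - P) = {}" using uv ij C(2) by blast
    qed
  qed
  also have "\<dots> \<le> emeasure lborel (U - G)"
  proof (rule emeasure_mono)
    show "(\<Union>i\<in>C. K i - P) \<subseteq> U - G"
      using \<tau> C(2) unfolding K_def G_def P_def D'_def by blast
    show "U - G \<in> sets lborel" using U(1) Gb by simp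
  qed
  also have "\<dots> \<le> ennreal e" using UG by simp
  finally have "m * emeasure lborel G \<le> 5 * ennreal c * ennreal e" by (simp add: mult_left_mono)
  moreover have "m * emeasure lborel G = ennreal (m' * d)"
    unfolding eG d(1) m'(1) using m' d by (simp add: ennreal_mult)
  moreover have "5 * ennreal c * ennreal e = ennreal (5 * c * e)"
    using c e by (simp add: ennreal_mult)
  ultimately have "m' * d \<le> 5 * c * e" using c e by (simp add: ennreal_le_iff)
  then show False using m' d c unfolding e_def by (simp add: field_simps)
qed

section \<open>The dominating measure\<close>

definition unhyperbolic :: "nat \<Rightarrow> circle set" where "unhyperbolic i = {x. \<forall>n\<le>i. x \<notin> H n}"

lemma unhyperbolic_borel [measurable]: "unhyperbolic i \<in> sets borel"
  unfolding unhyperbolic_def by measurable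

text \<open>The pieces on the right are the points whose last hyperbolic time up to \<open>j\<close> is \<open>m\<close>; hyperbolic times
  concatenate, so \<open>(f ^^ m) x\<close> has no hyperbolic time up to \<open>j - m\<close>.\<close>

lemma vimage_funpow_subset:
  "(f ^^ j) -` A \<subseteq> (unhyperbolic j \<inter> (f ^^ j) -` A) \<union>
     (\<Union>m\<le>j. H m \<inter> (f ^^ m) -` (unhyperbolic (j - m) \<inter> (f ^^ (j - m)) -` A))"
proof
  fix x assume x: "x \<in> (f ^^ j) -` A"
  show "x \<in> (unhyperbolic j \<inter> (f ^^ j) -` A) \<union>
     (\<Union>m\<le>j. H m \<inter> (f ^^ m) -` (unhyperbolic (j - m) \<inter> (f ^^ (j - m)) -` A))"
  proof (cases "x \<in> unhyperbolic j")
    case False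
    then obtain n where n: "n \<le> j" "x \<in> H n" unfolding unhyperbolic_def by blast
    define m where "m = (GREATEST m. m \<le> j \<and> x \<in> H m)"
    have m: "m \<le> j" "x \<in> H m"
      using GreatestI_nat[of "\<lambda>m. m \<le> j \<and> x \<in> H m" n j] n unfolding m_def by auto
    have max: "k \<le> m" if "k \<le> j" "x \<in> H k" for k
      using Greatest_le_nat[of "\<lambda>m. m \<le> j \<and> x \<in> H m" k j] that unfolding m_def by auto
    have "(f ^^ m) x \<in> unhyperbolic (j - m)"
      unfolding unhyperbolic_def
    proof (intro CollectI allI impI notI)
      fix k assume k: "k \<le> j - m" "(f ^^ m) x \<in> H k"
      then have "k \<ge> 1" by (simp add: H_def hyperbolic_time_def)
      moreover have "m + k \<le> m"
        by (rule max) (use k(1) m(1) hyperbolic_time_add[OF m(2) k(2)] in auto)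
      ultimately show False by simp
    qed
    moreover have "(f ^^ (j - m)) ((f ^^ m) x) \<in> A"
      using x m(1) by (simp add: funpow_add[symmetric, THEN fun_cong, unfolded o_apply])
    ultimately show ?thesis using m by blast
  qed (use x in blast)
qed

text \<open>\<open>\<nu>\<close> is \<open>c\<close> times the sum over \<open>i\<close> of the
  images under \<open>f ^^ i\<close> of Lebesgue measure restricted to
  \<open>unhyperbolic i\<close>; its mass is finite by \<open>summable_tail\<close>. In
  \<open>c\<close> the 1 accounts for the points without hyperbolic time up to \<open>j\<close>, the
  rest for pushing the other points forward to their last hyperbolic time by
  \<open>hyperbolic_push_le\<close>. Summing Radon-Nikodym densities instead of measures gives
  absolute continuity at once.\<close>

lemma ex_dominating_measure:
  "\<exists>\<nu>. finite_measure \<nu> \<and> sets \<nu> = sets borel \<and> absolutely_continuous circle_lebesgue \<nu> \<and>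
    (\<forall>j. \<forall>A\<in>sets borel. emeasure circle_lebesgue ((f ^^ j) -` A) \<le> emeasure \<nu> A)"
proof -
  define c where "c = 1 + ennreal (exp (2 * S\<^sub>1) / \<theta>) * 3"
  have c: "c < \<infinity>" unfolding c_def by (simp add: ennreal_mult_less_top)
  define N where "N i = distr (density circle_lebesgue (indicator (unhyperbolic i))) borel (f ^^ i)" for i
  have N_sets: "sets (N i) = sets circle_lebesgue" for i by (simp add: N_def)
  have N_eq: "emeasure (N i) A = emeasure circle_lebesgue (unhyperbolic i \<inter> (f ^^ i) -` A)"
    if A: "A \<in> sets borel" for i A
  proof -
    have A': "(f ^^ i) -` A \<in> sets circle_lebesgue" using funpow_vimage_borel[OF A] by simp
    have m: "(f ^^ i) \<in> density circle_lebesgue (indicator (unhyperbolic i)) \<rightarrow>\<^sub>M borel"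
      using borel_measurable_funpow[of i] by simp
    have "emeasure (N i) A = emeasure (density circle_lebesgue (indicator (unhyperbolic i))) ((f ^^ i) -` A)"
      unfolding N_def using emeasure_distr[OF m A] by simp
    also have "\<dots> = (\<integral>\<^sup>+x. indicator (unhyperbolic i) x * indicator ((f ^^ i) -` A) x \<partial>circle_lebesgue)"
      using A' by (intro emeasure_density) auto
    also have "\<dots> = (\<integral>\<^sup>+x. indicator (unhyperbolic i \<inter> (f ^^ i) -` A) x \<partial>circle_lebesgue)"
      by (simp add: indicator_inter_arith)
    also have "\<dots> = emeasure circle_lebesgue (unhyperbolic i \<inter> (f ^^ i) -` A)"
      using A' by simp
    finally show ?thesis .
  qed
  have N_ac: "absolutely_continuous circle_lebesgue (N i)" for i
    unfolding absolutely_continuous_def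
  proof
    fix A assume A: "A \<in> null_sets circle_lebesgue"
    then have Ab: "A \<in> sets borel" "emeasure circle_lebesgue A = 0" by auto
    have "emeasure (N i) A \<le> emeasure circle_lebesgue ((f ^^ i) -` A)"
      unfolding N_eq[OF Ab(1)] using funpow_vimage_borel[OF Ab(1)] by (intro emeasure_mono) auto
    then have "emeasure (N i) A = 0" using null_vimage_funpow[OF Ab] by simp
    then show "A \<in> null_sets (N i)" using Ab by (auto simp: null_sets_def N_sets)
  qed
  define d where "d i = RN_deriv circle_lebesgue (N i)" for i
  have d: "density circle_lebesgue (d i) = N i" for i
    unfolding d_def by (rule circle_lebesgue.density_RN_deriv[OF N_ac N_sets])
  have d_m: "d i \<in> borel_measurable circle_lebesgue" for i unfolding d_def by simp
  define \<nu> where "\<nu> = density circle_lebesgue (\<lambda>x. \<Sum>i. c * d i x)"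
  have \<nu>_m: "(\<lambda>x. \<Sum>i. c * d i x) \<in> borel_measurable circle_lebesgue"
    using d_m by simp
  have \<nu>_sets: "sets \<nu> = sets borel" by (simp add: \<nu>_def)
  have \<nu>_eq: "emeasure \<nu> A = (\<Sum>i. c * emeasure circle_lebesgue (unhyperbolic i \<inter> (f ^^ i) -` A))"
    if A: "A \<in> sets borel" for A
  proof -
    have A': "A \<in> sets circle_lebesgue" using A by simp
    have "emeasure \<nu> A = (\<integral>\<^sup>+x. (\<Sum>i. c * d i x) * indicator A x \<partial>circle_lebesgue)"
      unfolding \<nu>_def by (rule emeasure_density[OF \<nu>_m A'])
    also have "\<dots> = (\<integral>\<^sup>+x. (\<Sum>i. c * (d i x * indicator A x)) \<partial>circle_lebesgue)"
      by (simp only: ennreal_suminf_multc[symmetric] mult.assoc)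
    also have "\<dots> = (\<Sum>i. \<integral>\<^sup>+x. c * (d i x * indicator A x) \<partial>circle_lebesgue)"
      using d_m A' by (intro nn_integral_suminf) auto
    also have "\<dots> = (\<Sum>i. c * (\<integral>\<^sup>+x. d i x * indicator A x \<partial>circle_lebesgue))"
      using d_m A' by (simp add: nn_integral_cmult)
    also have "\<dots> = (\<Sum>i. c * emeasure (N i) A)"
      by (simp only: d[symmetric] emeasure_density[OF d_m A'])
    finally show ?thesis using N_eq[OF A] by simp
  qed
  have fin: "finite_measure \<nu>"
  proof (rule finite_measureI)
    have "space \<nu> = UNIV" by (simp add: \<nu>_def)
    then have "emeasure \<nu> (space \<nu>) = c * (\<Sum>i. emeasure circle_lebesgue (unhyperbolic i))"
      using \<nu>_eq[of UNIV] by simp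
    also have "\<dots> < \<infinity>"
      using summable_tail c unfolding unhyperbolic_def by (simp add: ennreal_mult_less_top)
    finally show "emeasure \<nu> (space \<nu>) \<noteq> \<infinity>" by simp
  qed
  have ac: "absolutely_continuous circle_lebesgue \<nu>"
    unfolding \<nu>_def using \<nu>_m by (rule absolutely_continuousI_density)
  have "emeasure circle_lebesgue ((f ^^ j) -` A) \<le> emeasure \<nu> A" if A: "A \<in> sets borel" for j A
  proof -
    let ?E = "\<lambda>i. unhyperbolic i \<inter> (f ^^ i) -` A"
    have Eb: "?E i \<in> sets borel" for i using funpow_vimage_borel[OF A] by simp
    have HEb: "H m \<inter> (f ^^ m) -` ?E i \<in> sets borel" for m i using funpow_vimage_borel[OF Eb] by simp
    let ?l = "emeasure circle_lebesgue"
    have "?l ((f ^^ j) -` A) \<le> ?l (?E j \<union> (\<Union>m\<le>j. H m \<inter> (f ^^ m) -` ?E (j - m)))"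
      using vimage_funpow_subset Eb HEb by (intro emeasure_mono) auto
    also have "\<dots> \<le> ?l (?E j) + ?l (\<Union>m\<le>j. H m \<inter> (f ^^ m) -` ?E (j - m))"
      using Eb HEb by (intro emeasure_subadditive) auto
    also have "?l (\<Union>m\<le>j. H m \<inter> (f ^^ m) -` ?E (j - m)) \<le> (\<Sum>m\<le>j. ?l (H m \<inter> (f ^^ m) -` ?E (j - m)))"
      using HEb by (intro emeasure_subadditive_finite) auto
    also have "\<dots> \<le> (\<Sum>m\<le>j. (ennreal (exp (2 * S\<^sub>1) / \<theta>) * 3) * ?l (?E (j - m)))"
      using hyperbolic_push_le[OF Eb] by (intro sum_mono) auto
    also have "\<dots> = (\<Sum>m\<le>j. (ennreal (exp (2 * S\<^sub>1) / \<theta>) * 3) * ?l (?E m))"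
      by (rule sum.nat_diff_reindex[of _ "Suc j", simplified lessThan_Suc_atMost, simplified])
    also have "?l (?E j) \<le> (\<Sum>m\<le>j. ?l (?E m))" by (rule member_le_sum) auto
    finally have "?l ((f ^^ j) -` A) \<le> (\<Sum>m\<le>j. ?l (?E m)) + (\<Sum>m\<le>j. (ennreal (exp (2 * S\<^sub>1) / \<theta>) * 3) * ?l (?E m))"
      by (simp add: add_right_mono add_left_mono)
    also have "\<dots> = (\<Sum>m\<le>j. c * ?l (?E m))"
      by (simp add: c_def distrib_right sum.distrib)
    also have "\<dots> \<le> (\<Sum>m. c * ?l (?E m))" by (rule sum_le_suminf) auto
    also have "\<dots> = emeasure \<nu> A" by (rule \<nu>_eq[OF A, symmetric])
    finally show ?thesis .
  qed
  then show ?thesis using fin \<nu>_sets ac by blast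
qed

end

section \<open>Transitive maps\<close>

text \<open>The hyperbolic structure enters the remaining argument only through
  \<open>nonsingular\<close> and \<open>blow_up\<close>, and later through the domination by
  \<open>\<nu>\<close>.\<close>

locale transitive_circle_map =
  fixes f :: "circle \<Rightarrow> circle"
  assumes continuous_f: "continuous_on UNIV f"
    and dense_orbit: "has_dense_orbit f"
    and nonsingular: "A \<in> sets borel \<Longrightarrow> emeasure circle_lebesgue A = 0 \<Longrightarrow> emeasure circle_lebesgue (f -` A) = 0"
    and blow_up: "D \<in> sets borel \<Longrightarrow> (\<And>x. x \<in> D \<Longrightarrow> f x \<in> D) \<Longrightarrow> emeasure circle_lebesgue D > 0 \<Longrightarrow>
      \<exists>A. open A \<and> A \<noteq> {} \<and> emeasure circle_lebesgue (A - D) = 0"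
begin

lemma f_borel [measurable]: "f \<in> borel_measurable borel"
  by (rule borel_measurable_continuous_onI[OF continuous_f])

lemma funpow_borel [measurable]: "(f ^^ n) \<in> borel_measurable borel"
  by (induction n) (simp_all add: id_def o_def)

lemma vimage_funpow_borel: "A \<in> sets borel \<Longrightarrow> (f ^^ n) -` A \<in> sets borel"
  using measurable_sets_borel[OF funpow_borel] by blast

lemma continuous_funpow: "continuous_on UNIV (f ^^ n)"
proof (induction n)
  case (Suc n)
  then show ?case
    unfolding funpow.simps using continuous_on_subset[OF continuous_f subset_UNIV]
    by (intro continuous_on_compose)
qed (simp add: continuous_on_id id_def)

lemma open_vimage_funpow: "open A \<Longrightarrow> open ((f ^^ n) -` A)"
  by (rule open_vimage[OF _ continuous_funpow])

lemma null_vimage_funpow: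
  assumes "A \<in> sets borel" "emeasure circle_lebesgue A = 0"
  shows "emeasure circle_lebesgue ((f ^^ n) -` A) = 0"
proof (induction n)
  case (Suc n)
  have "(f ^^ Suc n) -` A = f -` ((f ^^ n) -` A)"
    by (auto simp: funpow_swap1)
  show ?case
    unfolding \<open>(f ^^ Suc n) -` A = f -` ((f ^^ n) -` A)\<close>
    by (rule nonsingular[OF vimage_funpow_borel[OF assms(1)] Suc])
qed (use assms in simp)

text \<open>The dense orbit may meet \<open>V\<close> before \<open>U\<close>. Finite sets being
  null, \<open>V\<close> without the first \<open>n + 1\<close> orbit points is still open and
  nonempty, so the orbit meets it after time \<open>n\<close>.\<close>

lemma transitive:
  assumes "open U" "U \<noteq> {}" "open V" "V \<noteq> {}"
  shows "\<exists>n. \<exists>x\<in>U. (f ^^ n) x \<in> V"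
proof -
  obtain x where x: "closure (range (\<lambda>n. (f ^^ n) x)) = UNIV"
    using dense_orbit unfolding has_dense_orbit_def by blast
  have hit: "\<exists>n. (f ^^ n) x \<in> W" if "open W" "W \<noteq> {}" for W
    using that x open_Int_closure_eq_empty[of W "range (\<lambda>n. (f ^^ n) x)"] by auto
  obtain n where n: "(f ^^ n) x \<in> U" using hit assms(1,2) by blast
  define J where "J = (\<lambda>j. (f ^^ j) x) ` {..n}"
  have J: "finite J" unfolding J_def by simp
  have "V - J \<noteq> {}"
  proof
    assume "V - J = {}"
    then have "V \<subseteq> J" by blast
    then have "emeasure circle_lebesgue V \<le> emeasure circle_lebesgue J"
      using J by (intro emeasure_mono) (auto intro: borel_closed finite_imp_closed)
    also have "\<dots> = 0"
    proof -
      have "emeasure circle_lebesgue {y} = 0" for y :: circle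
      proof -
        have "emeasure circle_lebesgue {y} \<le> ennreal e" if "e > 0" for e
        proof -
          have "emeasure circle_lebesgue {y} \<le> emeasure circle_lebesgue (ball y (e / 2))"
            using that by (intro emeasure_mono) auto
          also have "\<dots> \<le> ennreal (2 * (e / 2))"
            using that by (intro emeasure_circle_lebesgue_ball_le) simp
          finally show ?thesis by simp
        qed
        then have "emeasure circle_lebesgue {y} \<le> 0"
          by (intro ennreal_le_epsilon[of 0]) simp
        then show ?thesis by simp
      qed
      then show ?thesis using J by (subst emeasure_eq_sum_singleton) auto
    qed
    finally show False using emeasure_circle_lebesgue_open_pos[OF assms(3,4)] by simp
  qed
  moreover have "open (V - J)" using assms(3) J by (simp add: finite_imp_closed open_Diff)
  ultimately obtain m where m: "(f ^^ m) x \<in> V - J" using hit by blast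
  then have "m > n" unfolding J_def by (metis DiffD2 atMost_iff image_eqI not_le)
  then have "(f ^^ (m - n)) ((f ^^ n) x) = (f ^^ m) x"
    by (simp add: funpow_add[symmetric, THEN fun_cong, unfolded o_apply])
  then show ?thesis using n m by (intro exI[of _ "m - n"] bexI[of _ "(f ^^ n) x"]) auto
qed

lemma forward_invariant_funpow:
  assumes "\<And>x. x \<in> D \<Longrightarrow> f x \<in> D" "x \<in> D"
  shows "(f ^^ n) x \<in> D"
  using assms(2) by (induction n) (auto simp: assms(1))

text \<open>The sets contain almost all of some nonempty open sets \<open>U\<close> and
  \<open>V\<close>. Transitivity provides an open part of \<open>U\<close> that
  \<open>f ^^ n\<close> sends into \<open>V\<close>, and by nonsingularity almost every point of it
  starts in \<open>D\<close> and ends in \<open>E\<close>; its image lies in both.\<close>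

lemma forward_invariant_Int_nonempty:
  assumes D: "D \<in> sets borel" "\<And>x. x \<in> D \<Longrightarrow> f x \<in> D" "emeasure circle_lebesgue D > 0"
    and E: "E \<in> sets borel" "\<And>x. x \<in> E \<Longrightarrow> f x \<in> E" "emeasure circle_lebesgue E > 0"
  shows "D \<inter> E \<noteq> {}"
proof -
  obtain U where U: "open U" "U \<noteq> {}" "emeasure circle_lebesgue (U - D) = 0" using blow_up[OF D] by blast
  obtain V where V: "open V" "V \<noteq> {}" "emeasure circle_lebesgue (V - E) = 0" using blow_up[OF E] by blast
  obtain n where n: "U \<inter> (f ^^ n) -` V \<noteq> {}" using transitive[OF U(1,2) V(1,2)] by blast
  define J where "J = U \<inter> (f ^^ n) -` V"
  have "open J" unfolding J_def using U(1) open_vimage_funpow[OF V(1)] by blast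
  then have J: "emeasure circle_lebesgue J > 0"
    using n by (intro emeasure_circle_lebesgue_open_pos) (auto simp: J_def)
  have VE: "V - E \<in> sets borel" using V(1) E(1) by simp
  have "J \<inter> D \<inter> (f ^^ n) -` E \<noteq> {}"
  proof
    assume "J \<inter> D \<inter> (f ^^ n) -` E = {}"
    then have "J \<subseteq> (U - D) \<union> (f ^^ n) -` (V - E)" unfolding J_def by blast
    then have "emeasure circle_lebesgue J \<le> emeasure circle_lebesgue ((U - D) \<union> (f ^^ n) -` (V - E))"
      using U(1) D(1) vimage_funpow_borel[OF VE] by (intro emeasure_mono) auto
    also have "\<dots> \<le> emeasure circle_lebesgue (U - D) + emeasure circle_lebesgue ((f ^^ n) -` (V - E))"
      using U(1) D(1) vimage_funpow_borel[OF VE] by (intro emeasure_subadditive) auto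
    also have "\<dots> = 0" using U(3) null_vimage_funpow[OF VE V(3)] by simp
    finally show False using J by simp
  qed
  then show ?thesis using forward_invariant_funpow[OF D(2)] by blast
qed

text \<open>The points that never enter \<open>A\<close> form a closed forward invariant set. With
  positive measure it would contain almost all of a nonempty open set, hence all of it, against
  transitivity.\<close>

lemma AE_hits_open:
  assumes A: "open A" "A \<noteq> {}"
  shows "AE x in circle_lebesgue. \<exists>n. (f ^^ n) x \<in> A"
proof -
  define D where "D = (\<Inter>n. (f ^^ n) -` (- A))"
  have "closed ((f ^^ n) -` (- A))" for n
    using open_vimage_funpow[OF A(1), of n] by (simp add: closed_def vimage_Compl)
  then have D: "closed D" unfolding D_def by (intro closed_INT) auto
  have inv: "f x \<in> D" if "x \<in> D" for x
  proof -
    have "(f ^^ n) (f x) \<notin> A" for n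
    proof -
      have "(f ^^ Suc n) x \<notin> A" using that unfolding D_def by blast
      then show ?thesis by (simp only: funpow_Suc_right o_apply not_False_eq_True)
    qed
    then show ?thesis unfolding D_def by blast
  qed
  have "emeasure circle_lebesgue D = 0"
  proof (rule ccontr)
    assume "emeasure circle_lebesgue D \<noteq> 0"
    then have "emeasure circle_lebesgue D > 0" by (simp add: zero_less_iff_neq_zero)
    moreover have "D \<in> sets borel" using D by simp
    ultimately obtain U where U: "open U" "U \<noteq> {}" "emeasure circle_lebesgue (U - D) = 0"
      using blow_up[OF _ inv] by blast
    have "open (U - D)" using U(1) D by blast
    then have "U - D = {}" using U(3) emeasure_circle_lebesgue_open_pos by force
    moreover obtain n x where "x \<in> U" "(f ^^ n) x \<in> A" using transitive[OF U(1,2) A] by blast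
    ultimately show False unfolding D_def by blast
  qed
  then show ?thesis
    using D by (intro AE_I[of _ _ D]) (auto simp: D_def)
qed

lemma ac_measure_eq_0:
  assumes "absolutely_continuous circle_lebesgue \<mu>" "A \<in> sets borel" "emeasure circle_lebesgue A = 0"
  shows "emeasure \<mu> A = 0"
  using assms unfolding absolutely_continuous_def by (auto simp: null_sets_def)

text \<open>An invariant set and its complement are forward invariant and disjoint, so one of them
  is Lebesgue null.\<close>

lemma ac_ergodic:
  assumes "circle_prob \<mu>" "absolutely_continuous circle_lebesgue \<mu>"
  shows "ergodic_measure f \<mu>"
  unfolding ergodic_measure_def
proof (intro ballI impI)
  fix A assume A: "A \<in> sets borel" "f -` A = A"
  interpret prob_space \<mu> using assms(1) by (simp add: circle_prob_def)
  have [simp]: "sets \<mu> = sets borel" using assms(1) by (simp add: circle_prob_def)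
  from sets_eq_imp_space_eq[OF this] have sp: "space \<mu> = UNIV" by simp
  have inv: "f x \<in> A" if "x \<in> A" for x using A(2) that by blast
  have inv': "f x \<in> - A" if "x \<in> - A" for x using A(2) that by blast
  have Ac: "- A \<in> sets borel" using A(1) by simp
  have "\<not> (emeasure circle_lebesgue A > 0 \<and> emeasure circle_lebesgue (- A) > 0)"
    using forward_invariant_Int_nonempty[OF A(1) inv _ Ac inv'] by blast
  then have "emeasure circle_lebesgue A = 0 \<or> emeasure circle_lebesgue (- A) = 0"
    by (simp add: zero_less_iff_neq_zero)
  then have "emeasure \<mu> A = 0 \<or> emeasure \<mu> (- A) = 0"
    using ac_measure_eq_0[OF assms(2)] A(1) Ac by blast
  moreover have "measure \<mu> (- A) = 1 - measure \<mu> A"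
    using prob_compl[of A] A(1) sp by (simp add: Compl_eq_Diff_UNIV)
  ultimately show "measure \<mu> A = 0 \<or> measure \<mu> A = 1"
    by (auto simp: emeasure_eq_measure)
qed

text \<open>The difference of the two measures is positive on non-null subsets of \<open>P\<close>
  and nowhere positive outside \<open>P\<close>. Invariance gives it the same value on
  \<open>P\<close> and on the preimage of \<open>P\<close>, so the part \<open>Q\<close> of
  \<open>P\<close> that leaves \<open>P\<close> can only be null. Removing the preimages of
  \<open>Q\<close>, null by nonsingularity, leaves a genuinely forward invariant set.\<close>

lemma acip_larger_forward_invariant:
  fixes d\<^sub>1 d\<^sub>2 :: "circle \<Rightarrow> ennreal"
  assumes m [measurable]: "d\<^sub>1 \<in> borel_measurable borel" "d\<^sub>2 \<in> borel_measurable borel"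
  defines "\<mu>\<^sub>1 \<equiv> density circle_lebesgue d\<^sub>1" and "\<mu>\<^sub>2 \<equiv> density circle_lebesgue d\<^sub>2"
  assumes prob: "circle_prob \<mu>\<^sub>1" "circle_prob \<mu>\<^sub>2" and inv: "invariant_measure f \<mu>\<^sub>1" "invariant_measure f \<mu>\<^sub>2"
    and pos: "emeasure circle_lebesgue {x. d\<^sub>2 x < d\<^sub>1 x} > 0"
  shows "\<exists>D\<in>sets borel. (\<forall>x\<in>D. f x \<in> D) \<and> D \<subseteq> {x. d\<^sub>2 x < d\<^sub>1 x} \<and> emeasure circle_lebesgue D > 0"
proof -
  interpret M1: prob_space \<mu>\<^sub>1 using prob by (simp add: circle_prob_def)
  interpret M2: prob_space \<mu>\<^sub>2 using prob by (simp add: circle_prob_def)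
  have [simp]: "sets \<mu>\<^sub>1 = sets borel" "sets \<mu>\<^sub>2 = sets borel" by (simp_all add: \<mu>\<^sub>1_def \<mu>\<^sub>2_def)
  have [simp]: "space \<mu>\<^sub>1 = UNIV" "space \<mu>\<^sub>2 = UNIV" by (simp_all add: \<mu>\<^sub>1_def \<mu>\<^sub>2_def)
  define P where "P = {x. d\<^sub>2 x < d\<^sub>1 x}"
  have P [measurable]: "P \<in> sets borel" unfolding P_def by measurable
  have fP [measurable]: "f -` P \<in> sets borel" using measurable_sets_borel[OF f_borel P] .
  have le: "measure \<mu>\<^sub>1 E \<le> measure \<mu>\<^sub>2 E" if "E \<in> sets borel" "E \<inter> P = {}" for E
  proof -
    have "emeasure \<mu>\<^sub>1 E \<le> emeasure \<mu>\<^sub>2 E"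
      unfolding \<mu>\<^sub>1_def \<mu>\<^sub>2_def using that
      by (simp add: emeasure_density) (intro nn_integral_mono, auto simp: P_def split: split_indicator)
    then show ?thesis by (simp add: M1.emeasure_eq_measure M2.emeasure_eq_measure)
  qed
  have fm: "f \<in> measurable \<mu>\<^sub>1 borel" "f \<in> measurable \<mu>\<^sub>2 borel"
    using f_borel by (simp_all cong: measurable_cong_sets)
  have inv1: "measure \<mu>\<^sub>1 (f -` P) = measure \<mu>\<^sub>1 P" and inv2: "measure \<mu>\<^sub>2 (f -` P) = measure \<mu>\<^sub>2 P"
    using inv measure_distr[OF fm(1) P] measure_distr[OF fm(2) P]
    by (simp_all add: invariant_measure_def)
  define Q where "Q = P - f -` P"
  have Q [measurable]: "Q \<in> sets borel" unfolding Q_def by measurable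
  have s1: "measure \<mu>\<^sub>1 (f -` P - P) = measure \<mu>\<^sub>1 (f -` P) - measure \<mu>\<^sub>1 (f -` P \<inter> P)"
    and s2: "measure \<mu>\<^sub>2 (f -` P - P) = measure \<mu>\<^sub>2 (f -` P) - measure \<mu>\<^sub>2 (f -` P \<inter> P)"
    using M1.finite_measure_Diff'[of "f -` P" P] M2.finite_measure_Diff'[of "f -` P" P] by simp_all
  have t1: "measure \<mu>\<^sub>1 Q = measure \<mu>\<^sub>1 P - measure \<mu>\<^sub>1 (f -` P \<inter> P)"
    and t2: "measure \<mu>\<^sub>2 Q = measure \<mu>\<^sub>2 P - measure \<mu>\<^sub>2 (f -` P \<inter> P)"
    using M1.finite_measure_Diff'[of P "f -` P"] M2.finite_measure_Diff'[of P "f -` P"]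
    by (simp_all add: Q_def Int_commute)
  have "measure \<mu>\<^sub>1 (f -` P - P) \<le> measure \<mu>\<^sub>2 (f -` P - P)" by (rule le) auto
  then have "measure \<mu>\<^sub>1 Q \<le> measure \<mu>\<^sub>2 Q" using s1 s2 t1 t2 inv1 inv2 by linarith
  then have "emeasure \<mu>\<^sub>1 Q \<le> emeasure \<mu>\<^sub>2 Q"
    by (simp add: M1.emeasure_eq_measure M2.emeasure_eq_measure)
  then have int_le: "(\<integral>\<^sup>+x. d\<^sub>1 x * indicator Q x \<partial>circle_lebesgue) \<le> (\<integral>\<^sup>+x. d\<^sub>2 x * indicator Q x \<partial>circle_lebesgue)"
    unfolding \<mu>\<^sub>1_def \<mu>\<^sub>2_def by (simp add: emeasure_density)
  have fin: "(\<integral>\<^sup>+x. d\<^sub>2 x * indicator Q x \<partial>circle_lebesgue) \<noteq> \<infinity>"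
    using M2.emeasure_finite[of Q] unfolding \<mu>\<^sub>2_def by (simp add: emeasure_density)
  have "AE x in circle_lebesgue. d\<^sub>2 x * indicator Q x \<le> d\<^sub>1 x * indicator Q x"
    by (auto simp: Q_def P_def less_imp_le split: split_indicator)
  then have "(\<integral>\<^sup>+x. d\<^sub>1 x * indicator Q x - d\<^sub>2 x * indicator Q x \<partial>circle_lebesgue)
      = (\<integral>\<^sup>+x. d\<^sub>1 x * indicator Q x \<partial>circle_lebesgue) - (\<integral>\<^sup>+x. d\<^sub>2 x * indicator Q x \<partial>circle_lebesgue)"
    using fin by (intro nn_integral_diff) auto
  also have "\<dots> = 0" using int_le fin by (simp add: diff_eq_0_iff_ennreal less_top)
  finally have "AE x in circle_lebesgue. d\<^sub>1 x * indicator Q x - d\<^sub>2 x * indicator Q x = 0"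
    by (subst (asm) nn_integral_0_iff_AE) auto
  then have "AE x in circle_lebesgue. x \<notin> Q"
    by eventually_elim (auto simp: Q_def P_def diff_eq_0_iff_ennreal split: split_indicator_asm)
  then have Q0: "emeasure circle_lebesgue Q = 0"
    by (subst (asm) AE_iff_measurable[OF _ refl]) auto
  define D where "D = (\<Inter>n. (f ^^ n) -` P)"
  have Db: "D \<in> sets borel" unfolding D_def using vimage_funpow_borel[OF P] by blast
  have Dinv: "f x \<in> D" if "x \<in> D" for x
  proof -
    have "(f ^^ n) (f x) \<in> P" for n
    proof -
      have "(f ^^ Suc n) x \<in> P" using that unfolding D_def by blast
      then show ?thesis by (simp only: funpow_Suc_right o_apply)
    qed
    then show ?thesis unfolding D_def by blast
  qed
  have DP: "D \<subseteq> P" 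
  proof
    fix x assume "x \<in> D"
    then have "x \<in> (f ^^ 0) -` P" unfolding D_def by blast
    then show "x \<in> P" by simp
  qed
  have "P \<subseteq> D \<union> (\<Union>n. (f ^^ n) -` Q)"
  proof
    fix x assume x: "x \<in> P"
    show "x \<in> D \<union> (\<Union>n. (f ^^ n) -` Q)"
    proof (rule ccontr)
      assume no: "x \<notin> D \<union> (\<Union>n. (f ^^ n) -` Q)"
      have "(f ^^ n) x \<in> P" for n
      proof (induction n)
        case (Suc n)
        then show ?case using no unfolding Q_def by auto
      qed (use x in simp)
      then show False using no unfolding D_def by blast
    qed
  qed
  then have "emeasure circle_lebesgue P \<le> emeasure circle_lebesgue (D \<union> (\<Union>n. (f ^^ n) -` Q))"
    using Db vimage_funpow_borel[OF Q] by (intro emeasure_mono) auto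
  also have "\<dots> \<le> emeasure circle_lebesgue D + emeasure circle_lebesgue (\<Union>n. (f ^^ n) -` Q)"
    using Db vimage_funpow_borel[OF Q] by (intro emeasure_subadditive) auto
  also have "emeasure circle_lebesgue (\<Union>n. (f ^^ n) -` Q) \<le> (\<Sum>n. emeasure circle_lebesgue ((f ^^ n) -` Q))"
    using vimage_funpow_borel[OF Q] by (intro emeasure_subadditive_countably) auto
  also have "\<dots> = 0" using null_vimage_funpow[OF Q Q0] by simp
  finally have "emeasure circle_lebesgue P \<le> emeasure circle_lebesgue D" by (simp add: add_left_mono)
  then show ?thesis using Db Dinv DP pos unfolding P_def by (intro bexI[of _ D]) auto
qed

text \<open>If each density exceeded the other on a set of positive measure, there would be disjoint
  forward invariant sets of positive measure. So one density is almost everywhere at most the other,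
  and equal total mass makes them agree.\<close>

lemma acip_unique:
  assumes prob: "circle_prob \<mu>\<^sub>1" "circle_prob \<mu>\<^sub>2" and inv: "invariant_measure f \<mu>\<^sub>1" "invariant_measure f \<mu>\<^sub>2"
    and ac: "absolutely_continuous circle_lebesgue \<mu>\<^sub>1" "absolutely_continuous circle_lebesgue \<mu>\<^sub>2"
  shows "\<mu>\<^sub>1 = \<mu>\<^sub>2"
proof -
  define d where "d = RN_deriv circle_lebesgue"
  have m [measurable]: "d \<mu> \<in> borel_measurable borel" for \<mu>
    using borel_measurable_RN_deriv[of circle_lebesgue \<mu>] unfolding d_def
    by (simp cong: measurable_cong_sets)
  have dens: "density circle_lebesgue (d \<mu>\<^sub>1) = \<mu>\<^sub>1" "density circle_lebesgue (d \<mu>\<^sub>2) = \<mu>\<^sub>2"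
    unfolding d_def using prob
    by (auto simp: circle_prob_def intro: circle_lebesgue.density_RN_deriv[OF ac(1)] circle_lebesgue.density_RN_deriv[OF ac(2)])
  have le_imp: "density circle_lebesgue g = density circle_lebesgue h"
    if gh: "g \<in> borel_measurable borel" "h \<in> borel_measurable borel"
      "circle_prob (density circle_lebesgue g)" "circle_prob (density circle_lebesgue h)"
      "emeasure circle_lebesgue {x. h x < g x} = 0" for g h :: "circle \<Rightarrow> ennreal"
  proof -
    have [measurable]: "g \<in> borel_measurable borel" "h \<in> borel_measurable borel" by fact+
    have ae: "AE x in circle_lebesgue. g x \<le> h x"
      using gh(5) by (intro AE_I[of _ _ "{x. h x < g x}"]) (auto simp: not_le)
    have I: "(\<integral>\<^sup>+x. g x \<partial>circle_lebesgue) = 1" "(\<integral>\<^sup>+x. h x \<partial>circle_lebesgue) = 1"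
      using gh(3,4) prob_space.emeasure_space_1[of "density circle_lebesgue g"]
        prob_space.emeasure_space_1[of "density circle_lebesgue h"]
      unfolding circle_prob_def by (simp_all add: emeasure_density)
    have "(\<integral>\<^sup>+x. h x - g x \<partial>circle_lebesgue) = (\<integral>\<^sup>+x. h x \<partial>circle_lebesgue) - (\<integral>\<^sup>+x. g x \<partial>circle_lebesgue)"
      using ae I by (intro nn_integral_diff) auto
    then have "(\<integral>\<^sup>+x. h x - g x \<partial>circle_lebesgue) = 0" using I by simp
    then have "AE x in circle_lebesgue. h x - g x = 0"
      by (subst (asm) nn_integral_0_iff_AE) auto
    moreover have "AE x in circle_lebesgue. h x \<noteq> \<infinity>"
      using I by (intro nn_integral_PInf_AE) auto
    ultimately have "AE x in circle_lebesgue. g x = h x"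
      using ae by eventually_elim (auto simp: diff_eq_0_iff_ennreal less_top)
    then show ?thesis by (intro density_cong) auto
  qed
  have "emeasure circle_lebesgue {x. d \<mu>\<^sub>2 x < d \<mu>\<^sub>1 x} = 0 \<or> emeasure circle_lebesgue {x. d \<mu>\<^sub>1 x < d \<mu>\<^sub>2 x} = 0"
  proof (rule ccontr)
    assume "\<not> ?thesis"
    then have pos: "emeasure circle_lebesgue {x. d \<mu>\<^sub>2 x < d \<mu>\<^sub>1 x} > 0" "emeasure circle_lebesgue {x. d \<mu>\<^sub>1 x < d \<mu>\<^sub>2 x} > 0"
      by (auto simp: zero_less_iff_neq_zero)
    obtain D where D: "D \<in> sets borel" "\<forall>x\<in>D. f x \<in> D" "D \<subseteq> {x. d \<mu>\<^sub>2 x < d \<mu>\<^sub>1 x}" "emeasure circle_lebesgue D > 0"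
      using acip_larger_forward_invariant[OF m[of \<mu>\<^sub>1] m[of \<mu>\<^sub>2], unfolded dens, OF prob inv pos(1)] by blast
    obtain E where E: "E \<in> sets borel" "\<forall>x\<in>E. f x \<in> E" "E \<subseteq> {x. d \<mu>\<^sub>1 x < d \<mu>\<^sub>2 x}" "emeasure circle_lebesgue E > 0"
      using acip_larger_forward_invariant[OF m[of \<mu>\<^sub>2] m[of \<mu>\<^sub>1], unfolded dens, OF prob(2,1) inv(2,1) pos(2)] by blast
    have "D \<inter> E \<noteq> {}" using forward_invariant_Int_nonempty D E by blast
    then obtain x where "x \<in> D" "x \<in> E" by blast
    then have "d \<mu>\<^sub>2 x < d \<mu>\<^sub>1 x" "d \<mu>\<^sub>1 x < d \<mu>\<^sub>2 x" using D(3) E(3) by blast+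
    then show False by (rule less_asym)
  qed
  then show ?thesis
    using le_imp[OF m[of \<mu>\<^sub>1] m[of \<mu>\<^sub>2], unfolded dens, OF prob]
      le_imp[OF m[of \<mu>\<^sub>2] m[of \<mu>\<^sub>1], unfolded dens, OF prob(2,1)] by blast
qed

end

section \<open>Towers\<close>

definition thicken :: "real \<Rightarrow> circle set \<Rightarrow> circle set" where
  "thicken \<eta> A = (\<Union>a\<in>A. ball a \<eta>)"

lemma open_thicken: "open (thicken \<eta> A)"
  by (auto simp: thicken_def)

lemma thicken_borel [measurable]: "thicken \<eta> A \<in> sets borel"
  using open_thicken by simp

lemma thicken_mono: "A \<subseteq> B \<Longrightarrow> \<eta> \<le> \<eta>' \<Longrightarrow> thicken \<eta> A \<subseteq> thicken \<eta>' B"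
  unfolding thicken_def using subset_ball by blast

lemma mem_thicken: "x \<in> thicken \<eta> A \<longleftrightarrow> (\<exists>a\<in>A. dist x a < \<eta>)"
  by (auto simp: thicken_def dist_commute)

lemma sphere_circle_borel [measurable]: "sphere (x :: circle) r \<in> sets borel"
proof -
  have "sphere x r = cball x r - ball x r" by auto
  then show ?thesis by simp
qed

lemma emeasure_circle_lebesgue_sphere: "emeasure circle_lebesgue (sphere x r) = 0"
proof -
  obtain t where t: "x = to_circle t" using surj_to_circle by blast
  have "{t - 1/2..<t - 1/2 + 1} \<inter> to_circle -` sphere x r \<subseteq> {t - r, t + r}"
  proof
    fix u assume u: "u \<in> {t - 1/2..<t - 1/2 + 1} \<inter> to_circle -` sphere x r"
    then have "t - 1/2 \<le> u" "u < t + 1/2" by auto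
    then have "dist (to_circle t) (to_circle u) = \<bar>t - u\<bar>"
      by (intro dist_to_circle_eq) linarith
    then show "u \<in> {t - r, t + r}" using u t by auto
  qed
  then have "emeasure lborel ({t - 1/2..<t - 1/2 + 1} \<inter> to_circle -` sphere x r) \<le> emeasure lborel {t - r, t + r}"
    by (rule emeasure_mono) auto
  also have "\<dots> = 0" by (rule emeasure_lborel_countable) simp
  finally show ?thesis
    unfolding emeasure_circle_lebesgue_Ico[OF sphere_circle_borel, of x r "t - 1/2"] by simp
qed

text \<open>The sets of the tower are built from balls so that their frontiers are null; this is the
  source of the local constancy of the noise amplitude almost everywhere.\<close>

lemma frontier_cball_null: "emeasure circle_lebesgue (frontier (cball x r)) = 0"
proof -
  have "frontier (cball x r) \<subseteq> sphere x r"
  proof -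
    have "closure (cball x r) - interior (cball x r) \<subseteq> cball x r - ball x r"
      using interior_maximal[OF ball_subset_cball[of x r] open_ball] by (auto simp: closure_closed)
    also have "\<dots> \<subseteq> sphere x r" by auto
    finally show ?thesis by (simp add: frontier_def)
  qed
  then show ?thesis
    using emeasure_mono[of "frontier (cball x r)" "sphere x r" circle_lebesgue] emeasure_circle_lebesgue_sphere[of x r]
    by simp
qed

lemma frontier_ball_null: "emeasure circle_lebesgue (frontier (ball x r)) = 0"
proof -
  have "closure (ball x r) \<subseteq> cball x r" by (rule closure_minimal) auto
  then have "frontier (ball x r) \<subseteq> sphere x r"
    unfolding frontier_def by (auto simp: interior_open)
  then show ?thesis
    using emeasure_mono[of "frontier (ball x r)" "sphere x r" circle_lebesgue] emeasure_circle_lebesgue_sphere[of x r]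
    by simp
qed

lemma null_Un: "A \<in> sets M \<Longrightarrow> B \<in> sets M \<Longrightarrow> emeasure M A = 0 \<Longrightarrow> emeasure M B = 0 \<Longrightarrow> emeasure M (A \<union> B) = 0"
  using emeasure_subadditive[of A M B] by simp

lemma null_frontier_Un:
  fixes A B :: "circle set"
  assumes "emeasure circle_lebesgue (frontier A) = 0" "emeasure circle_lebesgue (frontier B) = 0"
  shows "emeasure circle_lebesgue (frontier (A \<union> B)) = 0"
proof -
  have "emeasure circle_lebesgue (frontier (A \<union> B)) \<le> emeasure circle_lebesgue (frontier A \<union> frontier B)"
    using frontier_Un_subset by (intro emeasure_mono) auto
  then show ?thesis using null_Un[of "frontier A" circle_lebesgue "frontier B"] assms by simp
qed

lemma null_frontier_Union:
  fixes \<A> :: "circle set set"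
  assumes "finite \<A>" "\<And>A. A \<in> \<A> \<Longrightarrow> emeasure circle_lebesgue (frontier A) = 0"
  shows "emeasure circle_lebesgue (frontier (\<Union>\<A>)) = 0"
  using assms by (induction \<A> rule: finite_induct) (auto intro: null_frontier_Un)

lemma null_frontier_Diff:
  fixes A B :: "circle set"
  assumes "emeasure circle_lebesgue (frontier A) = 0" "emeasure circle_lebesgue (frontier B) = 0"
  shows "emeasure circle_lebesgue (frontier (A - B)) = 0"
proof -
  have "emeasure circle_lebesgue (frontier (- A)) = 0" using assms(1) by simp
  then have "emeasure circle_lebesgue (frontier (- A \<union> B)) = 0" using assms(2) by (rule null_frontier_Un)
  moreover have "frontier (A - B) = frontier (- A \<union> B)"
    by (metis frontier_complement Compl_Un Diff_eq double_compl)
  ultimately show ?thesis by simp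
qed

section \<open>Sets of small measure that every orbit meets soon\<close>

locale dominated_circle_map = transitive_circle_map +
  fixes \<nu> :: "circle measure"
  assumes finite_\<nu>: "finite_measure \<nu>" and sets_\<nu> [simp, measurable_cong]: "sets \<nu> = sets borel"
    and ac_\<nu>: "absolutely_continuous circle_lebesgue \<nu>"
    and dominated: "A \<in> sets borel \<Longrightarrow> emeasure circle_lebesgue ((f ^^ j) -` A) \<le> emeasure \<nu> A"
begin

sublocale \<nu>: finite_measure \<nu> by (rule finite_\<nu>)

lemma space_\<nu> [simp]: "space \<nu> = UNIV"
  using sets_eq_imp_space_eq[OF sets_\<nu>] by simp

lemma null_\<nu>: "A \<in> sets borel \<Longrightarrow> emeasure circle_lebesgue A = 0 \<Longrightarrow> measure \<nu> A = 0"
  using ac_measure_eq_0[OF ac_\<nu>] by (simp add: measure_def)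

text \<open>\<open>\<nu>\<close> has no atoms, as it is absolutely continuous. The Heine-Borel lemma
  makes the radius uniform.\<close>

lemma small_balls:
  assumes "\<tau> > 0"
  shows "\<exists>\<rho>>0. \<forall>x. measure \<nu> (ball x \<rho>) \<le> \<tau>"
proof -
  have "\<exists>r>0. measure \<nu> (ball x r) < \<tau>" for x
  proof -
    have "(\<lambda>n. measure \<nu> (ball x (inverse (real (Suc n))))) \<longlonglongrightarrow> measure \<nu> (\<Inter>n. ball x (inverse (real (Suc n))))"
    proof (rule \<nu>.finite_Lim_measure_decseq)
      show "decseq (\<lambda>n. ball x (inverse (real (Suc n))))"
        by (rule decseq_SucI) (auto intro!: subset_ball le_imp_inverse_le)
    qed auto
    moreover have "(\<Inter>n. ball x (inverse (real (Suc n)))) \<subseteq> sphere x 0"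
    proof
      fix y assume y: "y \<in> (\<Inter>n. ball x (inverse (real (Suc n))))"
      have "dist x y \<le> 0"
      proof (rule ccontr)
        assume "\<not> dist x y \<le> 0"
        then obtain n where "inverse (real (Suc n)) < dist x y" using reals_Archimedean[of "dist x y"] by auto
        moreover have "dist x y < inverse (real (Suc n))" using y by auto
        ultimately show False by simp
      qed
      then show "y \<in> sphere x 0" by simp
    qed
    then have "measure \<nu> (\<Inter>n. ball x (inverse (real (Suc n)))) \<le> measure \<nu> (sphere x 0)"
      by (intro \<nu>.finite_measure_mono) auto
    then have "measure \<nu> (\<Inter>n. ball x (inverse (real (Suc n)))) = 0"
      using null_\<nu>[OF sphere_circle_borel emeasure_circle_lebesgue_sphere, of x 0] by (simp only: measure_le_0_iff)
    ultimately have "(\<lambda>n. measure \<nu> (ball x (inverse (real (Suc n))))) \<longlonglongrightarrow> 0" by simp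
    then have "eventually (\<lambda>n. measure \<nu> (ball x (inverse (real (Suc n)))) < \<tau>) sequentially"
      using assms by (rule order_tendstoD)
    then obtain n where "measure \<nu> (ball x (inverse (real (Suc n)))) < \<tau>"
      unfolding eventually_sequentially by blast
    then show ?thesis by (intro exI[of _ "inverse (real (Suc n))"]) simp
  qed
  then obtain r where r: "\<And>x. r x > 0 \<and> measure \<nu> (ball x (r x)) < \<tau>" by metis
  have "\<exists>e>0. \<forall>x\<in>UNIV. \<exists>B\<in>range (\<lambda>x. ball x (r x)). ball x e \<subseteq> B"
  proof (rule Heine_Borel_lemma[OF compact_UNIV_circle])
    show "UNIV \<subseteq> \<Union> (range (\<lambda>x. ball x (r x)))" using r by (auto intro: centre_in_ball[THEN iffD2])
  qed auto
  then obtain e where e: "e > 0" "\<And>x. \<exists>y. ball x e \<subseteq> ball y (r y)" by blast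
  have "measure \<nu> (ball x e) \<le> \<tau>" for x
  proof -
    obtain y where "ball x e \<subseteq> ball y (r y)" using e(2) by blast
    then have "measure \<nu> (ball x e) \<le> measure \<nu> (ball y (r y))" by (intro \<nu>.finite_measure_mono) auto
    then show ?thesis using r[of y] by simp
  qed
  then show ?thesis using e(1) by blast
qed

text \<open>Every point is required to hit, not almost every one: this allows compactness to extend
  the property to pseudo-orbits.\<close>

definition hits_within :: "nat \<Rightarrow> circle set \<Rightarrow> bool" where
  "hits_within n R \<longleftrightarrow> (\<forall>x. \<exists>i<n. (f ^^ i) x \<in> R)"

definition visits :: "circle set \<Rightarrow> nat \<Rightarrow> circle \<Rightarrow> nat" where
  "visits R n x = card {i. i < n \<and> (f ^^ i) x \<in> R}"

lemma visits_Suc: "visits R (Suc n) x = visits R n x + (if (f ^^ n) x \<in> R then 1 else 0)"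
proof -
  have "{i. i < Suc n \<and> (f ^^ i) x \<in> R} = (if (f ^^ n) x \<in> R then insert n {i. i < n \<and> (f ^^ i) x \<in> R} else {i. i < n \<and> (f ^^ i) x \<in> R})"
    by (auto simp: less_Suc_eq)
  then show ?thesis unfolding visits_def by auto
qed

lemma visits_0 [simp]: "visits R 0 x = 0"
  by (simp add: visits_def)

lemma visits_add: "visits R (m + n) x = visits R m x + visits R n ((f ^^ m) x)"
  by (induction n) (simp_all add: visits_Suc funpow_add[symmetric, THEN fun_cong, unfolded o_apply] add.commute)

lemma even_visits_borel:
  assumes R: "R \<in> sets borel"
  shows "{x. even (visits R n x)} \<in> sets borel"
proof (induction n)
  case (Suc n)
  have "{x. even (visits R (Suc n) x)} =
      ({x. even (visits R n x)} - (f ^^ n) -` R) \<union> ((f ^^ n) -` R - {x. even (visits R n x)})"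
    by (auto simp: visits_Suc split: if_splits)
  then show ?case using Suc vimage_funpow_borel[OF R, of n] by simp
qed simp

text \<open>Every second visit to \<open>R\<close> is enough to hit within twice the time. Whether a visit is kept is
  decided by the parity of the number of further visits before the orbit enters a tiny set \<open>A\<close>.\<close>

lemma halve_tower:
  assumes R: "open R" "hits_within n R" and d: "d > 0"
  shows "\<exists>R'. open R' \<and> closure R' \<subseteq> R \<and> hits_within (2 * n) R' \<and>
    emeasure circle_lebesgue (frontier R') = 0 \<and> measure \<nu> (closure R') \<le> measure \<nu> R / 2 + d"
proof -
  have Rb [measurable]: "R \<in> sets borel" using R(1) by simp
  obtain x0 where x0: "x0 \<in> R" using R(2) unfolding hits_within_def by blast
  obtain \<rho>1 where \<rho>1: "\<rho>1 > 0" "\<And>x. measure \<nu> (ball x \<rho>1) \<le> d / 4" using small_balls[of "d / 4"] d by auto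
  obtain \<rho>2 where \<rho>2: "\<rho>2 > 0" "ball x0 \<rho>2 \<subseteq> R" using R(1) x0 openE by blast
  define A where "A = ball x0 (min \<rho>1 \<rho>2)"
  have A: "open A" "A \<noteq> {}" "A \<subseteq> R" "measure \<nu> A \<le> d / 4"
  proof -
    show "open A" "A \<noteq> {}" "A \<subseteq> R" using \<rho>1(1) \<rho>2 unfolding A_def by auto
    have "measure \<nu> A \<le> measure \<nu> (ball x0 \<rho>1)" unfolding A_def by (intro \<nu>.finite_measure_mono) auto
    then show "measure \<nu> A \<le> d / 4" using \<rho>1(2)[of x0] by simp
  qed
  have Ab [measurable]: "A \<in> sets borel" using A(1) by simp
  define V where "V = {x. \<forall>n. (f ^^ n) x \<notin> A}"
  have Vb [measurable]: "V \<in> sets borel"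
  proof -
    have "V = (\<Inter>n. - ((f ^^ n) -` A))" by (auto simp: V_def)
    then show ?thesis using vimage_funpow_borel[OF Ab] by simp
  qed
  have V0: "measure \<nu> V = 0"
  proof (rule null_\<nu>[OF Vb])
    show "emeasure circle_lebesgue V = 0"
      using AE_hits_open[OF A(1,2)] Vb by (subst (asm) AE_iff_measurable[OF _ refl]) (auto simp: V_def)
  qed
  define E where "E s = {x \<in> R - A. \<exists>n. (f ^^ n) x \<in> A \<and> (\<forall>j<n. (f ^^ j) x \<notin> A) \<and> (even (visits R n x) \<longleftrightarrow> s)}" for s
  have Eb [measurable]: "E s \<in> sets borel" for s
  proof -
    have "E s = (\<Union>n. (R - A) \<inter> ((f ^^ n) -` A) \<inter> (\<Inter>j\<in>{..<n}. - ((f ^^ j) -` A)) \<inter>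
        (if s then {x. even (visits R n x)} else - {x. even (visits R n x)}))"
      by (cases s) (auto simp: E_def)
    moreover have "(\<Inter>j\<in>{..<n}. - ((f ^^ j) -` A)) \<in> sets borel" for n :: nat
      using vimage_funpow_borel[OF Ab] by (cases "n = 0") (auto intro!: sets.finite_INT)
    ultimately show ?thesis
      using vimage_funpow_borel[OF Ab] even_visits_borel[OF Rb] by (auto intro!: sets.countable_UN sets.Int)
  qed
  have first_unique: "m = n" if "(f ^^ n) x \<in> A" "\<forall>j<n. (f ^^ j) x \<notin> A" "(f ^^ m) x \<in> A" "\<forall>j<m. (f ^^ j) x \<notin> A" for m n x
    using that by (metis linorder_neqE_nat)
  have "E True \<inter> E False = {}"
    unfolding E_def using first_unique by blast
  then have "measure \<nu> (E True) + measure \<nu> (E False) = measure \<nu> (E True \<union> E False)"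
    by (intro \<nu>.finite_measure_Union[symmetric]) auto
  also have "\<dots> \<le> measure \<nu> R" by (intro \<nu>.finite_measure_mono) (auto simp: E_def)
  finally obtain s where s: "measure \<nu> (E s) \<le> measure \<nu> R / 2"
    using that[of True] that[of False] by linarith
  \<comment> \<open>The count ends in \<open>A\<close> and has no end for points that never enter
    \<open>A\<close>. Both kinds of visits are kept, at a cost of at most
    \<open>d / 4\<close>.\<close>
  define Q where "Q = E s \<union> A \<union> (V \<inter> R)"
  have Qb [measurable]: "Q \<in> sets borel" unfolding Q_def by measurable
  have QR: "Q \<subseteq> R" unfolding Q_def E_def using A(3) by blast
  have "measure \<nu> Q \<le> measure \<nu> (E s \<union> A) + measure \<nu> (V \<inter> R)"
    unfolding Q_def by (rule measure_Un_le) auto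
  also have "measure \<nu> (V \<inter> R) \<le> measure \<nu> V" by (intro \<nu>.finite_measure_mono) auto
  also have "measure \<nu> (E s \<union> A) \<le> measure \<nu> (E s) + measure \<nu> A"
    by (rule measure_Un_le) auto
  finally have mQ: "measure \<nu> Q \<le> measure \<nu> R / 2 + d / 4" using V0 A(4) s by simp
  \<comment> \<open>Let \<open>y\<close> be a visit to \<open>R\<close> within \<open>n\<close>
    steps and \<open>z\<close> the next one, within \<open>n\<close> further steps. If
    \<open>y\<close> enters \<open>A\<close> eventually, but not up to \<open>z\<close>, then the
    counts at \<open>y\<close> and \<open>z\<close> differ by one, so one of the two belongs to
    \<open>E s\<close>.\<close>
  have hit: "\<exists>i<2 * n. (f ^^ i) x \<in> Q" for x
  proof -
    obtain i where i: "i < n" "(f ^^ i) x \<in> R" using R(2) unfolding hits_within_def by blast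
    define y where "y = (f ^^ i) x"
    have fy: "(f ^^ j) y = (f ^^ (i + j)) x" for j
      unfolding y_def by (simp add: funpow_add[symmetric, THEN fun_cong, unfolded o_apply] add.commute)
    obtain m where m: "m < n" "(f ^^ m) (f y) \<in> R" using R(2) unfolding hits_within_def by blast
    define k where "k = (LEAST k. (f ^^ k) (f y) \<in> R)"
    have k: "(f ^^ k) (f y) \<in> R" "k \<le> m" unfolding k_def using m(2) by (rule LeastI, rule Least_le)
    have k': "(f ^^ j) (f y) \<notin> R" if "j < k" for j using that unfolding k_def by (rule not_less_Least)
    define z where "z = (f ^^ Suc k) y"
    have z: "z \<in> R" using k(1) unfolding z_def by (simp only: funpow_Suc_right o_apply)
    have Suc_k: "i + Suc k < 2 * n" using i(1) k(2) m(1) by simp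
    show ?thesis
    proof (cases "\<exists>j\<le>Suc k. (f ^^ j) y \<in> A")
      case True
      then obtain j where j: "j \<le> Suc k" "(f ^^ j) y \<in> A" by blast
      then show ?thesis using Suc_k fy by (intro exI[of _ "i + j"]) (auto simp: Q_def)
    next
      case noA: False
      show ?thesis
      proof (cases "y \<in> V")
        case True
        then have "y \<in> Q" using i(2) by (simp add: Q_def y_def)
        then show ?thesis using i(1) unfolding y_def by (intro exI[of _ i]) simp
      next
        case False
        then obtain N where "(f ^^ N) y \<in> A" unfolding V_def by blast
        define T where "T = (LEAST T. (f ^^ T) y \<in> A)"
        have T: "(f ^^ T) y \<in> A" unfolding T_def by (rule LeastI) fact
        have T': "(f ^^ j) y \<notin> A" if "j < T" for j using that unfolding T_def by (rule not_less_Least)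
        have TS: "T > Suc k" using noA T by (meson not_le)
        define T2 where "T2 = T - Suc k"
        have T2: "T = Suc k + T2" using TS by (simp add: T2_def)
        have fz: "(f ^^ j) z = (f ^^ (Suc k + j)) y" for j
          unfolding z_def by (simp add: funpow_add[symmetric, THEN fun_cong, unfolded o_apply] add.commute del: funpow.simps)
        have zA: "(f ^^ T2) z \<in> A" unfolding fz T2[symmetric] by (rule T)
        have zA': "(f ^^ j) z \<notin> A" if "j < T2" for j unfolding fz by (rule T') (use that T2 in simp)
        have "visits R (Suc k) y = 1"
        proof -
          have "{j. j < Suc k \<and> (f ^^ j) y \<in> R} = {0}"
          proof safe
            fix j assume j: "j < Suc k" "(f ^^ j) y \<in> R"
            show "j = 0"
            proof (cases j)
              case (Suc j')
              then have "(f ^^ j') (f y) \<in> R" using j(2) by (simp only: funpow_Suc_right o_apply)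
              then show ?thesis using k'[of j'] j(1) Suc by simp
            qed
          qed (use i(2) in \<open>auto simp: y_def\<close>)
          then show ?thesis by (simp add: visits_def)
        qed
        then have par: "visits R T y = Suc (visits R T2 z)"
          unfolding T2 visits_add z_def by simp
        have yA: "y \<notin> A" using noA by (metis funpow_0 le0)
        have zA0: "z \<notin> A" unfolding z_def using noA by blast
        have "y \<in> E (even (visits R T y))"
          using T T' yA i(2) unfolding E_def y_def[symmetric] by blast
        moreover have "z \<in> E (even (visits R T2 z))"
          using zA zA' zA0 z unfolding E_def by blast
        ultimately have "y \<in> E s \<or> z \<in> E s" using par by (cases s; cases "even (visits R T2 z)") auto
        then have "y \<in> Q \<or> z \<in> Q" by (auto simp: Q_def)
        then show ?thesis
        proof
          assume "y \<in> Q"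
          then show ?thesis using i(1) unfolding y_def by (intro exI[of _ i]) simp
        next
          assume "z \<in> Q"
          then show ?thesis using Suc_k fy[of "Suc k"] unfolding z_def by (intro exI[of _ "i + Suc k"]) simp
        qed
      qed
    qed
  qed
  \<comment> \<open>Outer regularity and compactness replace \<open>Q\<close> by a finite union of
    balls, which is open, has null frontier and little more measure.\<close>
  have "emeasure \<nu> Q = (INF U\<in>{U. Q \<subseteq> U \<and> open U}. emeasure \<nu> U)"
    by (rule outer_regular) (auto simp: \<nu>.emeasure_eq_measure)
  moreover have "emeasure \<nu> Q < ennreal (measure \<nu> Q + d / 4)"
    using d by (simp add: \<nu>.emeasure_eq_measure ennreal_less_iff del: ennreal_plus)
  ultimately have "(INF U\<in>{U. Q \<subseteq> U \<and> open U}. emeasure \<nu> U) < ennreal (measure \<nu> Q + d / 4)"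
    by simp
  then obtain U where U: "Q \<subseteq> U" "open U" "emeasure \<nu> U < ennreal (measure \<nu> Q + d / 4)"
    unfolding INF_less_iff by blast
  then have mU: "measure \<nu> U < measure \<nu> Q + d / 4" by (simp add: \<nu>.emeasure_eq_measure ennreal_less_iff)
  define W where "W = U \<inter> R"
  have W: "open W" unfolding W_def using U(2) R(1) by blast
  define \<C> where "\<C> = {(y, r, i). 0 < r \<and> cball y r \<subseteq> W \<and> i < 2 * n}"
  obtain \<D> where D: "\<D> \<subseteq> \<C>" "finite \<D>" "UNIV \<subseteq> (\<Union>(y, r, i)\<in>\<D>. (f ^^ i) -` ball y r)"
  proof (rule compactE_image[OF compact_UNIV_circle, of \<C> "\<lambda>(y, r, i). (f ^^ i) -` ball y r"])
    show "\<And>c. c \<in> \<C> \<Longrightarrow> open (case c of (y, r, i) \<Rightarrow> (f ^^ i) -` ball y r)"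
      using open_vimage_funpow by auto
    show "UNIV \<subseteq> (\<Union>c\<in>\<C>. case c of (y, r, i) \<Rightarrow> (f ^^ i) -` ball y r)"
    proof
      fix x
      obtain i where i: "i < 2 * n" "(f ^^ i) x \<in> Q" using hit by blast
      then have "(f ^^ i) x \<in> W" using U(1) QR by (auto simp: W_def)
      then obtain r where "r > 0" "cball ((f ^^ i) x) r \<subseteq> W" using W open_contains_cball by blast
      then show "x \<in> (\<Union>c\<in>\<C>. case c of (y, r, i) \<Rightarrow> (f ^^ i) -` ball y r)"
        using i(1) by (intro UN_I[of "((f ^^ i) x, r, i)"]) (auto simp: \<C>_def)
    qed
  qed blast
  define R' where "R' = \<Union>((\<lambda>(y, r, i). ball y r) ` \<D>)"
  show ?thesis
  proof (intro exI conjI)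
    show "open R'" unfolding R'_def by auto
    have clW: "closure R' \<subseteq> W"
    proof -
      have "closed (\<Union>((\<lambda>(y, r, i). cball y r) ` \<D>))" using D(2) by (intro closed_Union) auto
      moreover have "R' \<subseteq> \<Union>((\<lambda>(y, r, i). cball y r) ` \<D>)"
        unfolding R'_def using ball_subset_cball by fastforce
      ultimately have "closure R' \<subseteq> \<Union>((\<lambda>(y, r, i). cball y r) ` \<D>)" by (rule closure_minimal[rotated])
      also have "\<dots> \<subseteq> W" using D(1) unfolding \<C>_def by auto
      finally show ?thesis .
    qed
    then show "closure R' \<subseteq> R" by (auto simp: W_def)
    show "hits_within (2 * n) R'"
      unfolding hits_within_def
    proof
      fix x
      have "x \<in> (\<Union>(y, r, i)\<in>\<D>. (f ^^ i) -` ball y r)" using D(3) by blast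
      then obtain y r i where "(y, r, i) \<in> \<D>" "(f ^^ i) x \<in> ball y r" by auto
      moreover from this have "i < 2 * n" using D(1) by (auto simp: \<C>_def)
      ultimately show "\<exists>i<2 * n. (f ^^ i) x \<in> R'" unfolding R'_def by force
    qed
    show "emeasure circle_lebesgue (frontier R') = 0"
      unfolding R'_def using D(2) by (intro null_frontier_Union) (auto simp: frontier_ball_null)
    have "measure \<nu> (closure R') \<le> measure \<nu> U"
      using clW U(2) by (intro \<nu>.finite_measure_mono) (auto simp: W_def)
    then show "measure \<nu> (closure R') \<le> measure \<nu> R / 2 + d" using mU mQ d by linarith
  qed
qed

section \<open>Shadowing of pseudo-orbits and the choice of scales\<close>

definition shadows :: "real \<Rightarrow> nat \<Rightarrow> real \<Rightarrow> bool" where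
  "shadows e n \<eta> \<longleftrightarrow> (\<forall>x :: nat \<Rightarrow> circle. \<forall>i\<le>n.
     (\<forall>j<i. dist (x (Suc j)) (f (x j)) \<le> e) \<longrightarrow> dist (x i) ((f ^^ i) (x 0)) < \<eta>)"

lemma ex_shadows: "\<eta> > 0 \<Longrightarrow> \<exists>e>0. shadows e n \<eta>"
proof (induction n arbitrary: \<eta>)
  case 0
  then show ?case by (intro exI[of _ 1]) (auto simp: shadows_def)
next
  case (Suc n)
  have "uniformly_continuous_on UNIV f"
    by (rule compact_uniformly_continuous[OF continuous_f compact_UNIV_circle])
  then obtain d where d: "d > 0" "\<And>a b. dist a b < d \<Longrightarrow> dist (f a) (f b) < \<eta> / 2"
    using Suc.prems unfolding uniformly_continuous_on_def by (metis UNIV_I half_gt_zero)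
  obtain e where e: "e > 0" "shadows e n (min d \<eta>)"
    using Suc.IH[of "min d \<eta>"] d(1) Suc.prems by auto
  define e' where "e' = min e (\<eta> / 2)"
  have "shadows e' (Suc n) \<eta>"
    unfolding shadows_def
  proof (intro allI impI)
    fix x :: "nat \<Rightarrow> circle" and i
    assume i: "i \<le> Suc n" and po: "\<forall>j<i. dist (x (Suc j)) (f (x j)) \<le> e'"
    show "dist (x i) ((f ^^ i) (x 0)) < \<eta>"
    proof (cases "i \<le> n")
      case True
      have "\<forall>j<i. dist (x (Suc j)) (f (x j)) \<le> e" using po by (auto simp: e'_def)
      then have "dist (x i) ((f ^^ i) (x 0)) < min d \<eta>" using e(2) True unfolding shadows_def by blast
      then show ?thesis by simp
    next
      case False
      then have iS: "i = Suc n" using i by simp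
      have "\<forall>j<n. dist (x (Suc j)) (f (x j)) \<le> e" using po iS by (auto simp: e'_def)
      then have "dist (x n) ((f ^^ n) (x 0)) < min d \<eta>" using e(2) unfolding shadows_def by blast
      then have "dist (f (x n)) (f ((f ^^ n) (x 0))) < \<eta> / 2" using d(2) by simp
      moreover have "dist (x (Suc n)) (f (x n)) \<le> \<eta> / 2" using po iS by (auto simp: e'_def)
      ultimately have "dist (x (Suc n)) (f ((f ^^ n) (x 0))) < \<eta>"
        using dist_triangle[of "x (Suc n)" "f ((f ^^ n) (x 0))" "f (x n)"] by linarith
      then show ?thesis unfolding iS by simp
    qed
  qed
  moreover have "e' > 0" using e(1) Suc.prems by (simp add: e'_def)
  ultimately show ?case by blast
qed

lemma shadows_mono: "shadows e n \<eta> \<Longrightarrow> e' \<le> e \<Longrightarrow> shadows e' n \<eta>"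
  unfolding shadows_def by (meson order.trans)

lemma measure_thicken:
  assumes "\<tau> > 0"
  shows "\<exists>\<eta>>0. measure \<nu> (thicken \<eta> A) \<le> measure \<nu> (closure A) + \<tau>"
proof -
  let ?T = "\<lambda>n. thicken (inverse (real (Suc n))) A"
  have "(\<lambda>n. measure \<nu> (?T n)) \<longlonglongrightarrow> measure \<nu> (\<Inter>n. ?T n)"
  proof (rule \<nu>.finite_Lim_measure_decseq)
    show "decseq ?T"
      by (rule decseq_SucI, rule thicken_mono) (auto intro!: le_imp_inverse_le)
  qed auto
  moreover have "(\<Inter>n. ?T n) \<subseteq> closure A"
  proof
    fix x assume x: "x \<in> (\<Inter>n. ?T n)"
    show "x \<in> closure A"
      unfolding closure_approachable
    proof (intro allI impI)
      fix e :: real assume "e > 0"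
      then obtain n where n: "inverse (real (Suc n)) < e" using reals_Archimedean by blast
      have "x \<in> ?T n" using x by blast
      then obtain a where "a \<in> A" "dist x a < inverse (real (Suc n))" unfolding mem_thicken by blast
      then show "\<exists>y\<in>A. dist y x < e" using n by (intro bexI[of _ a]) (auto simp: dist_commute)
    qed
  qed
  then have "measure \<nu> (\<Inter>n. ?T n) < measure \<nu> (closure A) + \<tau>"
    using \<nu>.finite_measure_mono[of "\<Inter>n. ?T n" "closure A"] assms by simp
  ultimately have "eventually (\<lambda>n. measure \<nu> (?T n) < measure \<nu> (closure A) + \<tau>) sequentially"
    by (rule order_tendstoD)
  then obtain n where "measure \<nu> (?T n) < measure \<nu> (closure A) + \<tau>"
    unfolding eventually_sequentially by blast
  then show ?thesis by (intro exI[of _ "inverse (real (Suc n))"]) simp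
qed

text \<open>Points at distance less than \<open>r\<close> from a centre whose ball of radius
  \<open>2 * r\<close> lies in \<open>R\<close> have a margin of \<open>r\<close>; by compactness
  finitely many centres suffice and the least \<open>r\<close> works for all.\<close>

lemma hits_within_uniform:
  assumes "open R" "hits_within n R"
  shows "\<exists>\<eta>>0. \<forall>x. \<exists>i<n. ball ((f ^^ i) x) \<eta> \<subseteq> R"
proof -
  define \<C> where "\<C> = {(y, r, i). 0 < r \<and> ball y (2 * r) \<subseteq> R \<and> i < n}"
  obtain \<D> where D: "\<D> \<subseteq> \<C>" "finite \<D>" "UNIV \<subseteq> (\<Union>(y, r, i)\<in>\<D>. (f ^^ i) -` ball y r)"
  proof (rule compactE_image[OF compact_UNIV_circle, of \<C> "\<lambda>(y, r, i). (f ^^ i) -` ball y r"])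
    show "\<And>c. c \<in> \<C> \<Longrightarrow> open (case c of (y, r, i) \<Rightarrow> (f ^^ i) -` ball y r)"
      using open_vimage_funpow by auto
    show "UNIV \<subseteq> (\<Union>c\<in>\<C>. case c of (y, r, i) \<Rightarrow> (f ^^ i) -` ball y r)"
    proof
      fix x
      obtain i where i: "i < n" "(f ^^ i) x \<in> R" using assms(2) unfolding hits_within_def by blast
      then obtain r where "r > 0" "ball ((f ^^ i) x) r \<subseteq> R" using assms(1) openE by blast
      then show "x \<in> (\<Union>c\<in>\<C>. case c of (y, r, i) \<Rightarrow> (f ^^ i) -` ball y r)"
        using i(1) by (intro UN_I[of "((f ^^ i) x, r / 2, i)"]) (auto simp: \<C>_def)
    qed
  qed blast
  define \<eta> where "\<eta> = Min (insert 1 ((\<lambda>(y, r, i). r) ` \<D>))"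
  have "\<eta> > 0" unfolding \<eta>_def using D(1,2) by (subst Min_gr_iff) (auto simp: \<C>_def)
  moreover have "\<exists>i<n. ball ((f ^^ i) x) \<eta> \<subseteq> R" for x
  proof -
    have "x \<in> (\<Union>(y, r, i)\<in>\<D>. (f ^^ i) -` ball y r)" using D(3) by blast
    then obtain y r i where c: "(y, r, i) \<in> \<D>" "(f ^^ i) x \<in> ball y r" by auto
    have i: "i < n" "ball y (2 * r) \<subseteq> R" using c(1) D(1) by (auto simp: \<C>_def)
    have "\<eta> \<le> r" unfolding \<eta>_def using c(1) D(2) by (intro Min_le) force+
    have "ball ((f ^^ i) x) \<eta> \<subseteq> ball y (2 * r)"
    proof
      fix z assume z: "z \<in> ball ((f ^^ i) x) \<eta>"
      have "dist y z \<le> dist y ((f ^^ i) x) + dist ((f ^^ i) x) z" by (rule dist_triangle)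
      then show "z \<in> ball y (2 * r)" using z c(2) \<open>\<eta> \<le> r\<close> by simp
    qed
    then show ?thesis using i by blast
  qed
  ultimately show ?thesis by blast
qed

lemma ex_tower:
  "\<exists>R :: nat \<Rightarrow> circle set. R 0 = UNIV \<and> (\<forall>k. open (R k) \<and> closure (R (Suc k)) \<subseteq> R k \<and> hits_within (2 ^ k) (R k) \<and>
     emeasure circle_lebesgue (frontier (R k)) = 0 \<and> 2 ^ k * measure \<nu> (closure (R k)) \<le> measure \<nu> UNIV + 4)"
proof -
  \<comment> \<open>The term \<open>4 / 2 ^ k\<close> pays for the errors \<open>1 / 4 ^ k\<close>
    of the halvings: scaled by \<open>2 ^ Suc k\<close> such an error is \<open>2 / 2 ^ k\<close>,
    the difference between \<open>4 / 2 ^ k\<close> and \<open>4 / 2 ^ Suc k\<close>.\<close>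
  let ?P = "\<lambda>k A. (k = 0 \<longrightarrow> A = UNIV) \<and> open A \<and> hits_within (2 ^ k) A \<and> emeasure circle_lebesgue (frontier A) = 0 \<and>
     2 ^ k * measure \<nu> (closure A) \<le> measure \<nu> UNIV + 4 - 4 / 2 ^ k"
  have "\<exists>R. \<forall>k. ?P k (R k) \<and> closure (R (Suc k)) \<subseteq> R k"
  proof (rule dependent_nat_choice)
    show "\<exists>A. ?P 0 A" by (intro exI[of _ UNIV]) (simp add: hits_within_def)
    fix A k assume A: "?P k A"
    have d: "(1 / 4 ^ k :: real) > 0" by simp
    obtain B where B: "open B" "closure B \<subseteq> A" "hits_within (2 * 2 ^ k) B" "emeasure circle_lebesgue (frontier B) = 0"
      "measure \<nu> (closure B) \<le> measure \<nu> A / 2 + 1 / 4 ^ k"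
      using halve_tower[of A "2 ^ k", OF _ _ d] A by blast
    have "measure \<nu> A \<le> measure \<nu> (closure A)" by (intro \<nu>.finite_measure_mono closure_subset) simp
    then have "measure \<nu> (closure B) \<le> measure \<nu> (closure A) / 2 + 1 / 4 ^ k" using B(5) by simp
    then have "2 ^ Suc k * measure \<nu> (closure B) \<le> 2 ^ Suc k * (measure \<nu> (closure A) / 2 + 1 / 4 ^ k)"
      by (intro mult_left_mono) auto
    also have "\<dots> = 2 ^ k * measure \<nu> (closure A) + 2 * (2 ^ k / 4 ^ k)"
      by (simp add: field_simps)
    also have "(2 ^ k / 4 ^ k :: real) = 1 / 2 ^ k"
    proof -
      have "(4 :: real) ^ k = 2 ^ k * 2 ^ k" by (simp flip: power_mult_distrib)
      then show ?thesis by simp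
    qed
    also have "2 ^ k * measure \<nu> (closure A) + 2 * (1 / 2 ^ k) \<le> measure \<nu> UNIV + 4 - 4 / 2 ^ k + 2 * (1 / 2 ^ k)"
      using A by simp
    also have "\<dots> = measure \<nu> UNIV + 4 - 4 / 2 ^ Suc k" by simp
    finally show "\<exists>B. ?P (Suc k) B \<and> closure B \<subseteq> A"
      using B(1-4) by (intro exI[of _ B]) simp
  qed
  then obtain R where R: "\<And>k. ?P k (R k)" "\<And>k. closure (R (Suc k)) \<subseteq> R k" by blast
  have "2 ^ k * measure \<nu> (closure (R k)) \<le> measure \<nu> UNIV + 4" for k
  proof -
    have "2 ^ k * measure \<nu> (closure (R k)) \<le> measure \<nu> UNIV + 4 - 4 / 2 ^ k" using R(1)[of k] by blast
    moreover have "(4 / 2 ^ k :: real) \<ge> 0" by simp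
    ultimately show ?thesis by linarith
  qed
  then show ?thesis using R by (intro exI[of _ R]) blast
qed

text \<open>The parameters are chosen in this order: \<open>\<eta>\<close> bounds the thickening of
  \<open>R\<close>, \<open>e\<close> makes \<open>e\<close>-pseudo-orbits stay
  \<open>\<eta>\<close>-close to orbits and meet \<open>R'\<close>, \<open>\<delta>\<close> makes
  balls small relative to \<open>e\<close>, and \<open>e'\<close> gives shadowing up to
  \<open>\<delta>\<close>. That \<open>\<delta>\<close> depends on \<open>e\<close> matters because
  noise of amplitude about \<open>e\<close> on a ball produces a density of order
  \<open>1 / e\<close>.\<close>

definition stage :: "circle set \<Rightarrow> circle set \<Rightarrow> nat \<Rightarrow> real \<Rightarrow> real \<Rightarrow> real \<Rightarrow> real \<Rightarrow> real \<Rightarrow> nat \<Rightarrow> (nat \<Rightarrow> circle) \<Rightarrow> bool" where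
  "stage R R' n \<tau> \<eta> e \<delta> e' N c \<longleftrightarrow> 0 < \<eta> \<and> \<eta> \<le> \<tau> \<and> measure \<nu> (thicken \<eta> R) \<le> measure \<nu> (closure R) + \<tau> \<and>
    0 < e \<and> e \<le> 1 / 2 \<and> shadows e n \<eta> \<and>
    (\<forall>x :: nat \<Rightarrow> circle. (\<forall>j<n. dist (x (Suc j)) (f (x j)) \<le> e) \<longrightarrow> (\<exists>j<n. x j \<in> R')) \<and>
    0 < \<delta> \<and> (\<forall>x. n * measure \<nu> (ball x (3 * \<delta>)) \<le> e / 2) \<and> 0 < e' \<and> e' \<le> e \<and> shadows e' n \<delta> \<and>
    0 < N \<and> (\<Union>j<N. cball (c j) \<delta>) = UNIV"

lemma ex_stage:
  assumes R': "open R'" "hits_within n R'" and \<tau>: "\<tau> > 0" and n: "n > 0"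
  shows "\<exists>\<eta> e \<delta> e' N c. stage R R' n \<tau> \<eta> e \<delta> e' N c"
proof -
  obtain \<eta>1 where \<eta>1: "\<eta>1 > 0" "measure \<nu> (thicken \<eta>1 R) \<le> measure \<nu> (closure R) + \<tau>"
    using measure_thicken[OF \<tau>] by blast
  obtain \<eta>2 where \<eta>2: "\<eta>2 > 0" "\<forall>x. \<exists>i<n. ball ((f ^^ i) x) \<eta>2 \<subseteq> R'"
    using hits_within_uniform[OF R'] by blast
  define \<eta> where "\<eta> = min \<tau> (min \<eta>1 \<eta>2)"
  have \<eta>: "\<eta> > 0" "\<eta> \<le> \<tau>" "\<eta> \<le> \<eta>1" "\<eta> \<le> \<eta>2" using \<tau> \<eta>1(1) \<eta>2(1) by (auto simp: \<eta>_def)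
  obtain e0 where e0: "e0 > 0" "shadows e0 n \<eta>" using ex_shadows[OF \<eta>(1)] by blast
  define e where "e = min e0 (1 / 2)"
  have e: "0 < e" "e \<le> 1 / 2" "shadows e n \<eta>" using e0 shadows_mono[of e0 n \<eta> e] by (auto simp: e_def)
  have hit: "\<forall>x :: nat \<Rightarrow> circle. (\<forall>j<n. dist (x (Suc j)) (f (x j)) \<le> e) \<longrightarrow> (\<exists>j<n. x j \<in> R')"
  proof (intro allI impI)
    fix x :: "nat \<Rightarrow> circle" assume x: "\<forall>j<n. dist (x (Suc j)) (f (x j)) \<le> e"
    obtain i where i: "i < n" "ball ((f ^^ i) (x 0)) \<eta>2 \<subseteq> R'" using \<eta>2(2) by blast
    have "\<forall>j<i. dist (x (Suc j)) (f (x j)) \<le> e" using x i(1) by simp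
    then have "dist (x i) ((f ^^ i) (x 0)) < \<eta>" using e(3) i(1) unfolding shadows_def by simp
    then have "x i \<in> ball ((f ^^ i) (x 0)) \<eta>2" using \<eta>(4) by (simp add: dist_commute)
    then show "\<exists>j<n. x j \<in> R'" using i by blast
  qed
  obtain \<rho> where \<rho>: "\<rho> > 0" "\<forall>x. measure \<nu> (ball x \<rho>) \<le> e / (2 * real n)"
    using small_balls[of "e / (2 * real n)"] e(1) n by auto
  define \<delta> where "\<delta> = \<rho> / 3"
  have \<delta>: "\<delta> > 0" "\<forall>x. n * measure \<nu> (ball x (3 * \<delta>)) \<le> e / 2"
    using \<rho> n by (auto simp: \<delta>_def field_simps)
  obtain e1 where e1: "e1 > 0" "shadows e1 n \<delta>" using ex_shadows[OF \<delta>(1)] by blast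
  define e' where "e' = min e1 e"
  have e': "0 < e'" "e' \<le> e" "shadows e' n \<delta>" using e1 e(1) shadows_mono[of e1 n \<delta> e'] by (auto simp: e'_def)
  obtain C where C: "finite C" "UNIV \<subseteq> (\<Union>y\<in>C. cball (y :: circle) \<delta>)"
  proof -
    obtain C where C: "C \<subseteq> UNIV" "finite C" "UNIV \<subseteq> (\<Union>y\<in>C. ball (y :: circle) \<delta>)"
      by (rule compactE_image[OF compact_UNIV_circle, of UNIV "\<lambda>y. ball y \<delta>"]) (use \<delta>(1) in auto)
    have "x \<in> (\<Union>y\<in>C. cball y \<delta>)" for x
    proof -
      obtain y where "y \<in> C" "x \<in> ball y \<delta>" using C(3) by blast
      then show ?thesis by (intro UN_I[of y]) auto
    qed
    then show ?thesis using that[OF C(2)] by blast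
  qed
  obtain c :: "nat \<Rightarrow> circle" and N where cN: "C = c ` {i. i < N}" using finite_imp_nat_seg_image_inj_on[OF C(1)] by blast
  have cov: "(\<Union>j<N. cball (c j) \<delta>) = UNIV" using C(2) unfolding cN by auto
  have N: "N > 0" using cov by (cases N) auto
  have thick: "measure \<nu> (thicken \<eta> R) \<le> measure \<nu> (closure R) + \<tau>"
  proof -
    have "measure \<nu> (thicken \<eta> R) \<le> measure \<nu> (thicken \<eta>1 R)"
      using \<eta>(3) by (intro \<nu>.finite_measure_mono thicken_mono) auto
    then show ?thesis using \<eta>1(2) by linarith
  qed
  show ?thesis
    unfolding stage_def
  proof (intro exI conjI)
    show "0 < \<eta>" "\<eta> \<le> \<tau>" by fact+
    show "measure \<nu> (thicken \<eta> R) \<le> measure \<nu> (closure R) + \<tau>" by (rule thick)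
    show "0 < e" "e \<le> 1 / 2" "shadows e n \<eta>" by fact+
    show "\<forall>x :: nat \<Rightarrow> circle. (\<forall>j<n. dist (x (Suc j)) (f (x j)) \<le> e) \<longrightarrow> (\<exists>j<n. x j \<in> R')" by (rule hit)
    show "0 < \<delta>" "\<forall>x. n * measure \<nu> (ball x (3 * \<delta>)) \<le> e / 2" by fact+
    show "0 < e'" "e' \<le> e" "shadows e' n \<delta>" by fact+
    show "0 < N" by (rule N)
    show "(\<Union>j<N. cball (c j) \<delta>) = UNIV" by (rule cov)
  qed
qed

text \<open>Between two stages of the tower the set is shrunk along the small balls \<open>cball (c j) \<delta>\<close>, one
  ball per step, so that a neighbourhood of \<open>R l - R (Suc l)\<close> has small measure.\<close>

lemma refined_tower:
  obtains R :: "nat \<Rightarrow> circle set" and n :: "nat \<Rightarrow> nat" and e e' \<eta> \<delta> :: "nat \<Rightarrow> real"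
  where "R 0 = UNIV" "\<And>l. open (R l)" "\<And>l. R (Suc l) \<subseteq> R l" "\<And>l. emeasure circle_lebesgue (frontier (R l)) = 0"
    "\<And>l. n l * measure \<nu> (closure (R l)) \<le> 2 * measure \<nu> UNIV + 10"
    "\<And>l. n l * measure \<nu> (thicken (\<eta> l) (R l)) \<le> 2 * measure \<nu> UNIV + 10"
    "\<And>l. 0 < e l" "\<And>l. e l \<le> 1 / 2" "\<And>l. shadows (e l) (n l) (\<eta> l)"
    "\<And>l (x :: nat \<Rightarrow> circle). (\<forall>j<n l. dist (x (Suc j)) (f (x j)) \<le> e l) \<Longrightarrow> \<exists>j<n l. x j \<in> R (Suc l)"
    "\<And>l. n l * measure \<nu> (thicken (\<delta> l) (R l - R (Suc l))) \<le> e l / 2"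
    "\<And>l. 0 < e' l" "\<And>l. e' l \<le> e l" "\<And>l. shadows (e' l) (n l) (\<delta> l)"
    "\<eta> \<longlonglongrightarrow> 0" "filterlim n at_top sequentially"
proof -
  obtain T :: "nat \<Rightarrow> circle set" where T: "T 0 = UNIV" "\<And>k. open (T k)" "\<And>k. closure (T (Suc k)) \<subseteq> T k"
    "\<And>k. hits_within (2 ^ k) (T k)" "\<And>k. emeasure circle_lebesgue (frontier (T k)) = 0"
    "\<And>k. 2 ^ k * measure \<nu> (closure (T k)) \<le> measure \<nu> UNIV + 4"
    using ex_tower by blast
  have "\<exists>\<eta> e \<delta> e' N c. stage (T k) (T (Suc k)) (2 ^ Suc k) (1 / 2 ^ k) \<eta> e \<delta> e' N c" for k
    by (rule ex_stage[OF T(2) T(4)]) simp_all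
  then obtain \<eta>0 e0 \<delta>0 e0' N c where st: "\<And>k. stage (T k) (T (Suc k)) (2 ^ Suc k) (1 / 2 ^ k) (\<eta>0 k) (e0 k) (\<delta>0 k) (e0' k) (N k) (c k)"
    by metis
  have TS: "T (Suc k) \<subseteq> T k" for k using T(3)[of k] closure_subset by blast
  \<comment> \<open>Successor in the lexicographic enumeration of the pairs of a stage
    \<open>k\<close> and a ball index below \<open>N k\<close>.\<close>
  define nxt where "nxt p = (if Suc (snd p) < N (fst p) then (fst p, Suc (snd p)) else (Suc (fst p), 0))" for p :: "nat \<times> nat"
  define s where "s l = (nxt ^^ l) (0, 0)" for l :: nat
  define \<kappa> where "\<kappa> l = fst (s l)" for l
  define \<iota> where "\<iota> l = snd (s l)" for l
  have Npos: "0 < N k" for k using st[of k] by (simp add: stage_def)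
  have s0: "s 0 = (0, 0)" by (simp add: s_def)
  have sS: "s (Suc l) = nxt (s l)" for l by (simp add: s_def)
  have \<iota>_less: "\<iota> l < N (\<kappa> l)" for l
    by (cases l) (auto simp: \<iota>_def \<kappa>_def s0 sS nxt_def Npos)
  have step: "(Suc (\<iota> l) < N (\<kappa> l) \<and> \<kappa> (Suc l) = \<kappa> l \<and> \<iota> (Suc l) = Suc (\<iota> l)) \<or>
      (Suc (\<iota> l) = N (\<kappa> l) \<and> \<kappa> (Suc l) = Suc (\<kappa> l) \<and> \<iota> (Suc l) = 0)" for l
    using \<iota>_less[of l] by (auto simp: \<iota>_def \<kappa>_def sS nxt_def)
  \<comment> \<open>The first \<open>i\<close> balls are removed from \<open>T k\<close>, but
    \<open>T (Suc k)\<close> is retained. The stages fit together because \<open>A k 0 = T k\<close>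
    and \<open>A k (N k) = T (Suc k)\<close>.\<close>
  define A where "A k i = T (Suc k) \<union> (T k - (\<Union>j<i. cball (c k j) (\<delta>0 k)))" for k i
  define R where "R l = A (\<kappa> l) (\<iota> l)" for l
  have A0: "A k 0 = T k" for k unfolding A_def using TS by auto
  have AS: "A k (Suc i) \<subseteq> A k i" for k i unfolding A_def by auto
  have AN: "A k (N k) = T (Suc k)" for k
  proof -
    have "(\<Union>j<N k. cball (c k j) (\<delta>0 k)) = UNIV" using st[of k] by (simp add: stage_def)
    then show ?thesis unfolding A_def by simp
  qed
  have R_Suc: "R (Suc l) = A (\<kappa> l) (Suc (\<iota> l))" for l
    using step[of l] unfolding R_def by (auto simp: A0 AN)
  have R_le: "R l \<subseteq> T (\<kappa> l)" "T (Suc (\<kappa> l)) \<subseteq> R (Suc l)" for l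
    unfolding R_Suc unfolding R_def A_def using TS by auto
  have R_diff: "R l - R (Suc l) \<subseteq> cball (c (\<kappa> l) (\<iota> l)) (\<delta>0 (\<kappa> l))" for l
    unfolding R_Suc unfolding R_def A_def by (auto simp: lessThan_Suc)
  have A_open: "open (A k i)" for k i
    unfolding A_def using T(2) by (intro open_Un open_Diff closed_UN) auto
  have A_front: "emeasure circle_lebesgue (frontier (A k i)) = 0" for k i
    unfolding A_def using T(5)
    by (intro null_frontier_Un null_frontier_Diff null_frontier_Union) (auto simp: frontier_cball_null)
  have \<kappa>_mono: "\<kappa> l \<le> \<kappa> (Suc l)" for l using step[of l] by auto
  then have \<kappa>_mono': "mono \<kappa>" by (rule mono_iff_le_Suc[THEN iffD2, rule_format])
  have \<kappa>_unbounded: "\<exists>l. \<kappa> l = k \<and> \<iota> l = 0" for k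
  proof (induction k)
    case 0
    show ?case by (intro exI[of _ 0]) (simp add: \<kappa>_def \<iota>_def s0)
  next
    case (Suc k)
    then obtain l where l: "\<kappa> l = k" "\<iota> l = 0" by blast
    have adv: "\<kappa> (l + m) = k \<and> \<iota> (l + m) = m" if "m < N k" for m
      using that
    proof (induction m)
      case (Suc m)
      then show ?case using step[of "l + m"] by auto
    qed (simp add: l)
    obtain m where m: "N k = Suc m" using Npos[of k] by (cases "N k") auto
    then have "\<kappa> (l + m) = k \<and> \<iota> (l + m) = m" using adv by simp
    then have "\<kappa> (Suc (l + m)) = Suc k \<and> \<iota> (Suc (l + m)) = 0" using step[of "l + m"] m by auto
    then show ?case by blast
  qed
  have \<kappa>_lim: "filterlim \<kappa> at_top sequentially"
    unfolding filterlim_at_top eventually_sequentially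
  proof
    fix k
    obtain l where "\<kappa> l = k" using \<kappa>_unbounded by blast
    then show "\<exists>N. \<forall>n\<ge>N. k \<le> \<kappa> n" using \<kappa>_mono' by (metis monoD)
  qed
  \<comment> \<open>\<open>R (Suc l)\<close> contains \<open>T (Suc (\<kappa> l))\<close>, which
    every orbit hits within this many steps.\<close>
  define n where "n l = (2 :: nat) ^ Suc (\<kappa> l)" for l
  have n_lim: "filterlim n at_top sequentially"
  proof (rule filterlim_at_top_mono[OF \<kappa>_lim])
    have "\<kappa> l \<le> n l" for l
    proof -
      have "Suc (\<kappa> l) < 2 ^ Suc (\<kappa> l)" by (rule less_exp)
      then show ?thesis unfolding n_def by linarith
    qed
    then show "\<forall>\<^sub>F l in sequentially. \<kappa> l \<le> n l" by simp
  qed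
  have n_real: "real (n l) = 2 * 2 ^ \<kappa> l" for l by (simp add: n_def)
  show ?thesis
  proof (rule that[of R n "\<lambda>l. \<eta>0 (\<kappa> l)" "\<lambda>l. e0 (\<kappa> l)" "\<lambda>l. \<delta>0 (\<kappa> l)" "\<lambda>l. e0' (\<kappa> l)"])
    show "R 0 = UNIV" unfolding R_def \<kappa>_def \<iota>_def s0 by (simp add: A0 T(1))
    show "open (R l)" for l unfolding R_def by (rule A_open)
    show "R (Suc l) \<subseteq> R l" for l unfolding R_Suc unfolding R_def by (rule AS)
    show "emeasure circle_lebesgue (frontier (R l)) = 0" for l unfolding R_def by (rule A_front)
    show "n l * measure \<nu> (closure (R l)) \<le> 2 * measure \<nu> UNIV + 10" for l
    proof -
      have "measure \<nu> (closure (R l)) \<le> measure \<nu> (closure (T (\<kappa> l)))"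
        by (intro \<nu>.finite_measure_mono closure_mono R_le) simp
      then have "n l * measure \<nu> (closure (R l)) \<le> 2 * (2 ^ \<kappa> l * measure \<nu> (closure (T (\<kappa> l))))"
        unfolding n_real by simp
      then show ?thesis using T(6)[of "\<kappa> l"] by simp
    qed
    show "n l * measure \<nu> (thicken (\<eta>0 (\<kappa> l)) (R l)) \<le> 2 * measure \<nu> UNIV + 10" for l
    proof -
      have "measure \<nu> (thicken (\<eta>0 (\<kappa> l)) (R l)) \<le> measure \<nu> (thicken (\<eta>0 (\<kappa> l)) (T (\<kappa> l)))"
        by (intro \<nu>.finite_measure_mono thicken_mono R_le) auto
      also have "\<dots> \<le> measure \<nu> (closure (T (\<kappa> l))) + 1 / 2 ^ \<kappa> l" using st[of "\<kappa> l"] by (simp add: stage_def)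
      finally have "2 ^ \<kappa> l * measure \<nu> (thicken (\<eta>0 (\<kappa> l)) (R l)) \<le> 2 ^ \<kappa> l * (measure \<nu> (closure (T (\<kappa> l))) + 1 / 2 ^ \<kappa> l)"
        by (rule mult_left_mono) simp
      also have "\<dots> = 2 ^ \<kappa> l * measure \<nu> (closure (T (\<kappa> l))) + 1" by (simp add: field_simps)
      also have "\<dots> \<le> measure \<nu> UNIV + 5" using T(6)[of "\<kappa> l"] by simp
      finally show ?thesis unfolding n_real by simp
    qed
    show "n l * measure \<nu> (thicken (\<delta>0 (\<kappa> l)) (R l - R (Suc l))) \<le> e0 (\<kappa> l) / 2" for l
    proof -
      have "thicken (\<delta>0 (\<kappa> l)) (R l - R (Suc l)) \<subseteq> ball (c (\<kappa> l) (\<iota> l)) (3 * \<delta>0 (\<kappa> l))"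
      proof
        fix x assume "x \<in> thicken (\<delta>0 (\<kappa> l)) (R l - R (Suc l))"
        then obtain a where a: "a \<in> R l - R (Suc l)" "dist x a < \<delta>0 (\<kappa> l)" unfolding mem_thicken by blast
        have "dist (c (\<kappa> l) (\<iota> l)) a \<le> \<delta>0 (\<kappa> l)" using subsetD[OF R_diff a(1)] by simp
        then show "x \<in> ball (c (\<kappa> l) (\<iota> l)) (3 * \<delta>0 (\<kappa> l))"
          using a(2) dist_triangle[of "c (\<kappa> l) (\<iota> l)" x a] st[of "\<kappa> l"]
          by (simp add: dist_commute stage_def)
      qed
      then have "measure \<nu> (thicken (\<delta>0 (\<kappa> l)) (R l - R (Suc l))) \<le> measure \<nu> (ball (c (\<kappa> l) (\<iota> l)) (3 * \<delta>0 (\<kappa> l)))"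
        by (intro \<nu>.finite_measure_mono) auto
      then have "n l * measure \<nu> (thicken (\<delta>0 (\<kappa> l)) (R l - R (Suc l))) \<le> n l * measure \<nu> (ball (c (\<kappa> l) (\<iota> l)) (3 * \<delta>0 (\<kappa> l)))"
        by (rule mult_left_mono) simp
      also have "\<dots> \<le> e0 (\<kappa> l) / 2" using st[of "\<kappa> l"] unfolding stage_def n_def by blast
      finally show ?thesis .
    qed
    show "\<exists>j<n l. x j \<in> R (Suc l)" if "\<forall>j<n l. dist (x (Suc j)) (f (x j)) \<le> e0 (\<kappa> l)" for l and x :: "nat \<Rightarrow> circle"
    proof -
      have "\<exists>j<n l. x j \<in> T (Suc (\<kappa> l))" using st[of "\<kappa> l"] that unfolding stage_def n_def by blast
      then show ?thesis using R_le(2) by blast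
    qed
    show "0 < e0 (\<kappa> l)" "e0 (\<kappa> l) \<le> 1 / 2" "0 < e0' (\<kappa> l)" "e0' (\<kappa> l) \<le> e0 (\<kappa> l)" for l
      using st[of "\<kappa> l"] by (simp_all add: stage_def)
    show "shadows (e0 (\<kappa> l)) (n l) (\<eta>0 (\<kappa> l))" "shadows (e0' (\<kappa> l)) (n l) (\<delta>0 (\<kappa> l))" for l
      using st[of "\<kappa> l"] unfolding stage_def n_def by blast+
    have "(\<lambda>k. 1 / 2 ^ k :: real) \<longlonglongrightarrow> 0"
      using LIMSEQ_power_zero[of "1 / 2 :: real"] by (simp add: power_one_over)
    moreover have "0 \<le> \<eta>0 k \<and> \<eta>0 k \<le> 1 / 2 ^ k" for k using st[of k] by (simp add: stage_def less_imp_le)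
    ultimately have "\<eta>0 \<longlonglongrightarrow> 0"
      by (intro tendsto_sandwich[of "\<lambda>_. 0" \<eta>0 sequentially "\<lambda>k. 1 / 2 ^ k" 0]) auto
    then show "(\<lambda>l. \<eta>0 (\<kappa> l)) \<longlonglongrightarrow> 0" by (rule filterlim_compose[OF _ \<kappa>_lim])
    show "filterlim n at_top sequentially" by (rule n_lim)
  qed
qed

end

section \<open>The perturbed Markov chain\<close>

lemma dist_circle_add_le: "dist (a + b) (c + d) \<le> dist a c + dist b (d :: circle)"
proof -
  have "a + b - (c + d) = to_circle (circle_rep (a - c) + circle_rep (b - d))"
    by (simp add: to_circle_add to_circle_rep)
  then have "dist (a + b) (c + d) \<le> \<bar>circle_rep (a - c) + circle_rep (b - d)\<bar>"
    unfolding dist_circle_def by (simp add: abs_circle_rep_le)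
  then show ?thesis unfolding dist_circle_def by linarith
qed

lemma continuous_circle_add: "continuous_on UNIV (\<lambda>p :: circle \<times> circle. fst p + snd p)"
  unfolding continuous_on_iff
proof (intro ballI allI impI)
  fix p :: "circle \<times> circle" and e :: real assume "e > 0"
  have "dist (fst q + snd q) (fst p + snd p) < e" if "dist q p < e / 2" for q
  proof -
    have "dist (fst q + snd q) (fst p + snd p) \<le> dist (fst q) (fst p) + dist (snd q) (snd p)"
      by (rule dist_circle_add_le)
    also have "\<dots> \<le> dist q p + dist q p" by (intro add_mono dist_fst_le dist_snd_le)
    finally show ?thesis using that by simp
  qed
  then show "\<exists>d>0. \<forall>q\<in>UNIV. dist q p < d \<longrightarrow> dist (fst q + snd q) (fst p + snd p) < e"
    using \<open>e > 0\<close> by (intro exI[of _ "e / 2"]) auto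
qed

lemma borel_measurable_circle_add [measurable (raw)]:
  fixes g h :: "'a \<Rightarrow> circle"
  assumes "g \<in> borel_measurable M" "h \<in> borel_measurable M"
  shows "(\<lambda>x. g x + h x) \<in> borel_measurable M"
  by (rule borel_measurable_continuous_Pair[OF assms continuous_circle_add])

lemma sets_noise [simp, measurable_cong]: "sets (noise \<epsilon>) = sets borel"
  by (simp add: noise_def)

lemma space_noise [simp]: "space (noise \<epsilon>) = UNIV"
  by (simp add: noise_def)

lemma prob_space_noise: "\<epsilon> > 0 \<Longrightarrow> prob_space (noise \<epsilon>)"
  unfolding noise_def by (rule prob_space_uniform_measure) (simp_all add: ball_eq_greaterThanLessThan)

lemma AE_noise: "AE t in noise \<epsilon>. \<bar>t\<bar> < \<epsilon>"
  unfolding noise_def by (rule AE_uniform_measureI) (auto simp: dist_real_def)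

lemma emeasure_lborel_affine:
  fixes s z :: real
  assumes z: "z > 0" and X: "X \<in> sets borel"
  shows "ennreal z * emeasure lborel ((\<lambda>t. s + z * t) -` X) = emeasure lborel X"
proof -
  have "emeasure lborel X = emeasure (density (distr lborel borel (\<lambda>t. s + z * t)) (\<lambda>_. ennreal \<bar>z\<bar>)) X"
    using lborel_real_affine[of z s] z by simp
  also have "\<dots> = (\<integral>\<^sup>+x. ennreal \<bar>z\<bar> * indicator X x \<partial>distr lborel borel (\<lambda>t. s + z * t))"
    using X by (intro emeasure_density) auto
  also have "\<dots> = ennreal \<bar>z\<bar> * emeasure (distr lborel borel (\<lambda>t. s + z * t)) X"
    using X by (intro nn_integral_cmult_indicator) auto
  also have "emeasure (distr lborel borel (\<lambda>t. s + z * t)) X = emeasure lborel ((\<lambda>t. s + z * t) -` X)"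
    using X by (subst emeasure_distr) auto
  finally show ?thesis using z by simp
qed

text \<open>The Markov operator of the perturbed chain, on nonnegative extended functions so that
  integrability is never an issue.\<close>

definition kernel_integral :: "(circle \<Rightarrow> circle) \<Rightarrow> (circle \<Rightarrow> real) \<Rightarrow> real \<Rightarrow> (circle \<Rightarrow> ennreal) \<Rightarrow> circle \<Rightarrow> ennreal" where
  "kernel_integral f \<zeta> \<epsilon> g x = (\<integral>\<^sup>+t. g (perturbed_map f \<zeta> t x) \<partial>noise \<epsilon>)"

text \<open>One step from \<open>x\<close> is uniformly distributed on an interval of length
  \<open>2 * r\<close> with \<open>r = \<epsilon> * \<zeta> x\<close>, wrapped around the circle.
  The wrapped density is at most \<open>(2 * r + 1) / (2 * r)\<close>.\<close>

lemma kernel_integral_indicator_le: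
  assumes A: "A \<in> sets borel" and \<epsilon>: "\<epsilon> > 0" and \<zeta>: "\<zeta> x > 0"
  shows "kernel_integral f \<zeta> \<epsilon> (indicator A) x \<le> ennreal (1 + 1 / (2 * (\<epsilon> * \<zeta> x))) * emeasure circle_lebesgue A"
proof -
  define r where "r = \<epsilon> * \<zeta> x"
  have r: "r > 0" using \<epsilon> \<zeta> by (simp add: r_def)
  obtain s where s: "f x = to_circle s" using surj_to_circle by blast
  define P where "P = to_circle -` A"
  have P [measurable]: "P \<in> sets borel" unfolding P_def by (rule vimage_to_circle_borel[OF A])
  let ?T = "\<lambda>t. s + \<zeta> x * t"
  have pm: "perturbed_map f \<zeta> t x = to_circle (?T t)" for t
    unfolding perturbed_map_def s to_circle_add[symmetric] by (simp add: mult.commute)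
  have TP: "?T -` P \<in> sets borel"
    using measurable_sets_borel[OF _ P, of ?T] by simp
  have ball_m: "emeasure lborel (ball (0 :: real) \<epsilon>) = ennreal (2 * \<epsilon>)"
    using \<epsilon> by (simp add: ball_eq_greaterThanLessThan)
  have "kernel_integral f \<zeta> \<epsilon> (indicator A) x = (\<integral>\<^sup>+t. indicator (?T -` P) t \<partial>noise \<epsilon>)"
    unfolding kernel_integral_def pm by (rule nn_integral_cong) (simp add: indicator_def P_def)
  also have "\<dots> = emeasure (noise \<epsilon>) (?T -` P)" using TP by simp
  also have "\<dots> = emeasure lborel (ball 0 \<epsilon> \<inter> ?T -` P) / ennreal (2 * \<epsilon>)"
    unfolding noise_def using TP ball_m by (simp add: emeasure_uniform_measure)
  also have "ball 0 \<epsilon> \<inter> ?T -` P \<subseteq> ?T -` ({s - r..<s + r} \<inter> P)"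
  proof
    fix t assume t: "t \<in> ball 0 \<epsilon> \<inter> ?T -` P"
    then have "\<zeta> x * \<bar>t\<bar> < \<zeta> x * \<epsilon>" using \<zeta> by (simp add: dist_real_def)
    then have "\<bar>\<zeta> x * t\<bar> < r" using \<zeta> by (simp add: r_def abs_mult mult.commute)
    then show "t \<in> ?T -` ({s - r..<s + r} \<inter> P)" using t by auto
  qed
  then have "emeasure lborel (ball 0 \<epsilon> \<inter> ?T -` P) / ennreal (2 * \<epsilon>)
      \<le> emeasure lborel (?T -` ({s - r..<s + r} \<inter> P)) / ennreal (2 * \<epsilon>)"
    using TP by (intro divide_right_mono_ennreal emeasure_mono) (auto intro!: measurable_sets_borel)
  also have "emeasure lborel (?T -` ({s - r..<s + r} \<inter> P)) = emeasure lborel ({s - r..<s + r} \<inter> P) / ennreal (\<zeta> x)"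
  proof -
    let ?a = "emeasure lborel (?T -` ({s - r..<s + r} \<inter> P))"
    have "{s - r..<s + r} \<inter> P \<in> sets borel" by simp
    from emeasure_lborel_affine[OF \<zeta> this]
    have "?a * ennreal (\<zeta> x) = emeasure lborel ({s - r..<s + r} \<inter> P)"
      by (subst mult.commute)
    moreover have "?a * ennreal (\<zeta> x) / ennreal (\<zeta> x) = ?a"
      using \<zeta> by (intro ennreal_mult_divide_eq) auto
    ultimately show ?thesis by simp
  qed
  also have "\<dots> / ennreal (2 * \<epsilon>) \<le> (ennreal (2 * r + 1) * emeasure circle_lebesgue A) / ennreal (\<zeta> x) / ennreal (2 * \<epsilon>)"
    using emeasure_lborel_Ico_le[OF A, of "s - r" "s + r"] r
    by (intro divide_right_mono_ennreal) (simp add: P_def)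
  also have "\<dots> = ennreal (1 + 1 / (2 * r)) * emeasure circle_lebesgue A"
  proof -
    have "emeasure circle_lebesgue A = ennreal (measure circle_lebesgue A)"
      by (rule circle_lebesgue.emeasure_eq_measure)
    moreover have "(2 * r + 1) * m / \<zeta> x / (2 * \<epsilon>) = (1 + 1 / (2 * r)) * m" for m
      using \<epsilon> \<zeta> by (simp add: r_def field_simps)
    ultimately show ?thesis
      using r \<epsilon> \<zeta> by (simp add: divide_ennreal ennreal_mult''[symmetric] del: ennreal_plus)
  qed
  finally show ?thesis by (simp add: r_def)
qed

text \<open>The continuous functions \<open>min 1 (n * infdist x (- U))\<close> increase to the
  indicator of an open set \<open>U\<close>, and the open sets form an intersection-stable
  generator.\<close>

lemma circle_measure_eqI:
  fixes \<mu>\<^sub>1 \<mu>\<^sub>2 :: "circle measure"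
  assumes "finite_measure \<mu>\<^sub>1" "finite_measure \<mu>\<^sub>2" and s: "sets \<mu>\<^sub>1 = sets borel" "sets \<mu>\<^sub>2 = sets borel"
    and int: "\<And>\<phi> :: circle \<Rightarrow> real. continuous_on UNIV \<phi> \<Longrightarrow> (\<integral>x. \<phi> x \<partial>\<mu>\<^sub>1) = (\<integral>x. \<phi> x \<partial>\<mu>\<^sub>2)"
  shows "\<mu>\<^sub>1 = \<mu>\<^sub>2"
proof -
  interpret M1: finite_measure \<mu>\<^sub>1 by fact
  interpret M2: finite_measure \<mu>\<^sub>2 by fact
  have sp: "space \<mu>\<^sub>1 = UNIV" "space \<mu>\<^sub>2 = UNIV"
    using sets_eq_imp_space_eq[OF s(1)] sets_eq_imp_space_eq[OF s(2)] by simp_all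
  have "measure \<mu>\<^sub>1 U = measure \<mu>\<^sub>2 U" if U: "open U" for U
  \<comment> \<open>As \<open>infdist x {} = 0\<close>, the approximating functions would vanish for
    \<open>U = UNIV\<close>.\<close>
  proof (cases "U = UNIV")
    case True
    then show ?thesis using int[of "\<lambda>_. 1"] sp by simp
  next
    case False
    define \<phi> where "\<phi> n x = min 1 (real n * infdist x (- U))" for n :: nat and x :: circle
    have c: "continuous_on UNIV (\<phi> n)" for n unfolding \<phi>_def by (intro continuous_intros)
    have lim: "(\<lambda>n. \<phi> n x) \<longlonglongrightarrow> indicator U x" for x
    proof (cases "x \<in> U")
      case True
      then have pos: "infdist x (- U) > 0"
        using U False in_closed_iff_infdist_zero[of "- U" x] infdist_nonneg[of x "- U"] by (auto simp: closed_def less_le)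
      obtain N where N: "1 < real N * infdist x (- U)"
        using reals_Archimedean3[OF pos] by (metis mult.commute)
      have "\<phi> n x = 1" if "n \<ge> N" for n
      proof -
        have "real N * infdist x (- U) \<le> real n * infdist x (- U)" using that pos by (intro mult_right_mono) auto
        then show ?thesis using N by (simp add: \<phi>_def)
      qed
      then have "eventually (\<lambda>n. \<phi> n x = 1) sequentially" unfolding eventually_sequentially by blast
      then show ?thesis using True by (simp add: tendsto_eventually)
    next
      case False
      then have "\<phi> n x = 0" for n by (simp add: \<phi>_def)
      then show ?thesis using False by simp
    qed
    have b: "norm (\<phi> n x) \<le> 1" for n x unfolding \<phi>_def using infdist_nonneg[of x "- U"] by (simp add: abs_le_iff min_def)
    have "(\<lambda>n. \<integral>x. \<phi> n x \<partial>\<mu>) \<longlonglongrightarrow> (\<integral>x. indicator U x \<partial>\<mu>)"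
      if "finite_measure \<mu>" "sets \<mu> = sets borel" for \<mu> :: "circle measure"
    proof (rule integral_dominated_convergence[where w="\<lambda>_. 1"])
      interpret finite_measure \<mu> by fact
      have *: "borel_measurable \<mu> = borel_measurable (borel :: circle measure)"
        by (rule measurable_cong_sets[OF that(2) refl])
      show "\<phi> n \<in> borel_measurable \<mu>" for n
        unfolding * using c by (rule borel_measurable_continuous_onI)
      show "(indicator U :: circle \<Rightarrow> real) \<in> borel_measurable \<mu>"
        unfolding * using U by (intro borel_measurable_indicator) simp
      show "integrable \<mu> (\<lambda>_. 1)" by (rule integrable_const)
    qed (use lim b in auto)
    from this[OF assms(1) s(1)] this[OF assms(2) s(2)]
    have "(\<integral>x. indicator U x \<partial>\<mu>\<^sub>1) = (\<integral>x. (indicator U x :: real) \<partial>\<mu>\<^sub>2)"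
      unfolding int[OF c] by (rule LIMSEQ_unique)
    then show ?thesis using U s sp by simp
  qed
  then have "emeasure \<mu>\<^sub>1 U = emeasure \<mu>\<^sub>2 U" if "open U" for U
    using that by (simp add: M1.emeasure_eq_measure M2.emeasure_eq_measure)
  then show ?thesis
    using s sp by (intro measure_eqI_generator_eq[of "{U. open U}" UNIV \<mu>\<^sub>1 \<mu>\<^sub>2 "\<lambda>_. UNIV"])
      (auto simp: borel_def Int_stable_def M1.emeasure_eq_measure)
qed

context
  fixes f :: "circle \<Rightarrow> circle" and \<zeta> :: "circle \<Rightarrow> real" and \<epsilon> :: real
  assumes f [measurable]: "f \<in> borel_measurable borel" and \<zeta> [measurable]: "\<zeta> \<in> borel_measurable borel" and \<epsilon>: "\<epsilon> > 0"
begin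

interpretation N: prob_space "noise \<epsilon>" by (rule prob_space_noise[OF \<epsilon>])

lemma perturbed_map_measurable:
  assumes [simp, measurable_cong]: "sets \<mu> = sets borel"
  shows "(\<lambda>(t, x). perturbed_map f \<zeta> t x) \<in> borel_measurable (noise \<epsilon> \<Otimes>\<^sub>M \<mu>)"
  unfolding perturbed_map_def by measurable

lemma perturbed_map_measurable1 [measurable]: "(\<lambda>t. perturbed_map f \<zeta> t x) \<in> borel_measurable borel"
  unfolding perturbed_map_def by measurable

lemma kernel_integral_measurable [measurable]:
  assumes [measurable]: "g \<in> borel_measurable borel"
  shows "kernel_integral f \<zeta> \<epsilon> g \<in> borel_measurable borel"
proof -
  have [measurable]: "(\<lambda>(x, t). perturbed_map f \<zeta> t x) \<in> borel_measurable (borel \<Otimes>\<^sub>M noise \<epsilon>)"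
    unfolding perturbed_map_def by measurable
  have "(\<lambda>x. \<integral>\<^sup>+t. g (perturbed_map f \<zeta> t x) \<partial>noise \<epsilon>) \<in> borel_measurable borel"
    by measurable
  then show ?thesis unfolding kernel_integral_def by simp
qed

text \<open>Stationarity says that \<open>\<mu>\<close> and the law of one step from
  \<open>\<mu>\<close> give the same integrals of continuous functions. Hence they coincide as
  measures, and the identity extends to Borel functions.\<close>

lemma stationary_nn_integral:
  assumes st: "stationary_measure f \<zeta> \<epsilon> \<mu>" and g [measurable]: "g \<in> borel_measurable borel"
  shows "(\<integral>\<^sup>+x. g x \<partial>\<mu>) = (\<integral>\<^sup>+x. kernel_integral f \<zeta> \<epsilon> g x \<partial>\<mu>)"
proof -
  have \<mu>: "prob_space \<mu>" and s [simp, measurable_cong]: "sets \<mu> = sets borel"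
    using st by (auto simp: stationary_measure_def circle_prob_def)
  interpret \<mu>: prob_space \<mu> by (rule \<mu>)
  interpret pair_prob_space "noise \<epsilon>" \<mu> ..
  note m [measurable] = perturbed_map_measurable[OF s]
  define \<rho> where "\<rho> = distr (noise \<epsilon> \<Otimes>\<^sub>M \<mu>) borel (\<lambda>(t, x). perturbed_map f \<zeta> t x)"
  have "\<mu> = \<rho>"
  proof (rule circle_measure_eqI)
    show "finite_measure \<mu>" by (rule \<mu>.finite_measure_axioms)
    show "finite_measure \<rho>" unfolding \<rho>_def by (intro finite_measure_distr m)
    show "sets \<mu> = sets borel" "sets \<rho> = sets borel" by (simp_all add: \<rho>_def)
    fix \<phi> :: "circle \<Rightarrow> real" assume \<phi>: "continuous_on UNIV \<phi>"
    then have [measurable]: "\<phi> \<in> borel_measurable borel" by (rule borel_measurable_continuous_onI)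
    have "bounded (range \<phi>)"
      using compact_continuous_image[OF \<phi> compact_UNIV_circle] by (rule compact_imp_bounded)
    then obtain b where b: "\<And>x. norm (\<phi> x) \<le> b" unfolding bounded_iff by auto
    have "(\<integral>x. \<phi> x \<partial>\<rho>) = (\<integral>p. \<phi> (case p of (t, x) \<Rightarrow> perturbed_map f \<zeta> t x) \<partial>(noise \<epsilon> \<Otimes>\<^sub>M \<mu>))"
      unfolding \<rho>_def by (rule integral_distr[OF m]) measurable
    also have "\<dots> = (\<integral>p. (case p of (t, x) \<Rightarrow> \<phi> (perturbed_map f \<zeta> t x)) \<partial>(noise \<epsilon> \<Otimes>\<^sub>M \<mu>))"
      by (rule Bochner_Integration.integral_cong) auto
    also have "\<dots> = (\<integral>t. (\<integral>x. \<phi> (perturbed_map f \<zeta> t x) \<partial>\<mu>) \<partial>noise \<epsilon>)"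
    proof (rule integral_fst[symmetric])
      show "integrable (noise \<epsilon> \<Otimes>\<^sub>M \<mu>) (\<lambda>(t, x). \<phi> (perturbed_map f \<zeta> t x))"
        by (rule P.integrable_const_bound[of _ b]) (use b in auto)
    qed
    also have "\<dots> = (\<integral>x. \<phi> x \<partial>\<mu>)" using st \<phi> by (simp add: stationary_measure_def)
    finally show "(\<integral>x. \<phi> x \<partial>\<mu>) = (\<integral>x. \<phi> x \<partial>\<rho>)" by simp
  qed
  then have "(\<integral>\<^sup>+x. g x \<partial>\<mu>) = (\<integral>\<^sup>+x. g x \<partial>\<rho>)" by simp
  also have "\<dots> = (\<integral>\<^sup>+p. g (case p of (t, x) \<Rightarrow> perturbed_map f \<zeta> t x) \<partial>(noise \<epsilon> \<Otimes>\<^sub>M \<mu>))"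
    unfolding \<rho>_def by (rule nn_integral_distr[OF m]) measurable
  also have "\<dots> = (\<integral>\<^sup>+p. (case p of (t, x) \<Rightarrow> g (perturbed_map f \<zeta> t x)) \<partial>(noise \<epsilon> \<Otimes>\<^sub>M \<mu>))"
    by (rule nn_integral_cong) auto
  also have "\<dots> = (\<integral>\<^sup>+x. (\<integral>\<^sup>+t. g (perturbed_map f \<zeta> t x) \<partial>noise \<epsilon>) \<partial>\<mu>)"
    by (subst nn_integral_snd[symmetric]) (auto simp: case_prod_beta)
  finally show ?thesis by (simp add: kernel_integral_def)
qed

lemma kernel_integral_const: "kernel_integral f \<zeta> \<epsilon> (\<lambda>_. c) x = c"
  using N.emeasure_space_1 by (simp add: kernel_integral_def)

lemma kernel_integral_add:
  assumes [measurable]: "g \<in> borel_measurable borel" "h \<in> borel_measurable borel"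
  shows "kernel_integral f \<zeta> \<epsilon> (\<lambda>x. g x + h x) y = kernel_integral f \<zeta> \<epsilon> g y + kernel_integral f \<zeta> \<epsilon> h y"
  unfolding kernel_integral_def by (intro nn_integral_add) measurable

lemma kernel_integral_mono: "(\<And>x. g x \<le> h x) \<Longrightarrow> kernel_integral f \<zeta> \<epsilon> g y \<le> kernel_integral f \<zeta> \<epsilon> h y"
  unfolding kernel_integral_def by (intro nn_integral_mono)

text \<open>Turns a positive transition weight into an actual small step, from which pseudo-orbits
  are assembled in \<open>survive_nonzero\<close>.\<close>

lemma kernel_integral_nonzero:
  assumes "kernel_integral f \<zeta> \<epsilon> g y \<noteq> 0"
  shows "\<exists>z. g z \<noteq> 0 \<and> dist z (f y) \<le> \<epsilon> * \<bar>\<zeta> y\<bar>"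
proof (rule ccontr)
  assume no: "\<not> ?thesis"
  have "AE t in noise \<epsilon>. g (perturbed_map f \<zeta> t y) = 0"
    using AE_noise[of \<epsilon>]
  proof eventually_elim
    case (elim t)
    have "dist (perturbed_map f \<zeta> t y) (f y) \<le> \<bar>t * \<zeta> y\<bar>"
      unfolding perturbed_map_def by (rule dist_add_to_circle_le)
    also have "\<dots> \<le> \<epsilon> * \<bar>\<zeta> y\<bar>" using elim by (simp add: abs_mult mult_right_mono)
    finally show ?case using no by blast
  qed
  then have "kernel_integral f \<zeta> \<epsilon> g y = (\<integral>\<^sup>+t. 0 \<partial>noise \<epsilon>)"
    unfolding kernel_integral_def by (intro nn_integral_cong_AE) auto
  then show False using assms by simp
qed

end

section \<open>Renewal estimates for stationary measures\<close>

text \<open>\<open>R\<close> is the set of strong noise: one step of the chain from \<open>R\<close> produces a measure of density at most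
  \<open>A\<close>, whereas a step from outside of \<open>R\<close> differs from \<open>f\<close> by at most \<open>e\<close>.\<close>

locale renewal = dominated_circle_map +
  fixes \<zeta> :: "circle \<Rightarrow> real" and \<epsilon> :: real and \<mu> :: "circle measure" and R :: "circle set" and e A :: real and n :: nat
  assumes \<zeta>_borel [measurable]: "\<zeta> \<in> borel_measurable borel" and \<zeta>_pos: "\<zeta> x > 0" and \<epsilon>_pos: "\<epsilon> > 0"
    and stationary: "stationary_measure f \<zeta> \<epsilon> \<mu>"
    and R_borel [measurable]: "R \<in> sets borel" and off: "x \<notin> R \<Longrightarrow> \<epsilon> * \<zeta> x \<le> e"
    and A_nonneg: "A \<ge> 0"
    and landing: "E \<in> sets borel \<Longrightarrow>
      (\<integral>\<^sup>+x. indicator R x * kernel_integral f \<zeta> \<epsilon> (indicator E) x \<partial>\<mu>) \<le> ennreal A * emeasure circle_lebesgue E"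
    and returns: "(\<forall>j<n. dist (y (Suc j)) (f (y j)) \<le> e) \<Longrightarrow> \<exists>j<n. y j \<in> R"
begin

abbreviation "Q \<equiv> kernel_integral f \<zeta> \<epsilon>"

lemmas Q_measurable [measurable] = kernel_integral_measurable[OF f_borel \<zeta>_borel \<epsilon>_pos]

lemma \<mu>_sets [simp, measurable_cong]: "sets \<mu> = sets borel"
  using stationary by (simp add: stationary_measure_def circle_prob_def)

lemma \<mu>_space [simp]: "space \<mu> = UNIV"
  using sets_eq_imp_space_eq[OF \<mu>_sets] by simp

sublocale \<mu>: prob_space \<mu>
  using stationary by (simp add: stationary_measure_def circle_prob_def)

text \<open>\<open>survive B i y\<close> is the probability that the chain started at \<open>y\<close> avoids \<open>R\<close> at the times
  \<open>0, \<dots>, i - 1\<close> and lies in \<open>B\<close> at time \<open>i\<close>.\<close>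

primrec survive :: "circle set \<Rightarrow> nat \<Rightarrow> circle \<Rightarrow> ennreal" where
  "survive B 0 = indicator B"
| "survive B (Suc i) = (\<lambda>y. indicator (- R) y * Q (survive B i) y)"

lemma survive_measurable [measurable]: "B \<in> sets borel \<Longrightarrow> survive B i \<in> borel_measurable borel"
  by (induction i) simp_all

lemma survive_le_1: "survive B i y \<le> 1"
proof (induction i arbitrary: y)
  case (Suc i)
  have "Q (survive B i) y \<le> Q (\<lambda>_. 1) y" using Suc by (intro kernel_integral_mono)
      (auto intro: f_borel \<zeta>_borel \<epsilon>_pos)
  also have "\<dots> = 1" by (rule kernel_integral_const[OF f_borel \<zeta>_borel \<epsilon>_pos])
  finally show ?case by (auto split: split_indicator)
qed (auto split: split_indicator)

lemma survive_nonzero: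
  "survive B i y \<noteq> 0 \<Longrightarrow> \<exists>x :: nat \<Rightarrow> circle. x 0 = y \<and> (\<forall>j<i. x j \<notin> R \<and> dist (x (Suc j)) (f (x j)) \<le> e) \<and> x i \<in> B"
proof (induction i arbitrary: y)
  case 0
  then show ?case by (intro exI[of _ "\<lambda>_. y"]) (auto split: split_indicator_asm)
next
  case (Suc i)
  then have y: "y \<notin> R" "Q (survive B i) y \<noteq> 0" by (auto split: split_indicator_asm)
  obtain z where z: "survive B i z \<noteq> 0" "dist z (f y) \<le> \<epsilon> * \<bar>\<zeta> y\<bar>"
    using kernel_integral_nonzero[OF f_borel \<zeta>_borel \<epsilon>_pos y(2)] by blast
  obtain x where x: "x 0 = z" "\<forall>j<i. x j \<notin> R \<and> dist (x (Suc j)) (f (x j)) \<le> e" "x i \<in> B"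
    using Suc.IH[OF z(1)] by blast
  have ze: "dist z (f y) \<le> e" using z(2) off[OF y(1)] \<zeta>_pos[of y] by simp
  define x' where "x' j = (case j of 0 \<Rightarrow> y | Suc j' \<Rightarrow> x j')" for j
  have "x' 0 = y" "x' (Suc i) \<in> B" using x by (simp_all add: x'_def)
  moreover have "x' j \<notin> R \<and> dist (x' (Suc j)) (f (x' j)) \<le> e" if "j < Suc i" for j
    using that x y(1) ze by (cases j) (auto simp: x'_def)
  ultimately show ?case by blast
qed

text \<open>The pseudo-orbit behind a positive probability is shadowed by the orbit of its starting
  point, which therefore ends near \<open>B\<close>.\<close>

lemma survive_le_indicator:
  assumes "shadows e n \<eta>" "i \<le> n"
  shows "survive B i y \<le> indicator ((f ^^ i) -` thicken \<eta> B) y"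
proof (cases "survive B i y = 0")
  case False
  then obtain x where x: "x 0 = y" "\<forall>j<i. x j \<notin> R \<and> dist (x (Suc j)) (f (x j)) \<le> e" "x i \<in> B"
    using survive_nonzero by blast
  have "dist (x i) ((f ^^ i) (x 0)) < \<eta>" using assms x(2) unfolding shadows_def by blast
  then have "y \<in> (f ^^ i) -` thicken \<eta> B" using x by (auto simp: mem_thicken dist_commute)
  then show ?thesis using survive_le_1 by simp
qed simp

text \<open>A pseudo-orbit that avoids \<open>R\<close> at the times \<open>0, ..., n - 1\<close>
  would contradict \<open>returns\<close>.\<close>

lemma survive_n: "survive B n y = 0"
  using survive_nonzero[of B n y] returns by blast

text \<open>Mass of the stationary chain that makes a step from \<open>R\<close>, then avoids \<open>R\<close> for \<open>i\<close> steps and ends in \<open>B\<close>.\<close>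

definition land :: "circle set \<Rightarrow> nat \<Rightarrow> ennreal" where
  "land B i = (\<integral>\<^sup>+y. indicator R y * Q (survive B i) y \<partial>\<mu>)"

text \<open>By stationarity the chain may be started one step earlier. The earlier position lies in
  \<open>R\<close>, which gives \<open>land B i\<close>, or outside, which gives one more surviving
  step.\<close>

lemma survive_integral_Suc:
  assumes [measurable]: "B \<in> sets borel"
  shows "(\<integral>\<^sup>+y. survive B i y \<partial>\<mu>) = land B i + (\<integral>\<^sup>+y. survive B (Suc i) y \<partial>\<mu>)"
proof -
  have "(\<integral>\<^sup>+y. survive B i y \<partial>\<mu>) = (\<integral>\<^sup>+y. Q (survive B i) y \<partial>\<mu>)"
    by (rule stationary_nn_integral[OF f_borel \<zeta>_borel \<epsilon>_pos stationary]) measurable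
  also have "\<dots> = (\<integral>\<^sup>+y. indicator R y * Q (survive B i) y + indicator (- R) y * Q (survive B i) y \<partial>\<mu>)"
    by (intro nn_integral_cong) (auto split: split_indicator)
  also have "\<dots> = land B i + (\<integral>\<^sup>+y. indicator (- R) y * Q (survive B i) y \<partial>\<mu>)"
    unfolding land_def by (rule nn_integral_add) measurable
  finally show ?thesis by simp
qed

lemma survive_integral_sum:
  assumes "B \<in> sets borel"
  shows "emeasure \<mu> B = (\<Sum>i<m. land B i) + (\<integral>\<^sup>+y. survive B m y \<partial>\<mu>)"
proof (induction m)
  case 0
  then show ?case using assms by simp
next
  case (Suc m)
  then show ?case using survive_integral_Suc[OF assms, of m] by (simp add: add.assoc)
qed

text \<open>The step from \<open>R\<close> lands with density at most \<open>A\<close>, shadowing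
  replaces the following \<open>i\<close> steps of the chain by \<open>f ^^ i\<close> up to
  \<open>\<eta>\<close>, and \<open>\<nu>\<close> dominates the resulting image of Lebesgue
  measure.\<close>

lemma land_le:
  assumes "shadows e n \<eta>" "i \<le> n" and B [measurable]: "B \<in> sets borel"
  shows "land B i \<le> ennreal (A * measure \<nu> (thicken \<eta> B))"
proof -
  define E where "E = (f ^^ i) -` thicken \<eta> B"
  have E [measurable]: "E \<in> sets borel" unfolding E_def by (rule vimage_funpow_borel) simp
  have "land B i \<le> (\<integral>\<^sup>+y. indicator R y * Q (indicator E) y \<partial>\<mu>)"
    unfolding land_def E_def
    by (intro nn_integral_mono mult_left_mono kernel_integral_mono[OF f_borel \<zeta>_borel \<epsilon>_pos]
        survive_le_indicator assms) simp
  also have "\<dots> \<le> ennreal A * emeasure circle_lebesgue E" by (rule landing[OF E])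
  also have "\<dots> \<le> ennreal A * emeasure \<nu> (thicken \<eta> B)"
    unfolding E_def by (intro mult_left_mono dominated) simp_all
  also have "\<dots> = ennreal (A * measure \<nu> (thicken \<eta> B))"
    using A_nonneg by (simp add: \<nu>.emeasure_eq_measure ennreal_mult)
  finally show ?thesis .
qed

text \<open>After the last visit has been looked for \<open>n\<close> steps back, the remaining term
  vanishes, since the chain cannot avoid \<open>R\<close> that long.\<close>

lemma stationary_le:
  assumes "shadows e n \<eta>" "B \<in> sets borel"
  shows "measure \<mu> B \<le> n * A * measure \<nu> (thicken \<eta> B)"
proof -
  have "survive B n = (\<lambda>_. 0)" by (rule ext) (rule survive_n)
  then have "emeasure \<mu> B = (\<Sum>i<n. land B i)"
    unfolding survive_integral_sum[OF assms(2), of n] by simp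
  also have "\<dots> \<le> (\<Sum>i<n. ennreal (A * measure \<nu> (thicken \<eta> B)))"
    by (intro sum_mono land_le assms) simp
  also have "\<dots> = ennreal (n * A * measure \<nu> (thicken \<eta> B))"
    using A_nonneg by (simp add: ennreal_of_nat_eq_real_of_nat ennreal_mult'' mult.assoc)
  finally show ?thesis
    using A_nonneg by (simp add: \<mu>.emeasure_eq_measure)
qed

lemma survive_decompose: "survive UNIV i y = survive UNIV (Suc i) y + survive R i y"
proof (induction i arbitrary: y)
  case 0
  then show ?case
    using kernel_integral_const[OF f_borel \<zeta>_borel \<epsilon>_pos, of 1 y]
    by (auto simp: indicator_def[of UNIV] split: split_indicator)
next
  case (Suc i)
  have "survive UNIV i = (\<lambda>y. survive UNIV (Suc i) y + survive R i y)" using Suc by blast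
  then have "Q (survive UNIV i) y = Q (\<lambda>y. survive UNIV (Suc i) y + survive R i y) y" by simp
  also have "\<dots> = Q (survive UNIV (Suc i)) y + Q (survive R i) y"
    by (rule kernel_integral_add[OF f_borel \<zeta>_borel \<epsilon>_pos]) (intro survive_measurable; simp)+
  finally show ?case by (simp add: distrib_left)
qed

lemma land_decompose: "land UNIV i = land UNIV (Suc i) + land R i"
proof -
  have m: "survive UNIV (Suc i) \<in> borel_measurable borel" "survive R i \<in> borel_measurable borel"
    by (intro survive_measurable; simp)+
  have "survive UNIV i = (\<lambda>y. survive UNIV (Suc i) y + survive R i y)" by (rule ext) (rule survive_decompose)
  then have "land UNIV i = (\<integral>\<^sup>+y. indicator R y * Q (survive UNIV (Suc i)) y + indicator R y * Q (survive R i) y \<partial>\<mu>)"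
    unfolding land_def by (simp only: kernel_integral_add[OF f_borel \<zeta>_borel \<epsilon>_pos m] distrib_left)
  also have "\<dots> = land UNIV (Suc i) + land R i"
    unfolding land_def using m by (intro nn_integral_add) (measurable; simp)+
  finally show ?thesis .
qed

text \<open>All mass in \<open>R\<close> leaves it with the next step; as at most \<open>land R i \<le> A * measure \<nu> (thicken \<eta> R)\<close> of it
  returns after \<open>i\<close> further steps, most of it stays away for a long time, which is possible for a small
  total mass only.\<close>

lemma stationary_R_le:
  assumes sh: "shadows e n \<eta>" and m: "m \<le> n"
  shows "m * measure \<mu> R \<le> 1 + real m ^ 2 * (A * measure \<nu> (thicken \<eta> R))"
proof -
  define g where "g = A * measure \<nu> (thicken \<eta> R)"
  have g: "g \<ge> 0" unfolding g_def using A_nonneg by simp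
  have "Q (survive UNIV 0) y = 1" for y
  proof -
    have "survive UNIV 0 = (\<lambda>_. 1)" by auto
    then show ?thesis using kernel_integral_const[OF f_borel \<zeta>_borel \<epsilon>_pos] by simp
  qed
  then have land0: "land UNIV 0 = ennreal (measure \<mu> R)"
    unfolding land_def by (simp add: \<mu>.emeasure_eq_measure del: survive.simps)
  have "ennreal (measure \<mu> R) \<le> land UNIV i + of_nat i * ennreal g" if "i \<le> n" for i
    using that
  proof (induction i)
    case (Suc i)
    have "ennreal (measure \<mu> R) \<le> land UNIV i + of_nat i * ennreal g" using Suc by simp
    also have "land UNIV i = land UNIV (Suc i) + land R i" by (rule land_decompose)
    also have "land R i \<le> ennreal g" unfolding g_def by (rule land_le[OF sh]) (use Suc.prems in simp_all)
    finally show ?case by (simp add: distrib_right add_ac add_left_mono)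
  qed (simp add: land0)
  then have "(\<Sum>i<m. ennreal (measure \<mu> R)) \<le> (\<Sum>i<m. land UNIV i + ennreal (m * g))"
  proof (intro sum_mono)
    fix i assume hyp: "\<And>i. i \<le> n \<Longrightarrow> ennreal (measure \<mu> R) \<le> land UNIV i + of_nat i * ennreal g" and i: "i \<in> {..<m}"
    have "of_nat i * ennreal g = ennreal (i * g)" using g by (simp add: ennreal_of_nat_eq_real_of_nat ennreal_mult)
    also have "\<dots> \<le> ennreal (m * g)" using i g by (intro ennreal_leI mult_right_mono) auto
    finally show "ennreal (measure \<mu> R) \<le> land UNIV i + ennreal (m * g)"
      using hyp[of i] i m by (auto intro: order.trans[OF _ add_left_mono])
  qed
  also have "\<dots> = (\<Sum>i<m. land UNIV i) + of_nat m * ennreal (m * g)"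
    by (simp add: sum.distrib)
  also have "(\<Sum>i<m. land UNIV i) \<le> 1"
  proof -
    have "(\<Sum>i<m. land UNIV i) \<le> (\<Sum>i<m. land UNIV i) + (\<integral>\<^sup>+y. survive UNIV m y \<partial>\<mu>)" by simp
    also have "\<dots> = emeasure \<mu> UNIV" by (rule survive_integral_sum[symmetric]) simp
    also have "\<dots> = 1" using \<mu>.emeasure_space_1 by simp
    finally show ?thesis .
  qed
  finally have "(\<Sum>i<m. ennreal (measure \<mu> R)) \<le> 1 + of_nat m * ennreal (m * g)" by (simp add: add_right_mono)
  moreover have "(\<Sum>i<m. ennreal (measure \<mu> R)) = ennreal (m * measure \<mu> R)"
    by (simp add: ennreal_of_nat_eq_real_of_nat ennreal_mult)
  moreover have "1 + of_nat m * ennreal (m * g) = ennreal (1 + m * (m * g))"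
    using g by (simp add: ennreal_of_nat_eq_real_of_nat ennreal_mult)
  ultimately have "ennreal (m * measure \<mu> R) \<le> ennreal (1 + m * (m * g))" by argo
  moreover have "0 \<le> 1 + m * (m * g)" using g by simp
  ultimately have "m * measure \<mu> R \<le> 1 + m * (m * g)" by (simp only: ennreal_le_iff)
  then show ?thesis unfolding g_def power2_eq_square by (simp only: mult.assoc)
qed

text \<open>With \<open>m\<close> about \<open>n / (8 * K)\<close> the quadratic term in
  \<open>stationary_R_le\<close> is at most half of \<open>m * measure \<mu> R\<close>, because
  \<open>A\<close> is bounded by a multiple of \<open>measure \<mu> R\<close>. Absorbing it leaves
  \<open>m * measure \<mu> R \<le> 2\<close>.\<close>

lemma stationary_R_le':
  assumes sh: "shadows e n \<eta>" and A: "A \<le> 4 * measure \<mu> R" and K: "K \<ge> 1" "n * measure \<nu> (thicken \<eta> R) \<le> K"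
    and n: "real n \<ge> 16 * K"
  shows "measure \<mu> R \<le> 32 * K / n"
proof -
  define m where "m = nat \<lfloor>n / (8 * K)\<rfloor>"
  have n0: "real n > 0" using n K(1) by linarith
  have q: "2 \<le> n / (8 * K)" using n K(1) by (subst pos_le_divide_eq) auto
  have m: "real m \<le> n / (8 * K)" "n / (8 * K) - 1 \<le> real m" unfolding m_def using q by linarith+
  have mn: "m \<le> n"
  proof -
    have "n / (8 * K) \<le> n / 1" using K(1) by (intro divide_left_mono) auto
    then show ?thesis using m(1) by simp
  qed
  have m16: "real m \<ge> n / (16 * K)"
  proof -
    have "n / (16 * K) = n / (8 * K) / 2" by simp
    then show ?thesis using m(2) q by linarith
  qed
  let ?r = "measure \<mu> R"
  have r: "?r \<ge> 0" by simp
  have "real m * (4 * measure \<nu> (thicken \<eta> R)) \<le> n / (8 * K) * (4 * measure \<nu> (thicken \<eta> R))"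
    using m(1) by (intro mult_right_mono) auto
  also have "\<dots> = (n * measure \<nu> (thicken \<eta> R)) / (2 * K)" using K(1) by (simp add: field_simps)
  also have "\<dots> \<le> K / (2 * K)" using K by (intro divide_right_mono) auto
  also have "\<dots> = 1 / 2" using K(1) by simp
  finally have half: "real m * (4 * measure \<nu> (thicken \<eta> R)) \<le> 1 / 2" .
  have "m * ?r \<le> 1 + real m ^ 2 * (A * measure \<nu> (thicken \<eta> R))" by (rule stationary_R_le[OF sh mn])
  also have "\<dots> \<le> 1 + real m ^ 2 * (4 * ?r * measure \<nu> (thicken \<eta> R))"
    using A by (intro add_left_mono mult_left_mono mult_right_mono) auto
  also have "\<dots> = 1 + m * ?r * (m * (4 * measure \<nu> (thicken \<eta> R)))" by (simp add: power2_eq_square mult_ac)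
  also have "\<dots> \<le> 1 + m * ?r * (1 / 2)" using half r by (intro add_left_mono mult_left_mono) auto
  finally have "m * ?r \<le> 2" by simp
  have "n / (16 * K) * ?r \<le> m * ?r" using m16 r by (intro mult_right_mono)
  then have "n / (16 * K) * ?r \<le> 2" using \<open>m * ?r \<le> 2\<close> by linarith
  then show ?thesis using n0 K(1) by (simp add: pos_le_divide_eq mult.commute divide_le_eq)
qed

end

section \<open>Noise adapted to a tower\<close>

locale noisy_tower = dominated_circle_map +
  fixes R :: "nat \<Rightarrow> circle set" and n :: "nat \<Rightarrow> nat" and e e' \<eta> \<delta> :: "nat \<Rightarrow> real"
  assumes R_0: "R 0 = UNIV" and open_R: "open (R l)" and R_Suc: "R (Suc l) \<subseteq> R l"
    and frontier_R: "emeasure circle_lebesgue (frontier (R l)) = 0"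
    and closure_R: "n l * measure \<nu> (closure (R l)) \<le> 2 * measure \<nu> UNIV + 10"
    and thicken_R: "n l * measure \<nu> (thicken (\<eta> l) (R l)) \<le> 2 * measure \<nu> UNIV + 10"
    and e: "0 < e l" "e l \<le> 1 / 2" "shadows (e l) (n l) (\<eta> l)"
    and hits: "(\<forall>j<n l. dist (x (Suc j)) (f (x j)) \<le> e l) \<Longrightarrow> \<exists>j<n l. x j \<in> R (Suc l)"
    and thicken_diff: "n l * measure \<nu> (thicken (\<delta> l) (R l - R (Suc l))) \<le> e l / 2"
    and e': "0 < e' l" "e' l \<le> e l" "shadows (e' l) (n l) (\<delta> l)"
    and \<eta>_0: "\<eta> \<longlonglongrightarrow> 0" and n_top: "filterlim n at_top sequentially"
begin

definition K :: real where "K = 2 * measure \<nu> UNIV + 10"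

lemma K_ge: "K \<ge> 10"
  unfolding K_def by simp

lemma R_borel [measurable]: "R l \<in> sets borel"
  using open_R by simp

lemma R_antimono: "k \<le> l \<Longrightarrow> R l \<subseteq> R k"
  using R_Suc by (rule lift_Suc_antimono_le)

text \<open>Dividing by \<open>e' (Suc l)\<close> separates the scales so far that
  \<open>\<epsilon> * z (Suc l) < 1\<close> forces \<open>\<epsilon> * z l < e' (Suc l)\<close>, the
  error that shadowing up to \<open>\<delta> (Suc l)\<close> tolerates.\<close>

primrec z :: "nat \<Rightarrow> real" where
  "z 0 = 1"
| "z (Suc l) = z l / e' (Suc l)"

lemma z_pos: "z l > 0"
  by (induction l) (simp_all add: e')

lemma z_double: "2 * z l \<le> z (Suc l)"
proof -
  have "e' (Suc l) \<le> 1 / 2" using e'(2) e(2) order.trans by blast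
  then have "2 * e' (Suc l) * z l \<le> 1 * z l" using z_pos[of l] by (intro mult_right_mono) auto
  then show ?thesis using e'(1)[of "Suc l"] by (simp add: z.simps pos_le_divide_eq mult_ac)
qed

declare z.simps(2) [simp del]

lemma z_mono: "k \<le> l \<Longrightarrow> z k \<le> z l"
proof (rule lift_Suc_mono_le)
  show "z i \<le> z (Suc i)" for i using z_double[of i] z_pos[of i] by linarith
qed

lemma z_ge: "z l \<ge> l"
proof (induction l)
  case (Suc l)
  then show ?case using z_double[of l] z_mono[of 0 l] by simp
qed simp

text \<open>The value on the null set \<open>\<Inter>l. R l\<close> is irrelevant.\<close>

definition \<zeta> :: "circle \<Rightarrow> real" where
  "\<zeta> x = (if \<exists>l. x \<notin> R l then z (LEAST l. x \<notin> R (Suc l)) else 1)"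

lemma \<zeta>_eq: "x \<in> R l \<Longrightarrow> x \<notin> R (Suc l) \<Longrightarrow> \<zeta> x = z l"
proof -
  assume x: "x \<in> R l" "x \<notin> R (Suc l)"
  have "(LEAST l. x \<notin> R (Suc l)) = l"
  proof (rule Least_equality)
    fix k assume k: "x \<notin> R (Suc k)"
    show "l \<le> k"
    proof (rule ccontr)
      assume "\<not> l \<le> k"
      then show False using R_antimono[of "Suc k" l] k x(1) by auto
    qed
  qed (rule x)
  then show ?thesis using x by (auto simp: \<zeta>_def)
qed

lemma ex_level:
  assumes "x \<in> R k" "x \<notin> R m"
  obtains l where "k \<le> l" "l < m" "x \<in> R l" "x \<notin> R (Suc l)"
proof -
  define l where "l = (LEAST l. x \<notin> R (Suc l))"
  have m0: "m \<noteq> 0" using assms R_0 by (cases m) auto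
  then have m1: "x \<notin> R (Suc (m - 1))" using assms by simp
  have l: "x \<notin> R (Suc l)" unfolding l_def by (rule LeastI) (rule m1)
  have lm: "l \<le> m - 1" unfolding l_def by (rule Least_le) (rule m1)
  have xl: "x \<in> R l"
  proof (cases l)
    case (Suc l')
    have "\<not> x \<notin> R (Suc l')"
      by (rule not_less_Least) (use Suc in \<open>simp add: l_def\<close>)
    then show ?thesis using Suc by simp
  qed (use R_0 in simp)
  have "k \<le> l"
  proof (rule ccontr)
    assume "\<not> k \<le> l"
    then show False using R_antimono[of "Suc l" k] l assms(1) by auto
  qed
  then show ?thesis using that[of l] l lm m0 xl by simp
qed

lemma \<zeta>_pos: "\<zeta> x > 0"
  by (simp add: \<zeta>_def z_pos)

lemma \<zeta>_le: "x \<notin> R (Suc l) \<Longrightarrow> \<zeta> x \<le> z l"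
proof -
  assume x: "x \<notin> R (Suc l)"
  have "x \<in> R 0" using R_0 by simp
  then obtain k where "k < Suc l" "x \<in> R k" "x \<notin> R (Suc k)" using x by (rule ex_level)
  then show ?thesis using \<zeta>_eq z_mono[of k l] by simp
qed

lemma \<zeta>_ge: "x \<in> R l \<Longrightarrow> x \<notin> (\<Inter>l. R l) \<Longrightarrow> z l \<le> \<zeta> x"
proof -
  assume x: "x \<in> R l" "x \<notin> (\<Inter>l. R l)"
  then obtain m where "x \<notin> R m" by blast
  with x(1) obtain k where "l \<le> k" "x \<in> R k" "x \<notin> R (Suc k)" by (rule ex_level)
  then show ?thesis using \<zeta>_eq z_mono[of l k] by simp
qed

lemma \<zeta>_borel [measurable]: "\<zeta> \<in> borel_measurable borel"
  unfolding \<zeta>_def by measurable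

text \<open>The \<open>\<nu>\<close>-measure of the intersection is at most \<open>K / n l\<close>
  for all large \<open>l\<close>, and the case \<open>j = 0\<close> of domination compares it with
  Lebesgue measure.\<close>

lemma null_Inter_closure: "emeasure circle_lebesgue (\<Inter>l. closure (R l)) = 0"
proof -
  let ?C = "\<Inter>l. closure (R l)"
  have c: "closed ?C" by (intro closed_INT) simp
  have b: "measure \<nu> ?C \<le> K * inverse (real (n l))" if "n l > 0" for l
  proof -
    have "measure \<nu> ?C \<le> measure \<nu> (closure (R l))" by (rule \<nu>.finite_measure_mono) auto
    moreover have "measure \<nu> (closure (R l)) \<le> K * inverse (real (n l))"
      using closure_R[of l] that by (simp add: K_def field_simps)
    ultimately show ?thesis by linarith
  qed
  have nt: "filterlim (\<lambda>l. real (n l)) at_top sequentially"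
    by (rule filterlim_compose[OF filterlim_real_sequentially n_top])
  have "(\<lambda>l. K * inverse (real (n l))) \<longlonglongrightarrow> K * 0"
    by (intro tendsto_mult tendsto_const tendsto_inverse_0_at_top nt)
  moreover have "\<forall>\<^sub>F l in sequentially. measure \<nu> ?C \<le> K * inverse (real (n l))"
    using nt[unfolded filterlim_at_top, rule_format, of 1] by eventually_elim (rule b, simp)
  ultimately have "measure \<nu> ?C \<le> K * 0"
    by (intro tendsto_lowerbound[of _ "K * 0" sequentially]) auto
  then have "measure \<nu> ?C = 0" using measure_nonneg[of \<nu> ?C] by linarith
  then have "emeasure \<nu> ?C = 0" by (simp add: \<nu>.emeasure_eq_measure)
  moreover have "emeasure circle_lebesgue ?C \<le> emeasure \<nu> ?C"
    using dominated[of ?C 0] borel_closed[OF c] by simp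
  ultimately show ?thesis by simp
qed

lemma AE_locally_constant: "AE x in circle_lebesgue. locally_constant_at \<zeta> x"
proof -
  have "AE x in circle_lebesgue. x \<notin> frontier (R l)" for l
    by (rule AE_not_in) (use frontier_R[of l] in \<open>auto intro!: null_setsI\<close>)
  then have "AE x in circle_lebesgue. \<forall>l. x \<notin> frontier (R l)" by (simp add: AE_all_countable)
  moreover have "AE x in circle_lebesgue. x \<notin> (\<Inter>l. closure (R l))"
    by (rule AE_not_in) (use null_Inter_closure in \<open>auto intro!: null_setsI borel_closed closed_INT\<close>)
  ultimately show ?thesis
  proof eventually_elim
    case (elim x)
    then obtain m where "x \<notin> closure (R m)" by blast
    then have m: "x \<notin> R m" using closure_subset by blast
    have "x \<in> R 0" using R_0 by simp
    from this m obtain l where l: "x \<in> R l" "x \<notin> R (Suc l)" by (rule ex_level)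
    have "x \<notin> frontier (R (Suc l))" using elim by blast
    then have c: "x \<notin> closure (R (Suc l))" using l(2) interior_open[OF open_R] by (simp add: frontier_def)
    have o: "open (R l - closure (R (Suc l)))" using open_R by (intro open_Diff) auto
    have "\<forall>\<^sub>F y in nhds x. y \<in> R l - closure (R (Suc l))"
      by (rule eventually_nhds_in_open[OF o]) (use l c in simp)
    then show ?case unfolding locally_constant_at_def
    proof eventually_elim
      case (elim y)
      then have "y \<in> R l" "y \<notin> R (Suc l)" using closure_subset[of "R (Suc l)"] by auto
      then show ?case using \<zeta>_eq l by simp
    qed
  qed
qed

context
  fixes \<epsilon> :: real and \<mu> :: "circle measure" and l :: nat
  assumes \<epsilon>_pos: "\<epsilon> > 0" and stationary: "stationary_measure f \<zeta> \<epsilon> \<mu>"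
    and \<epsilon>: "1 \<le> \<epsilon> * z (Suc (Suc l))" "\<epsilon> * z (Suc l) < 1"
begin

lemma \<mu>_sets [simp, measurable_cong]: "sets \<mu> = sets borel"
  using stationary by (simp add: stationary_measure_def circle_prob_def)

lemma \<mu>_prob: "prob_space \<mu>"
  using stationary by (simp add: stationary_measure_def circle_prob_def)

text \<open>Each step has a density because the amplitude is positive everywhere, so a stationary
  measure vanishes on Lebesgue null sets.\<close>

lemma \<mu>_null_Inter: "AE x in \<mu>. x \<notin> (\<Inter>l. R l)"
proof (rule AE_not_in, rule null_setsI)
  let ?Z = "\<Inter>l. R l"
  show Z: "?Z \<in> sets \<mu>" by simp
  have "?Z \<subseteq> (\<Inter>l. closure (R l))" using closure_subset by blast
  then have "emeasure circle_lebesgue ?Z \<le> emeasure circle_lebesgue (\<Inter>l. closure (R l))"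
    by (intro emeasure_mono) (auto intro!: borel_closed closed_INT)
  then have 0: "emeasure circle_lebesgue ?Z = 0" by (simp add: null_Inter_closure)
  have "kernel_integral f \<zeta> \<epsilon> (indicator ?Z) x = 0" for x
    using kernel_integral_indicator_le[of ?Z \<epsilon> \<zeta> x f] Z \<zeta>_pos \<epsilon>_pos by (simp add: 0)
  moreover have "emeasure \<mu> ?Z = (\<integral>\<^sup>+x. kernel_integral f \<zeta> \<epsilon> (indicator ?Z) x \<partial>\<mu>)"
    using stationary_nn_integral[OF f_borel \<zeta>_borel \<epsilon>_pos stationary, of "indicator ?Z"] Z by simp
  ultimately show "emeasure \<mu> ?Z = 0" by simp
qed

lemma kernel_near:
  assumes E: "E \<in> sets borel" and x: "x \<in> R (Suc (Suc l))" "x \<notin> (\<Inter>l. R l)"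
  shows "kernel_integral f \<zeta> \<epsilon> (indicator E) x \<le> ennreal 2 * emeasure circle_lebesgue E"
proof -
  have "1 \<le> \<epsilon> * z (Suc (Suc l))" by (rule \<epsilon>)
  also have "\<dots> \<le> \<epsilon> * \<zeta> x" using \<zeta>_ge[OF x] \<epsilon>_pos by simp
  finally have "1 + 1 / (2 * (\<epsilon> * \<zeta> x)) \<le> 2" by (simp add: divide_le_eq)
  then have "ennreal (1 + 1 / (2 * (\<epsilon> * \<zeta> x))) * emeasure circle_lebesgue E \<le> ennreal 2 * emeasure circle_lebesgue E"
    by (intro mult_right_mono ennreal_leI) auto
  then show ?thesis by (rule order.trans[OF kernel_integral_indicator_le[OF E \<epsilon>_pos \<zeta>_pos]])
qed

text \<open>The bound \<open>e (Suc l) \<le> 1 / 2\<close> absorbs the summand 1 of the density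
  bound into a second term \<open>1 / (2 * e (Suc l))\<close>.\<close>

lemma kernel_shell:
  assumes E: "E \<in> sets borel" and x: "x \<in> R (Suc l)" "x \<notin> R (Suc (Suc l))" and r: "e (Suc l) < \<epsilon> * z (Suc l)"
  shows "kernel_integral f \<zeta> \<epsilon> (indicator E) x \<le> ennreal (1 / e (Suc l)) * emeasure circle_lebesgue E"
proof -
  have "1 / (2 * (\<epsilon> * z (Suc l))) \<le> 1 / (2 * e (Suc l))"
    using r e(1)[of "Suc l"] \<epsilon>_pos z_pos[of "Suc l"] by (intro divide_left_mono) auto
  moreover have "1 \<le> 1 / (2 * e (Suc l))" using e(1,2)[of "Suc l"] by (simp add: le_divide_eq)
  moreover have "1 / (2 * e (Suc l)) + 1 / (2 * e (Suc l)) = 1 / e (Suc l)" by simp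
  ultimately have "1 + 1 / (2 * (\<epsilon> * \<zeta> x)) \<le> 1 / e (Suc l)" unfolding \<zeta>_eq[OF x] by linarith
  then have "ennreal (1 + 1 / (2 * (\<epsilon> * \<zeta> x))) * emeasure circle_lebesgue E \<le> ennreal (1 / e (Suc l)) * emeasure circle_lebesgue E"
    by (intro mult_right_mono ennreal_leI) auto
  then show ?thesis by (rule order.trans[OF kernel_integral_indicator_le[OF E \<epsilon>_pos \<zeta>_pos]])
qed

lemma landing_near:
  assumes E: "E \<in> sets borel"
  shows "(\<integral>\<^sup>+x. indicator (R (Suc (Suc l))) x * kernel_integral f \<zeta> \<epsilon> (indicator E) x \<partial>\<mu>)
    \<le> ennreal (2 * measure \<mu> (R (Suc (Suc l)))) * emeasure circle_lebesgue E"
proof -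
  interpret \<mu>: prob_space \<mu> by (rule \<mu>_prob)
  have "(\<integral>\<^sup>+x. indicator (R (Suc (Suc l))) x * kernel_integral f \<zeta> \<epsilon> (indicator E) x \<partial>\<mu>)
    \<le> (\<integral>\<^sup>+x. (ennreal 2 * emeasure circle_lebesgue E) * indicator (R (Suc (Suc l))) x \<partial>\<mu>)"
  proof (rule nn_integral_mono_AE)
    show "AE x in \<mu>. indicator (R (Suc (Suc l))) x * kernel_integral f \<zeta> \<epsilon> (indicator E) x
      \<le> (ennreal 2 * emeasure circle_lebesgue E) * indicator (R (Suc (Suc l))) x"
      using \<mu>_null_Inter
    proof eventually_elim
      case (elim x)
      then show ?case using kernel_near[OF E, of x] by (cases "x \<in> R (Suc (Suc l))") simp_all
    qed
  qed
  also have "\<dots> = (ennreal 2 * emeasure circle_lebesgue E) * emeasure \<mu> (R (Suc (Suc l)))"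
    by (rule nn_integral_cmult_indicator) simp
  also have "\<dots> = ennreal (2 * measure \<mu> (R (Suc (Suc l)))) * emeasure circle_lebesgue E"
    by (simp add: \<mu>.emeasure_eq_measure ennreal_mult mult_ac)
  finally show ?thesis .
qed

lemma landing_shell:
  assumes E: "E \<in> sets borel" and r: "e (Suc l) < \<epsilon> * z (Suc l)"
  shows "(\<integral>\<^sup>+x. indicator (R (Suc l)) x * kernel_integral f \<zeta> \<epsilon> (indicator E) x \<partial>\<mu>)
    \<le> ennreal (2 * measure \<mu> (R (Suc (Suc l))) + measure \<mu> (R (Suc l) - R (Suc (Suc l))) / e (Suc l)) * emeasure circle_lebesgue E"
proof -
  interpret \<mu>: prob_space \<mu> by (rule \<mu>_prob)
  let ?Q = "kernel_integral f \<zeta> \<epsilon> (indicator E)" and ?S = "R (Suc l) - R (Suc (Suc l))"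
  have [measurable]: "?Q \<in> borel_measurable borel"
    by (rule kernel_integral_measurable[OF f_borel \<zeta>_borel \<epsilon>_pos]) (use E in simp)
  have "(\<integral>\<^sup>+x. indicator (R (Suc l)) x * ?Q x \<partial>\<mu>)
    = (\<integral>\<^sup>+x. indicator (R (Suc (Suc l))) x * ?Q x + indicator ?S x * ?Q x \<partial>\<mu>)"
    using R_Suc[of "Suc l"] by (intro nn_integral_cong) (auto split: split_indicator)
  also have "\<dots> = (\<integral>\<^sup>+x. indicator (R (Suc (Suc l))) x * ?Q x \<partial>\<mu>) + (\<integral>\<^sup>+x. indicator ?S x * ?Q x \<partial>\<mu>)"
    by (rule nn_integral_add) measurable
  also have "(\<integral>\<^sup>+x. indicator ?S x * ?Q x \<partial>\<mu>)
    \<le> (\<integral>\<^sup>+x. (ennreal (1 / e (Suc l)) * emeasure circle_lebesgue E) * indicator ?S x \<partial>\<mu>)"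
  proof (rule nn_integral_mono)
    fix x
    show "indicator ?S x * ?Q x \<le> (ennreal (1 / e (Suc l)) * emeasure circle_lebesgue E) * indicator ?S x"
      using kernel_shell[OF E _ _ r, of x] by (cases "x \<in> ?S") simp_all
  qed
  also have "\<dots> = (ennreal (1 / e (Suc l)) * emeasure circle_lebesgue E) * emeasure \<mu> ?S"
    by (rule nn_integral_cmult_indicator) simp
  also have "\<dots> = ennreal (measure \<mu> ?S / e (Suc l)) * emeasure circle_lebesgue E"
    using e(1)[of "Suc l"] by (simp add: \<mu>.emeasure_eq_measure ennreal_mult[symmetric] mult_ac)
  finally have "(\<integral>\<^sup>+x. indicator (R (Suc l)) x * ?Q x \<partial>\<mu>) \<le>
      ennreal (2 * measure \<mu> (R (Suc (Suc l)))) * emeasure circle_lebesgue E + ennreal (measure \<mu> ?S / e (Suc l)) * emeasure circle_lebesgue E"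
    using landing_near[OF E] by (meson add_left_mono add_right_mono order.trans)
  also have "\<dots> = ennreal (2 * measure \<mu> (R (Suc (Suc l))) + measure \<mu> ?S / e (Suc l)) * emeasure circle_lebesgue E"
    using e(1)[of "Suc l"] by (simp add: ennreal_plus distrib_right)
  finally show ?thesis .
qed

text \<open>On the shell \<open>R (Suc l) - R (Suc (Suc l))\<close> the noise has amplitude \<open>\<epsilon> * z (Suc l) < 1\<close>. If it is at most
  \<open>e (Suc l)\<close>, the shell counts as weak noise; otherwise it counts as strong noise, and the resulting
  density of order \<open>1 / e (Suc l)\<close> is compensated by the small measure of the shell.\<close>

lemma renewal_near:
  assumes r: "\<epsilon> * z (Suc l) \<le> e (Suc l)"
  shows "renewal f \<nu> \<zeta> \<epsilon> \<mu> (R (Suc (Suc l))) (e (Suc l)) (2 * measure \<mu> (R (Suc (Suc l)))) (n (Suc l))"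
proof unfold_locales
  show "\<epsilon> * \<zeta> x \<le> e (Suc l)" if "x \<notin> R (Suc (Suc l))" for x
  proof -
    have "\<epsilon> * \<zeta> x \<le> \<epsilon> * z (Suc l)" using \<zeta>_le[OF that] \<epsilon>_pos by simp
    then show ?thesis using r by linarith
  qed
  show "\<exists>j<n (Suc l). y j \<in> R (Suc (Suc l))" if "\<forall>j<n (Suc l). dist (y (Suc j)) (f (y j)) \<le> e (Suc l)" for y
    using that by (rule hits)
qed (use \<zeta>_borel \<zeta>_pos \<epsilon>_pos stationary landing_near in auto)

lemma renewal_shell:
  assumes r: "e (Suc l) < \<epsilon> * z (Suc l)"
  shows "renewal f \<nu> \<zeta> \<epsilon> \<mu> (R (Suc l)) (e' (Suc l))
    (2 * measure \<mu> (R (Suc (Suc l))) + measure \<mu> (R (Suc l) - R (Suc (Suc l))) / e (Suc l)) (n (Suc l))"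
proof unfold_locales
  show "\<epsilon> * \<zeta> x \<le> e' (Suc l)" if "x \<notin> R (Suc l)" for x
  proof -
    have "\<epsilon> * \<zeta> x \<le> \<epsilon> * z l" using \<zeta>_le[OF that] \<epsilon>_pos by simp
    also have "\<epsilon> * z l = \<epsilon> * z (Suc l) * e' (Suc l)" using e'(1)[of "Suc l"] by (simp add: z.simps)
    also have "\<dots> \<le> 1 * e' (Suc l)" using e'(1)[of "Suc l"] \<epsilon>(2) by (intro mult_right_mono) auto
    finally show ?thesis by simp
  qed
  show "\<exists>j<n (Suc l). y j \<in> R (Suc l)" if y: "\<forall>j<n (Suc l). dist (y (Suc j)) (f (y j)) \<le> e' (Suc l)" for y
  proof -
    have "\<forall>j<n (Suc l). dist (y (Suc j)) (f (y j)) \<le> e (Suc l)"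
    proof (intro allI impI)
      fix j assume "j < n (Suc l)"
      then have "dist (y (Suc j)) (f (y j)) \<le> e' (Suc l)" using y by simp
      then show "dist (y (Suc j)) (f (y j)) \<le> e (Suc l)" using e'(2)[of "Suc l"] by linarith
    qed
    then have "\<exists>j<n (Suc l). y j \<in> R (Suc (Suc l))" by (rule hits)
    then show ?thesis using R_Suc by blast
  qed
  show "(\<integral>\<^sup>+x. indicator (R (Suc l)) x * kernel_integral f \<zeta> \<epsilon> (indicator E) x \<partial>\<mu>)
    \<le> ennreal (2 * measure \<mu> (R (Suc (Suc l))) + measure \<mu> (R (Suc l) - R (Suc (Suc l))) / e (Suc l)) * emeasure circle_lebesgue E"
    if "E \<in> sets borel" for E
    using that r by (rule landing_shell)
  show "2 * measure \<mu> (R (Suc (Suc l))) + measure \<mu> (R (Suc l) - R (Suc (Suc l))) / e (Suc l) \<ge> 0"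
    using e(1)[of "Suc l"] by simp
qed (use \<zeta>_borel \<zeta>_pos \<epsilon>_pos stationary in auto)

text \<open>Both cases come down to \<open>A \<le> 4 * measure \<mu> S\<close>. Together with
  \<open>measure \<mu> S \<le> 32 * K / n (Suc l)\<close> this makes \<open>n (Suc l) * A\<close> at
  most \<open>128 * K\<close>.\<close>

lemma stationary_bounds:
  assumes n: "real (n (Suc l)) \<ge> 16 * K"
  obtains S where "S \<in> sets borel" "\<And>x. x \<notin> S \<Longrightarrow> \<epsilon> * \<zeta> x \<le> e (Suc l)" "measure \<mu> S \<le> 32 * K / n (Suc l)"
    "\<And>B. B \<in> sets borel \<Longrightarrow> measure \<mu> B \<le> 128 * K * measure \<nu> (thicken (\<eta> (Suc l)) B)"
proof -
  note result = that
  interpret \<mu>: prob_space \<mu> by (rule \<mu>_prob)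
  have K1: "K \<ge> 1" using K_ge by linarith
  have n0: "real (n (Suc l)) > 0" using n K1 by linarith
  have final: thesis
    if ren: "renewal f \<nu> \<zeta> \<epsilon> \<mu> S e\<^sub>0 A (n (Suc l))" and sh: "shadows e\<^sub>0 (n (Suc l)) (\<eta> (Suc l))" "e\<^sub>0 \<le> e (Suc l)"
      and A: "A \<le> 4 * measure \<mu> S" and S: "S \<subseteq> R (Suc l)" for S e\<^sub>0 A
  proof -
    interpret renewal f \<nu> \<zeta> \<epsilon> \<mu> S e\<^sub>0 A "n (Suc l)" by (rule ren)
    have "n (Suc l) * measure \<nu> (thicken (\<eta> (Suc l)) S) \<le> n (Suc l) * measure \<nu> (thicken (\<eta> (Suc l)) (R (Suc l)))"
      by (intro mult_left_mono \<nu>.finite_measure_mono thicken_mono S) auto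
    also have "\<dots> \<le> K" unfolding K_def by (rule thicken_R)
    finally have S_le: "measure \<mu> S \<le> 32 * K / n (Suc l)" by (rule stationary_R_le'[OF sh(1) A K1 _ n])
    have "measure \<mu> B \<le> 128 * K * measure \<nu> (thicken (\<eta> (Suc l)) B)" if "B \<in> sets borel" for B
    proof -
      have "n (Suc l) * A \<le> n (Suc l) * (4 * (32 * K / n (Suc l)))"
        using A S_le by (intro mult_left_mono) auto
      also have "\<dots> = 128 * K" using n0 by simp
      finally have "n (Suc l) * A * measure \<nu> (thicken (\<eta> (Suc l)) B) \<le> 128 * K * measure \<nu> (thicken (\<eta> (Suc l)) B)"
        by (intro mult_right_mono) auto
      then show ?thesis using stationary_le[OF sh(1) that] by linarith
    qed
    moreover have "\<epsilon> * \<zeta> x \<le> e (Suc l)" if "x \<notin> S" for x using off[OF that] sh(2) by linarith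
    ultimately show thesis using S_le by (intro result[of S] R_borel)
  qed
  show thesis
  proof (cases "\<epsilon> * z (Suc l) \<le> e (Suc l)")
    case True
    show thesis by (rule final[OF renewal_near[OF True]]) (use e R_Suc in auto)
  next
    case False
    then have r: "e (Suc l) < \<epsilon> * z (Suc l)" by simp
    let ?S = "R (Suc l) - R (Suc (Suc l))"
    define A where "A = 2 * measure \<mu> (R (Suc (Suc l))) + measure \<mu> ?S / e (Suc l)"
    note ren = renewal_shell[OF r, folded A_def]
    interpret r: renewal f \<nu> \<zeta> \<epsilon> \<mu> "R (Suc l)" "e' (Suc l)" A "n (Suc l)" by (rule ren)
    \<comment> \<open>The estimate for the shell involves \<open>A\<close> again:
      \<open>n (Suc l)\<close> times the \<open>\<nu>\<close>-measure of the thickened shell is at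
      most \<open>e (Suc l) / 2\<close>, so the term of the shell in \<open>A\<close> is at most
      \<open>A / 2\<close> and can be absorbed.\<close>
    have "measure \<mu> ?S \<le> n (Suc l) * A * measure \<nu> (thicken (\<delta> (Suc l)) ?S)"
      by (rule r.stationary_le[OF e'(3)]) simp
    also have "\<dots> = A * (n (Suc l) * measure \<nu> (thicken (\<delta> (Suc l)) ?S))" by simp
    also have "\<dots> \<le> A * (e (Suc l) / 2)" by (intro mult_left_mono thicken_diff r.A_nonneg)
    finally have "measure \<mu> ?S / e (Suc l) \<le> A / 2" using e(1)[of "Suc l"] by (simp add: divide_le_eq)
    moreover have "A = 2 * measure \<mu> (R (Suc (Suc l))) + measure \<mu> ?S / e (Suc l)" by (rule A_def)
    ultimately have "A \<le> 4 * measure \<mu> (R (Suc (Suc l)))" by argo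
    also have "\<dots> \<le> 4 * measure \<mu> (R (Suc l))"
      using \<mu>.finite_measure_mono[OF R_Suc[of "Suc l"]] by simp
    finally show thesis
      by (intro final[OF ren]) (use e'(2) shadows_mono[OF e(3)] in auto)
  qed
qed

end

end

section \<open>The zero noise limit\<close>

context dominated_circle_map
begin

text \<open>No inequality between \<open>e\<close> and \<open>\<eta>\<close> is recorded; shadowing
  of a pseudo-orbit with a single step replaces it.\<close>

lemma shadows_one_step:
  assumes "shadows e n \<eta>" "n > 0" "dist y (f x) \<le> e"
  shows "dist y (f x) < \<eta>"
proof -
  define s :: "nat \<Rightarrow> circle" where "s j = (if j = 0 then x else y)" for j
  have "\<forall>j<1. dist (s (Suc j)) (f (s j)) \<le> e" using assms(3) by (simp add: s_def)
  then have "dist (s 1) ((f ^^ 1) (s 0)) < \<eta>"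
    using assms(1)[unfolded shadows_def, rule_format, of 1 s] assms(2) by simp
  then show ?thesis by (simp add: s_def)
qed

end

context noisy_tower
begin

text \<open>The scale is read off from the least \<open>k\<close> with
  \<open>1 \<le> \<epsilon> * z k\<close>, which exceeds \<open>Suc L\<close> once
  \<open>\<epsilon> < 1 / z (Suc L)\<close>.\<close>

lemma eventually_scale:
  "\<forall>\<^sub>F \<epsilon> in at_right 0. \<exists>l\<ge>L. 1 \<le> \<epsilon> * z (Suc (Suc l)) \<and> \<epsilon> * z (Suc l) < 1"
proof -
  have "\<forall>\<^sub>F \<epsilon> in at_right 0. \<epsilon> \<in> {0<..<1 / z (Suc L)}"
    by (rule eventually_at_right_real) (simp add: z_pos)
  then show ?thesis
  proof eventually_elim
    case (elim \<epsilon>)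
    define k where "k = (LEAST k. 1 \<le> \<epsilon> * z k)"
    have L: "\<epsilon> * z (Suc L) < 1" using elim z_pos[of "Suc L"] by (simp add: pos_less_divide_eq)
    obtain m :: nat where m: "1 / \<epsilon> < m" using reals_Archimedean2 by blast
    have "1 / \<epsilon> \<le> z m" using m z_ge[of m] by linarith
    then have "1 \<le> \<epsilon> * z m" using elim by (simp add: divide_le_eq mult.commute)
    then have k: "1 \<le> \<epsilon> * z k" unfolding k_def by (rule LeastI)
    have "Suc L < k"
    proof (rule ccontr)
      assume "\<not> Suc L < k"
      then have "\<epsilon> * z k \<le> \<epsilon> * z (Suc L)" using elim z_mono[of k "Suc L"] by simp
      then show False using k L by linarith
    qed
    then obtain l where l: "k = Suc (Suc l)" "L \<le> l" by (metis Suc_le_eq Suc_le_D Suc_le_mono)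
    have "Suc l < (LEAST k. 1 \<le> \<epsilon> * z k)" using l(1) unfolding k_def[symmetric] by simp
    then have "\<not> 1 \<le> \<epsilon> * z (Suc l)" by (rule not_less_Least)
    then show ?case using l k by (intro exI[of _ l]) auto
  qed
qed

lemma eventually_stationary_bounds:
  assumes \<tau>: "\<tau> > 0"
  shows "\<forall>\<^sub>F \<epsilon> in at_right 0. \<forall>\<mu>. stationary_measure f \<zeta> \<epsilon> \<mu> \<longrightarrow>
    (\<exists>S\<in>sets borel. (\<forall>x. \<forall>y. x \<notin> S \<longrightarrow> dist y (f x) \<le> \<epsilon> * \<zeta> x \<longrightarrow> dist y (f x) < \<tau>) \<and> measure \<mu> S \<le> \<tau> \<and>
      (\<forall>B\<in>sets borel. measure \<mu> B \<le> 128 * K * measure \<nu> (thicken \<tau> B)))"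
proof -
  have K: "K > 0" using K_ge by linarith
  have nt: "filterlim (\<lambda>l. real (n l)) at_top sequentially"
    by (rule filterlim_compose[OF filterlim_real_sequentially n_top])
  have "\<forall>\<^sub>F l in sequentially. \<eta> l < \<tau>" using \<eta>_0 \<tau> by (rule order_tendstoD)
  moreover have "\<forall>\<^sub>F l in sequentially. max (16 * K) (32 * K / \<tau>) \<le> n l"
    using nt[unfolded filterlim_at_top] by blast
  ultimately have "\<forall>\<^sub>F l in sequentially. \<eta> l < \<tau> \<and> max (16 * K) (32 * K / \<tau>) \<le> n l"
    by eventually_elim simp
  then obtain L where L: "\<And>l. l \<ge> L \<Longrightarrow> \<eta> l < \<tau> \<and> max (16 * K) (32 * K / \<tau>) \<le> n l"
    unfolding eventually_sequentially by blast
  have "\<forall>\<^sub>F \<epsilon> in at_right (0 :: real). \<epsilon> > 0" by (rule eventually_at_right_less)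
  with eventually_scale[of L] show ?thesis
  proof eventually_elim
    case (elim \<epsilon>)
    then obtain l where l: "l \<ge> L" "1 \<le> \<epsilon> * z (Suc (Suc l))" "\<epsilon> * z (Suc l) < 1" by blast
    have "\<eta> (Suc l) < \<tau> \<and> max (16 * K) (32 * K / \<tau>) \<le> n (Suc l)" using l(1) by (intro L) simp
    then have \<eta>\<tau>: "\<eta> (Suc l) < \<tau>" and n16: "16 * K \<le> n (Suc l)" and n32: "32 * K / \<tau> \<le> n (Suc l)" by simp_all
    have n0: "n (Suc l) > 0" using n16 K by (cases "n (Suc l)") auto
    show ?case
    proof (intro allI impI)
      fix \<mu> assume st: "stationary_measure f \<zeta> \<epsilon> \<mu>"
      obtain S where S: "S \<in> sets borel" "\<And>x. x \<notin> S \<Longrightarrow> \<epsilon> * \<zeta> x \<le> e (Suc l)" "measure \<mu> S \<le> 32 * K / n (Suc l)"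
        "\<And>B. B \<in> sets borel \<Longrightarrow> measure \<mu> B \<le> 128 * K * measure \<nu> (thicken (\<eta> (Suc l)) B)"
        by (rule stationary_bounds[OF elim(2) st l(2,3) n16], rule that)
      have "dist y (f x) < \<tau>" if x: "x \<notin> S" "dist y (f x) \<le> \<epsilon> * \<zeta> x" for x y
      proof -
        have "dist y (f x) \<le> e (Suc l)" using x(2) S(2)[OF x(1)] by linarith
        then have "dist y (f x) < \<eta> (Suc l)" by (rule shadows_one_step[OF e(3) n0])
        then show ?thesis using \<eta>\<tau> by linarith
      qed
      moreover have "measure \<mu> S \<le> \<tau>"
      proof -
        have "32 * K / n (Suc l) \<le> \<tau>" using n32 \<tau> n0 by (simp add: divide_le_eq mult.commute)
        then show ?thesis using S(3) by linarith
      qed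
      moreover have "measure \<mu> B \<le> 128 * K * measure \<nu> (thicken \<tau> B)" if B: "B \<in> sets borel" for B
      proof -
        have "128 * K * measure \<nu> (thicken (\<eta> (Suc l)) B) \<le> 128 * K * measure \<nu> (thicken \<tau> B)"
          using K \<eta>\<tau> by (intro mult_left_mono \<nu>.finite_measure_mono thicken_mono) auto
        then show ?thesis using S(4)[OF B] by linarith
      qed
      ultimately show "\<exists>S\<in>sets borel. (\<forall>x. \<forall>y. x \<notin> S \<longrightarrow> dist y (f x) \<le> \<epsilon> * \<zeta> x \<longrightarrow> dist y (f x) < \<tau>) \<and> measure \<mu> S \<le> \<tau> \<and>
          (\<forall>B\<in>sets borel. measure \<mu> B \<le> 128 * K * measure \<nu> (thicken \<tau> B))"
        using S(1) by (intro bexI[of _ S]) auto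
    qed
  qed
qed

text \<open>Off \<open>S\<close> a noisy step ends \<open>d\<close>-close to \<open>f x\<close>,
  which costs \<open>\<tau>\<close>; on \<open>S\<close>, of measure at most
  \<open>\<kappa>\<close>, the trivial bound \<open>2 * C\<close> is used.\<close>

lemma stationary_almost_invariant:
  fixes \<phi> :: "circle \<Rightarrow> real"
  assumes \<phi>: "continuous_on UNIV \<phi>" and C: "\<And>x. \<bar>\<phi> x\<bar> \<le> C" and d0: "d > 0" and d: "\<And>a b. dist a b < d \<Longrightarrow> \<bar>\<phi> a - \<phi> b\<bar> \<le> \<tau>"
    and \<epsilon>: "\<epsilon> > 0" and st: "stationary_measure f \<zeta> \<epsilon> \<mu>" and S: "S \<in> sets borel" "measure \<mu> S \<le> \<kappa>"
    and near: "\<And>x y. x \<notin> S \<Longrightarrow> dist y (f x) \<le> \<epsilon> * \<zeta> x \<Longrightarrow> dist y (f x) < d"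
  shows "\<bar>(\<integral>x. \<phi> x \<partial>\<mu>) - (\<integral>x. \<phi> (f x) \<partial>\<mu>)\<bar> \<le> \<tau> + 2 * C * \<kappa>"
proof -
  interpret \<mu>: prob_space \<mu> using st by (simp add: stationary_measure_def circle_prob_def)
  have \<mu>_sets [simp, measurable_cong]: "sets \<mu> = sets borel"
    using st by (simp add: stationary_measure_def circle_prob_def)
  interpret N: prob_space "noise \<epsilon>" by (rule prob_space_noise[OF \<epsilon>])
  have [measurable]: "\<phi> \<in> borel_measurable borel" by (rule borel_measurable_continuous_onI[OF \<phi>])
  have C0: "C \<ge> 0" using C[of 0] by linarith
  have [measurable]: "(\<lambda>x. perturbed_map f \<zeta> t x) \<in> borel_measurable borel" for t
    unfolding perturbed_map_def by measurable
  note [measurable] = S(1) f_borel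
  have bounded_int: "integrable \<mu> (\<lambda>x. \<phi> (g x))" if "g \<in> borel_measurable borel" for g
  proof (rule \<mu>.integrable_const_bound[where B = C])
    show "(\<lambda>x. \<phi> (g x)) \<in> borel_measurable \<mu>"
      unfolding measurable_cong_sets[OF \<mu>_sets refl] using that by measurable
  qed (simp add: C)
  have int: "integrable \<mu> (\<lambda>x. \<phi> (perturbed_map f \<zeta> t x))" "integrable \<mu> (\<lambda>x. \<phi> (f x))" for t
    by (rule bounded_int, measurable)+
  have inner: "\<bar>(\<integral>x. \<phi> (perturbed_map f \<zeta> t x) \<partial>\<mu>) - (\<integral>x. \<phi> (f x) \<partial>\<mu>)\<bar> \<le> \<tau> + 2 * C * \<kappa>" if t: "\<bar>t\<bar> < \<epsilon>" for t
  proof -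
    have pt: "\<bar>\<phi> (perturbed_map f \<zeta> t x) - \<phi> (f x)\<bar> \<le> \<tau> * indicator (- S) x + 2 * C * indicator S x" for x
    proof (cases "x \<in> S")
      case True
      then show ?thesis using C[of "perturbed_map f \<zeta> t x"] C[of "f x"] by simp
    next
      case False
      have "dist (perturbed_map f \<zeta> t x) (f x) \<le> \<bar>t * \<zeta> x\<bar>"
        unfolding perturbed_map_def by (rule dist_add_to_circle_le)
      also have "\<dots> \<le> \<epsilon> * \<zeta> x" using t \<zeta>_pos[of x] by (simp add: abs_mult)
      finally have "dist (perturbed_map f \<zeta> t x) (f x) < d" by (rule near[OF False])
      then show ?thesis using d False by simp
    qed
    have intb: "integrable \<mu> (\<lambda>x. \<tau> * indicator (- S) x + 2 * C * indicator S x :: real)"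
      by (intro Bochner_Integration.integrable_add integrable_mult_right integrable_real_indicator)
         (auto simp: \<mu>.emeasure_eq_measure)
    have "\<bar>(\<integral>x. \<phi> (perturbed_map f \<zeta> t x) \<partial>\<mu>) - (\<integral>x. \<phi> (f x) \<partial>\<mu>)\<bar>
      = \<bar>(\<integral>x. \<phi> (perturbed_map f \<zeta> t x) - \<phi> (f x) \<partial>\<mu>)\<bar>"
      using int by simp
    also have "\<dots> \<le> (\<integral>x. \<bar>\<phi> (perturbed_map f \<zeta> t x) - \<phi> (f x)\<bar> \<partial>\<mu>)"
      by (rule integral_abs_bound)
    also have "\<dots> \<le> (\<integral>x. \<tau> * indicator (- S) x + 2 * C * indicator S x \<partial>\<mu>)"
      by (intro integral_mono pt intb integrable_abs Bochner_Integration.integrable_diff int)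
    also have "\<dots> = \<tau> * measure \<mu> (- S) + 2 * C * measure \<mu> S"
      by (subst Bochner_Integration.integral_add)
         (auto intro!: integrable_mult_right integrable_real_indicator simp: \<mu>.emeasure_eq_measure)
    also have "\<tau> * measure \<mu> (- S) \<le> \<tau> * 1" using d[of 0 0] d0 by (intro mult_left_mono) auto
    also have "2 * C * measure \<mu> S \<le> 2 * C * \<kappa>" using S(2) C0 by (intro mult_left_mono) auto
    finally show ?thesis by simp
  qed
  let ?g = "\<lambda>t. \<integral>x. \<phi> (perturbed_map f \<zeta> t x) \<partial>\<mu>" and ?c = "\<integral>x. \<phi> (f x) \<partial>\<mu>"
  have [measurable]: "(\<lambda>(t, x). perturbed_map f \<zeta> t x) \<in> borel_measurable (noise \<epsilon> \<Otimes>\<^sub>M \<mu>)"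
    by (rule perturbed_map_measurable[OF f_borel \<zeta>_borel \<epsilon>]) simp
  have g [measurable]: "?g \<in> borel_measurable (noise \<epsilon>)" by measurable
  have gint: "integrable (noise \<epsilon>) ?g"
  proof (rule N.integrable_const_bound[where B = "\<bar>?c\<bar> + (\<tau> + 2 * C * \<kappa>)"])
    show "AE t in noise \<epsilon>. norm (?g t) \<le> \<bar>?c\<bar> + (\<tau> + 2 * C * \<kappa>)"
      using AE_noise[of \<epsilon>]
    proof eventually_elim
      case (elim t)
      show ?case using inner[OF elim] unfolding real_norm_def by linarith
    qed
  qed (rule g)
  have "(\<integral>x. \<phi> x \<partial>\<mu>) = (\<integral>t. ?g t \<partial>noise \<epsilon>)"
    using st \<phi> by (simp add: stationary_measure_def)
  then have "\<bar>(\<integral>x. \<phi> x \<partial>\<mu>) - ?c\<bar> = \<bar>\<integral>t. ?g t - ?c \<partial>noise \<epsilon>\<bar>"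
    using gint N.prob_space by simp
  also have "\<dots> \<le> (\<integral>t. \<bar>?g t - ?c\<bar> \<partial>noise \<epsilon>)" by (rule integral_abs_bound)
  also have "\<dots> \<le> (\<integral>t. \<tau> + 2 * C * \<kappa> \<partial>noise \<epsilon>)"
  proof (rule integral_mono_AE)
    show "AE t in noise \<epsilon>. \<bar>?g t - ?c\<bar> \<le> \<tau> + 2 * C * \<kappa>"
      using AE_noise[of \<epsilon>] by eventually_elim (rule inner)
  qed (use gint in \<open>auto intro!: integrable_abs\<close>)
  also have "\<dots> = \<tau> + 2 * C * \<kappa>" using N.prob_space by simp
  finally show ?thesis .
qed

section \<open>Accumulation points of stationary measures\<close>

context
  fixes \<mu> :: "real \<Rightarrow> circle measure" and \<mu>\<^sub>0 :: "circle measure"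
  assumes stationary: "\<forall>\<^sub>F \<epsilon> in at_right 0. stationary_measure f \<zeta> \<epsilon> (\<mu> \<epsilon>)"
    and accumulation: "weak_star_accumulation_point \<mu> \<mu>\<^sub>0"
begin

lemma limit_sets [simp, measurable_cong]: "sets \<mu>\<^sub>0 = sets borel"
  using accumulation by (simp add: weak_star_accumulation_point_def circle_prob_def)

lemma limit_prob: "prob_space \<mu>\<^sub>0"
  using accumulation by (simp add: weak_star_accumulation_point_def circle_prob_def)

text \<open>Weak closeness holds for arbitrarily small \<open>\<epsilon>\<close>, stationarity and
  its bounds for all small \<open>\<epsilon>\<close>, so some \<open>\<epsilon>\<close> has
  both.\<close>

lemma accumulate:
  assumes "finite \<Phi>" "\<And>\<phi>. \<phi> \<in> \<Phi> \<Longrightarrow> continuous_on UNIV \<phi>" "\<tau> > 0"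
  obtains \<epsilon> S where "\<epsilon> > 0" "stationary_measure f \<zeta> \<epsilon> (\<mu> \<epsilon>)"
    "\<And>\<phi>. \<phi> \<in> \<Phi> \<Longrightarrow> \<bar>(\<integral>x. \<phi> x \<partial>\<mu> \<epsilon>) - (\<integral>x. \<phi> x \<partial>\<mu>\<^sub>0)\<bar> < \<tau>"
    "S \<in> sets borel" "\<And>x y. x \<notin> S \<Longrightarrow> dist y (f x) \<le> \<epsilon> * \<zeta> x \<Longrightarrow> dist y (f x) < \<tau>" "measure (\<mu> \<epsilon>) S \<le> \<tau>"
    "\<And>B. B \<in> sets borel \<Longrightarrow> measure (\<mu> \<epsilon>) B \<le> 128 * K * measure \<nu> (thicken \<tau> B)"
proof -
  have "\<exists>\<^sub>F \<epsilon> in at_right 0. \<forall>\<phi>\<in>\<Phi>. \<bar>(\<integral>x. \<phi> x \<partial>\<mu> \<epsilon>) - (\<integral>x. \<phi> x \<partial>\<mu>\<^sub>0)\<bar> < \<tau>"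
    using accumulation assms unfolding weak_star_accumulation_point_def by blast
  moreover have "\<forall>\<^sub>F \<epsilon> in at_right (0 :: real). \<epsilon> > 0" by (rule eventually_at_right_less)
  then have "\<forall>\<^sub>F \<epsilon> in at_right 0. \<epsilon> > 0 \<and> stationary_measure f \<zeta> \<epsilon> (\<mu> \<epsilon>) \<and>
    (\<forall>\<mu>. stationary_measure f \<zeta> \<epsilon> \<mu> \<longrightarrow>
    (\<exists>S\<in>sets borel. (\<forall>x. \<forall>y. x \<notin> S \<longrightarrow> dist y (f x) \<le> \<epsilon> * \<zeta> x \<longrightarrow> dist y (f x) < \<tau>) \<and> measure \<mu> S \<le> \<tau> \<and>
      (\<forall>B\<in>sets borel. measure \<mu> B \<le> 128 * K * measure \<nu> (thicken \<tau> B))))"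
    using stationary eventually_stationary_bounds[OF assms(3)] by eventually_elim (intro conjI)
  ultimately have "\<exists>\<^sub>F \<epsilon> in at_right 0. (\<forall>\<phi>\<in>\<Phi>. \<bar>(\<integral>x. \<phi> x \<partial>\<mu> \<epsilon>) - (\<integral>x. \<phi> x \<partial>\<mu>\<^sub>0)\<bar> < \<tau>) \<and>
    \<epsilon> > 0 \<and> stationary_measure f \<zeta> \<epsilon> (\<mu> \<epsilon>) \<and>
    (\<forall>\<mu>. stationary_measure f \<zeta> \<epsilon> \<mu> \<longrightarrow>
    (\<exists>S\<in>sets borel. (\<forall>x. \<forall>y. x \<notin> S \<longrightarrow> dist y (f x) \<le> \<epsilon> * \<zeta> x \<longrightarrow> dist y (f x) < \<tau>) \<and> measure \<mu> S \<le> \<tau> \<and>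
      (\<forall>B\<in>sets borel. measure \<mu> B \<le> 128 * K * measure \<nu> (thicken \<tau> B))))"
    by (rule frequently_eventually_frequently)
  then obtain \<epsilon> where \<epsilon>: "\<forall>\<phi>\<in>\<Phi>. \<bar>(\<integral>x. \<phi> x \<partial>\<mu> \<epsilon>) - (\<integral>x. \<phi> x \<partial>\<mu>\<^sub>0)\<bar> < \<tau>" "\<epsilon> > 0"
    and st: "stationary_measure f \<zeta> \<epsilon> (\<mu> \<epsilon>)" and
    ex: "\<forall>\<mu>. stationary_measure f \<zeta> \<epsilon> \<mu> \<longrightarrow>
    (\<exists>S\<in>sets borel. (\<forall>x. \<forall>y. x \<notin> S \<longrightarrow> dist y (f x) \<le> \<epsilon> * \<zeta> x \<longrightarrow> dist y (f x) < \<tau>) \<and> measure \<mu> S \<le> \<tau> \<and>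
      (\<forall>B\<in>sets borel. measure \<mu> B \<le> 128 * K * measure \<nu> (thicken \<tau> B)))"
    by (auto dest: frequently_ex)
  obtain S where S: "S \<in> sets borel" "\<forall>x. \<forall>y. x \<notin> S \<longrightarrow> dist y (f x) \<le> \<epsilon> * \<zeta> x \<longrightarrow> dist y (f x) < \<tau>"
      "measure (\<mu> \<epsilon>) S \<le> \<tau>" "\<forall>B\<in>sets borel. measure (\<mu> \<epsilon>) B \<le> 128 * K * measure \<nu> (thicken \<tau> B)"
    using ex[rule_format, OF st] by (elim bexE conjE)
  show ?thesis by (rule that[OF \<epsilon>(2) st _ S(1) _ S(3)]) (use \<epsilon>(1) S(2,4) in auto)
qed

text \<open>A tent function lies between the indicators of \<open>B\<close> and of
  \<open>thicken s B\<close>, so weak closeness transfers the bound by \<open>\<nu>\<close> to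
  \<open>\<mu>\<^sub>0\<close>. That bound thickens once more, hence
  \<open>s = \<eta>\<^sub>0 / 2\<close>. As \<open>B\<close> is closed and null, its small
  neighbourhoods have small \<open>\<nu>\<close>-measure.\<close>

lemma limit_closed_null:
  assumes B: "closed B" "emeasure circle_lebesgue B = 0"
  shows "measure \<mu>\<^sub>0 B = 0"
proof (cases "B = {}")
  case False
  interpret \<mu>\<^sub>0: prob_space \<mu>\<^sub>0 by (rule limit_prob)
  have K: "K > 0" using K_ge by linarith
  have Bb [measurable]: "B \<in> sets borel" using B(1) by simp
  have \<nu>B: "measure \<nu> (closure B) = 0" using null_\<nu>[OF Bb B(2)] B(1) by simp
  have "measure \<mu>\<^sub>0 B \<le> (128 * K + 1) * \<kappa>" if \<kappa>: "\<kappa> > 0" for \<kappa>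
  proof -
    obtain \<eta>\<^sub>0 where \<eta>\<^sub>0: "\<eta>\<^sub>0 > 0" "measure \<nu> (thicken \<eta>\<^sub>0 B) \<le> \<kappa>"
      using measure_thicken[OF \<kappa>, of B] \<nu>B by auto
    define s where "s = \<eta>\<^sub>0 / 2"
    have s: "s > 0" using \<eta>\<^sub>0 by (simp add: s_def)
    define \<phi> where "\<phi> x = max 0 (1 - infdist x B / s)" for x
    have \<phi>: "continuous_on UNIV \<phi>" unfolding \<phi>_def using s by (intro continuous_intros) auto
    have [measurable]: "\<phi> \<in> borel_measurable borel" by (rule borel_measurable_continuous_onI[OF \<phi>])
    have \<phi>1: "0 \<le> \<phi> x" "\<phi> x \<le> 1" for x using s infdist_nonneg[of x B] by (auto simp: \<phi>_def)
    have lo: "indicator B x \<le> \<phi> x" for x using \<phi>1[of x] by (auto simp: \<phi>_def split: split_indicator)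
    have hi: "\<phi> x \<le> indicator (thicken s B) x" for x
    proof (cases "x \<in> thicken s B")
      case False
      have "s \<le> infdist x B"
        unfolding infdist_notempty[OF \<open>B \<noteq> {}\<close>]
        by (rule cINF_greatest[OF \<open>B \<noteq> {}\<close>]) (use False in \<open>auto simp: mem_thicken not_less\<close>)
      then show ?thesis using False s by (simp add: \<phi>_def)
    qed (use \<phi>1 in simp)
    obtain \<epsilon> S where \<epsilon>: "\<epsilon> > 0" "stationary_measure f \<zeta> \<epsilon> (\<mu> \<epsilon>)"
      "\<And>\<psi>. \<psi> \<in> {\<phi>} \<Longrightarrow> \<bar>(\<integral>x. \<psi> x \<partial>\<mu> \<epsilon>) - (\<integral>x. \<psi> x \<partial>\<mu>\<^sub>0)\<bar> < min s \<kappa>"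
      "S \<in> sets borel" "\<And>x y. x \<notin> S \<Longrightarrow> dist y (f x) \<le> \<epsilon> * \<zeta> x \<Longrightarrow> dist y (f x) < min s \<kappa>"
      "measure (\<mu> \<epsilon>) S \<le> min s \<kappa>"
      "\<And>B. B \<in> sets borel \<Longrightarrow> measure (\<mu> \<epsilon>) B \<le> 128 * K * measure \<nu> (thicken (min s \<kappa>) B)"
    proof (rule accumulate[of "{\<phi>}" "min s \<kappa>"])
      show "continuous_on UNIV \<psi>" if "\<psi> \<in> {\<phi>}" for \<psi> using that \<phi> by auto
      show "0 < min s \<kappa>" using s \<kappa> by simp
    qed (simp, rule that)
    interpret \<mu>\<^sub>\<epsilon>: prob_space "\<mu> \<epsilon>" using \<epsilon>(2) by (simp add: stationary_measure_def circle_prob_def)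
    have \<mu>\<^sub>\<epsilon>_sets: "sets (\<mu> \<epsilon>) = sets borel"
      using \<epsilon>(2) by (simp add: stationary_measure_def circle_prob_def)
    have "thicken (min s \<kappa>) (thicken s B) \<subseteq> thicken \<eta>\<^sub>0 B"
    proof
      fix x assume "x \<in> thicken (min s \<kappa>) (thicken s B)"
      then obtain y b where yb: "b \<in> B" "dist y b < s" "dist x y < min s \<kappa>" by (auto simp: mem_thicken)
      have "dist x b < \<eta>\<^sub>0" using yb(2,3) dist_triangle[of x b y] unfolding s_def by linarith
      then show "x \<in> thicken \<eta>\<^sub>0 B" using yb(1) by (auto simp: mem_thicken)
    qed
    then have "measure \<nu> (thicken (min s \<kappa>) (thicken s B)) \<le> measure \<nu> (thicken \<eta>\<^sub>0 B)"
      by (rule \<nu>.finite_measure_mono) simp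
    then have "measure \<nu> (thicken (min s \<kappa>) (thicken s B)) \<le> \<kappa>" using \<eta>\<^sub>0(2) by linarith
    then have b: "128 * K * measure \<nu> (thicken (min s \<kappa>) (thicken s B)) \<le> 128 * K * \<kappa>"
      using K by (intro mult_left_mono) auto
    have "measure \<mu>\<^sub>0 B = (\<integral>x. indicator B x \<partial>\<mu>\<^sub>0)" by simp
    also have "\<dots> \<le> (\<integral>x. \<phi> x \<partial>\<mu>\<^sub>0)"
      by (intro integral_mono lo \<mu>\<^sub>0.integrable_const_bound[where B = 1];
          (unfold measurable_cong_sets[OF limit_sets refl])?; auto simp: \<phi>1 split: split_indicator)
    also have "\<dots> \<le> (\<integral>x. \<phi> x \<partial>\<mu> \<epsilon>) + \<kappa>" using \<epsilon>(3)[of \<phi>] by auto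
    also have "(\<integral>x. \<phi> x \<partial>\<mu> \<epsilon>) \<le> (\<integral>x. indicator (thicken s B) x \<partial>\<mu> \<epsilon>)"
      by (intro integral_mono hi \<mu>\<^sub>\<epsilon>.integrable_const_bound[where B = 1];
          (unfold measurable_cong_sets[OF \<mu>\<^sub>\<epsilon>_sets refl])?; auto simp: \<phi>1 split: split_indicator)
    also have "\<dots> = measure (\<mu> \<epsilon>) (thicken s B)" 
      by (subst Bochner_Integration.integral_indicator) (simp add: sets_eq_imp_space_eq[OF \<mu>\<^sub>\<epsilon>_sets])
    also have "\<dots> \<le> 128 * K * \<kappa>" using \<epsilon>(7)[OF thicken_borel, of s B] b by linarith
    finally show ?thesis by (simp add: distrib_right)
  qed
  then have "measure \<mu>\<^sub>0 B / (128 * K + 1) \<le> \<kappa>" if "\<kappa> > 0" for \<kappa>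
    using that K by (simp add: pos_divide_le_eq mult.commute)
  then have "measure \<mu>\<^sub>0 B / (128 * K + 1) \<le> 0" by (rule field_le_epsilon[of _ 0, simplified])
  then have "measure \<mu>\<^sub>0 B \<le> 0" using K by (simp add: divide_le_0_iff)
  then show ?thesis using measure_nonneg[of \<mu>\<^sub>0 B] by linarith
qed simp

text \<open>The weak limit argument concerns closed sets; inner regularity extends it to Borel null
  sets.\<close>

lemma limit_ac: "absolutely_continuous circle_lebesgue \<mu>\<^sub>0"
  unfolding absolutely_continuous_def
proof
  interpret \<mu>\<^sub>0: prob_space \<mu>\<^sub>0 by (rule limit_prob)
  fix A assume "A \<in> null_sets circle_lebesgue"
  then have A: "A \<in> sets borel" "emeasure circle_lebesgue A = 0" by auto
  have "emeasure \<mu>\<^sub>0 A = (SUP K \<in> {K. K \<subseteq> A \<and> compact K}. emeasure \<mu>\<^sub>0 K)"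
    by (rule inner_regular) (use A in simp_all)
  also have "\<dots> \<le> 0"
  proof (rule SUP_least)
    fix C assume "C \<in> {K. K \<subseteq> A \<and> compact K}"
    then have C: "C \<subseteq> A" "closed C" using compact_imp_closed by auto
    have "emeasure circle_lebesgue C \<le> emeasure circle_lebesgue A"
      by (intro emeasure_mono C) (use A in simp)
    then have "emeasure circle_lebesgue C = 0" using A(2) by simp
    then have "measure \<mu>\<^sub>0 C = 0" by (rule limit_closed_null[OF C(2)])
    then show "emeasure \<mu>\<^sub>0 C \<le> 0" by (simp add: \<mu>\<^sub>0.emeasure_eq_measure)
  qed
  finally show "A \<in> null_sets \<mu>\<^sub>0" using A(1) by auto
qed

text \<open>The constant \<open>3 + 2 * C\<close> collects two weak approximation errors, for
  \<open>\<phi>\<close> and for \<open>\<phi>\<close> after \<open>f\<close>, and the defect of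
  invariance of \<open>\<mu> \<epsilon>\<close>.\<close>

lemma limit_invariant: "invariant_measure f \<mu>\<^sub>0"
  unfolding invariant_measure_def
proof (rule circle_measure_eqI)
  interpret \<mu>\<^sub>0: prob_space \<mu>\<^sub>0 by (rule limit_prob)
  show "finite_measure (distr \<mu>\<^sub>0 borel f)" 
    by (rule \<mu>\<^sub>0.finite_measure_distr) (unfold measurable_cong_sets[OF limit_sets refl], rule f_borel)
  show "finite_measure \<mu>\<^sub>0" by unfold_locales
  fix \<phi> :: "circle \<Rightarrow> real" assume \<phi>: "continuous_on UNIV \<phi>"
  have [measurable]: "\<phi> \<in> borel_measurable borel" by (rule borel_measurable_continuous_onI[OF \<phi>])
  have \<phi>f: "continuous_on UNIV (\<lambda>x. \<phi> (f x))"
    by (rule continuous_on_compose2[OF \<phi> continuous_f]) simp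
  have "bounded (\<phi> ` UNIV)" by (rule compact_imp_bounded[OF compact_continuous_image[OF \<phi> compact_UNIV_circle]])
  then obtain C where C: "\<And>x. \<bar>\<phi> x\<bar> \<le> C" unfolding bounded_iff by auto
  have C0: "C \<ge> 0" using C[of 0] by linarith
  have uc: "uniformly_continuous_on UNIV \<phi>" by (rule compact_uniformly_continuous[OF \<phi> compact_UNIV_circle])
  have "\<bar>(\<integral>x. \<phi> (f x) \<partial>\<mu>\<^sub>0) - (\<integral>x. \<phi> x \<partial>\<mu>\<^sub>0)\<bar> \<le> (3 + 2 * C) * \<tau>" if \<tau>: "\<tau> > 0" for \<tau>
  proof -
    obtain d where d: "d > 0" "\<And>a b. dist a b < d \<Longrightarrow> dist (\<phi> a) (\<phi> b) < \<tau>"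
      by (rule uniformly_continuous_onE[OF uc \<tau>]) auto
    obtain \<epsilon> S where \<epsilon>: "\<epsilon> > 0" "stationary_measure f \<zeta> \<epsilon> (\<mu> \<epsilon>)"
      "\<And>\<psi>. \<psi> \<in> {\<phi>, \<lambda>x. \<phi> (f x)} \<Longrightarrow> \<bar>(\<integral>x. \<psi> x \<partial>\<mu> \<epsilon>) - (\<integral>x. \<psi> x \<partial>\<mu>\<^sub>0)\<bar> < min d \<tau>"
      "S \<in> sets borel" "\<And>x y. x \<notin> S \<Longrightarrow> dist y (f x) \<le> \<epsilon> * \<zeta> x \<Longrightarrow> dist y (f x) < min d \<tau>"
      "measure (\<mu> \<epsilon>) S \<le> min d \<tau>"
      "\<And>B. B \<in> sets borel \<Longrightarrow> measure (\<mu> \<epsilon>) B \<le> 128 * K * measure \<nu> (thicken (min d \<tau>) B)"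
    proof (rule accumulate[of "{\<phi>, \<lambda>x. \<phi> (f x)}" "min d \<tau>"])
      show "continuous_on UNIV \<psi>" if "\<psi> \<in> {\<phi>, \<lambda>x. \<phi> (f x)}" for \<psi> using that \<phi> \<phi>f by auto
      show "0 < min d \<tau>" using d(1) \<tau> by simp
    qed (simp, rule that)
    have close: "\<bar>\<phi> a - \<phi> b\<bar> \<le> \<tau>" if "dist a b < min d \<tau>" for a b
      using d(2)[of a b] that by (simp add: dist_real_def)
    have "min d \<tau> > 0" using d(1) \<tau> by simp
    then have "\<bar>(\<integral>x. \<phi> x \<partial>\<mu> \<epsilon>) - (\<integral>x. \<phi> (f x) \<partial>\<mu> \<epsilon>)\<bar> \<le> \<tau> + 2 * C * min d \<tau>"
      by (rule stationary_almost_invariant[OF \<phi> C _ close \<epsilon>(1,2,4,6,5)])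
    moreover have "2 * C * min d \<tau> \<le> 2 * C * \<tau>" using C0 by (intro mult_left_mono) auto
    moreover have "\<bar>(\<integral>x. \<phi> x \<partial>\<mu> \<epsilon>) - (\<integral>x. \<phi> x \<partial>\<mu>\<^sub>0)\<bar> < \<tau>"
      by (rule order.strict_trans2[OF \<epsilon>(3)]) simp_all
    moreover have "\<bar>(\<integral>x. \<phi> (f x) \<partial>\<mu> \<epsilon>) - (\<integral>x. \<phi> (f x) \<partial>\<mu>\<^sub>0)\<bar> < \<tau>"
      by (rule order.strict_trans2[OF \<epsilon>(3)]) simp_all
    moreover have "(3 + 2 * C) * \<tau> = 3 * \<tau> + 2 * C * \<tau>" by (rule distrib_right)
    ultimately show ?thesis by linarith
  qed
  then have "\<bar>(\<integral>x. \<phi> (f x) \<partial>\<mu>\<^sub>0) - (\<integral>x. \<phi> x \<partial>\<mu>\<^sub>0)\<bar> / (3 + 2 * C) \<le> \<tau>" if "\<tau> > 0" for \<tau>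
    using that C0 by (simp add: pos_divide_le_eq mult.commute)
  then have "\<bar>(\<integral>x. \<phi> (f x) \<partial>\<mu>\<^sub>0) - (\<integral>x. \<phi> x \<partial>\<mu>\<^sub>0)\<bar> / (3 + 2 * C) \<le> 0" by (rule field_le_epsilon[of _ 0, simplified])
  then have "(\<integral>x. \<phi> (f x) \<partial>\<mu>\<^sub>0) = (\<integral>x. \<phi> x \<partial>\<mu>\<^sub>0)" using C0 by (simp add: divide_le_0_iff)
  then show "(\<integral>x. \<phi> x \<partial>distr \<mu>\<^sub>0 borel f) = (\<integral>x. \<phi> x \<partial>\<mu>\<^sub>0)" 
    by (subst integral_distr) (simp_all only: measurable_cong_sets[OF limit_sets refl] f_borel \<open>\<phi> \<in> borel_measurable borel\<close>)
qed simp_all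

text \<open>The limit is itself an ergodic absolutely continuous invariant measure, and by
  uniqueness the only one, so it carries the weight 1.\<close>

lemma limit_physical: "convex_combination_of_physical f \<mu>\<^sub>0"
proof -
  have prob: "circle_prob \<mu>\<^sub>0" using limit_prob by (simp add: circle_prob_def)
  have "physical_measures f = {\<mu>\<^sub>0}"
  proof
    show "{\<mu>\<^sub>0} \<subseteq> physical_measures f"
      using prob limit_invariant limit_ac ac_ergodic[OF prob limit_ac] by (simp add: physical_measures_def)
    show "physical_measures f \<subseteq> {\<mu>\<^sub>0}"
    proof
      fix \<mu>' assume "\<mu>' \<in> physical_measures f"
      then have "circle_prob \<mu>'" "invariant_measure f \<mu>'" "absolutely_continuous circle_lebesgue \<mu>'"
        by (simp_all add: physical_measures_def)
      then show "\<mu>' \<in> {\<mu>\<^sub>0}" using acip_unique[OF _ prob _ limit_invariant _ limit_ac] by simp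
    qed
  qed
  then show ?thesis
    unfolding convex_combination_of_physical_def by (intro exI[of _ "\<lambda>_. 1"]) simp
qed

end

lemma stable: "stochastically_stable f \<zeta>"
  unfolding stochastically_stable_def
proof (intro allI impI)
  fix \<mu> \<mu>\<^sub>0
  assume "(\<forall>\<^sub>F \<epsilon> in at_right 0. stationary_measure f \<zeta> \<epsilon> (\<mu> \<epsilon>)) \<and> weak_star_accumulation_point \<mu> \<mu>\<^sub>0"
  then show "convex_combination_of_physical f \<mu>\<^sub>0" by (intro limit_physical[of \<mu>]) simp_all
qed

end

section \<open>Stochastic stability\<close>

context hyperbolic_lift
begin

text \<open>The tail indicators vanish from \<open>i = h\<close> on, so their sum is at most
  \<open>h\<close>, and \<open>h \<le> h powr p\<close> as \<open>h \<ge> 1\<close>. Exchanging sum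
  and integral bounds the sum of the tails.\<close>

lemma summable_tail_if_integrable:
  assumes ae: "AE x in circle_lebesgue. \<exists>n. x \<in> H n" and p: "p \<ge> 1"
    and int: "(\<integral>\<^sup>+ x. ennreal (real (first_hyperbolic_time f \<beta> \<sigma> \<delta> x) powr p) \<partial>circle_lebesgue) < \<infinity>"
  shows "(\<Sum>i. emeasure circle_lebesgue {x. \<forall>n\<le>i. x \<notin> H n}) < \<infinity>"
proof -
  let ?T = "\<lambda>i. {x. \<forall>n\<le>i. x \<notin> H n}" and ?h = "first_hyperbolic_time f \<beta> \<sigma> \<delta>"
  have T: "?T i \<in> sets borel" for i
  proof -
    have "?T i = - (\<Union>n\<le>i. H n)" by auto
    then show ?thesis by simp
  qed
  have "(\<Sum>i. emeasure circle_lebesgue (?T i)) = (\<Sum>i. \<integral>\<^sup>+x. indicator (?T i) x \<partial>circle_lebesgue)"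
    by (simp only: nn_integral_indicator sets_circle_lebesgue T)
  also have "\<dots> = (\<integral>\<^sup>+x. (\<Sum>i. indicator (?T i) x) \<partial>circle_lebesgue)"
    by (rule nn_integral_suminf[symmetric]) (simp add: T)
  also have "\<dots> \<le> (\<integral>\<^sup>+ x. ennreal (real (?h x) powr p) \<partial>circle_lebesgue)"
  proof (rule nn_integral_mono_AE)
    show "AE x in circle_lebesgue. (\<Sum>i. indicator (?T i) x) \<le> ennreal (real (?h x) powr p)"
      using ae
    proof eventually_elim
      case (elim x)
      then have h: "hyperbolic_time f \<beta> \<sigma> \<delta> x (?h x)"
        unfolding H_def first_hyperbolic_time_def mem_Collect_eq by (rule LeastI_ex)
      then have h1: "?h x \<ge> 1" by (simp add: hyperbolic_time_def)
      have out: "indicator (?T i) x = (0 :: ennreal)" if "i \<notin> {..<?h x}" for i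
        using h that by (auto simp: H_def indicator_def intro!: exI[of _ "?h x"])
      have "(\<Sum>i. indicator (?T i) x :: ennreal) = (\<Sum>i<?h x. indicator (?T i) x)"
        by (rule suminf_finite) (use out in auto)
      also have "\<dots> \<le> (\<Sum>i<?h x. 1)" by (intro sum_mono) (auto split: split_indicator)
      also have "\<dots> = ennreal (real (?h x) powr 1)" by (simp add: ennreal_of_nat_eq_real_of_nat)
      also have "\<dots> \<le> ennreal (real (?h x) powr p)" using h1 p by (intro ennreal_leI powr_mono) auto
      finally show ?case .
    qed
  qed
  finally show ?thesis using int by (rule order.strict_trans1)
qed

end

context expanding_lift
begin

lemma transitive: "has_dense_orbit f \<Longrightarrow> transitive_circle_map f"
proof
  assume "has_dense_orbit f"
  then show "has_dense_orbit f" .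
qed (use continuous_f null_vimage_f[OF _ _ null_critical] forward_invariant_contains_arc in blast)+

lemma ex_noise:
  assumes "has_dense_orbit f"
  shows "\<exists>\<zeta> :: circle \<Rightarrow> real. \<zeta> \<in> borel_measurable borel \<and> (\<forall>x. \<zeta> x > 0) \<and>
      (AE x in circle_lebesgue. locally_constant_at \<zeta> x) \<and> stochastically_stable f \<zeta>"
proof -
  obtain \<nu> where \<nu>: "finite_measure \<nu>" "sets \<nu> = sets borel" "absolutely_continuous circle_lebesgue \<nu>"
    "\<And>j A. A \<in> sets borel \<Longrightarrow> emeasure circle_lebesgue ((f ^^ j) -` A) \<le> emeasure \<nu> A"
    using ex_dominating_measure by (elim exE conjE) (rule that, assumption+, blast)
  interpret d: dominated_circle_map f \<nu>
    by (intro dominated_circle_map.intro transitive assms dominated_circle_map_axioms.intro \<nu>)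
  obtain R n e e' \<eta> \<delta>' where "noisy_tower f \<nu> R n e e' \<eta> \<delta>'"
  proof (rule d.refined_tower, goal_cases)
    case (1 R n e e' \<eta> \<delta>')
    show ?case
      by (rule 1(1), intro noisy_tower.intro noisy_tower_axioms.intro d.dominated_circle_map_axioms) (rule 1(2-); assumption)+
  qed
  then interpret t: noisy_tower f \<nu> R n e e' \<eta> \<delta>' .
  show ?thesis using t.\<zeta>_borel t.\<zeta>_pos t.AE_locally_constant t.stable by blast
qed

end

theorem theorem1:
  fixes f :: "circle \<Rightarrow> circle" and B \<beta> \<sigma> \<delta> p :: real
  assumes "C2_local_diffeomorphism_on (- critical_set f) f"
    and "nondegenerate_critical_set f B \<beta>"
    and "nonuniformly_expanding f"
    and "slow_recurrence f"
    and "has_dense_orbit f"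
    and "0 < \<sigma>" "\<sigma> < 1" "0 < \<delta>" "\<delta> < 1"
    and "AE x in circle_lebesgue. \<exists>n. hyperbolic_time f \<beta> \<sigma> \<delta> x n"
    and "p > 3"
    and "(\<integral>\<^sup>+ x. ennreal (real (first_hyperbolic_time f \<beta> \<sigma> \<delta> x) powr p) \<partial>circle_lebesgue) < \<infinity>"
  shows "\<exists>\<zeta> :: circle \<Rightarrow> real.
      \<zeta> \<in> borel_measurable borel \<and>
      (\<forall>x. \<zeta> x > 0) \<and>
      (AE x in circle_lebesgue. locally_constant_at \<zeta> x) \<and>
      stochastically_stable f \<zeta>"
proof -
  \<comment> \<open>Noncritical points have open neighbourhoods of differentiability off the
    critical set, and at critical points the derivative exists by definition. So \<open>f\<close> is
    differentiable everywhere and the critical set is closed.\<close>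
  have diff: "\<exists>U. open U \<and> x \<in> U \<and> U \<subseteq> - critical_set f \<and> (\<exists>D. \<forall>y\<in>U. has_circle_deriv f (D y) y)"
    if "x \<notin> critical_set f" for x
  proof -
    obtain U where U: "U \<subseteq> - critical_set f" "x \<in> U" "C2_diffeomorphism_on U f"
      using assms(1) \<open>x \<notin> critical_set f\<close> unfolding C2_local_diffeomorphism_on_def by blast
    then have "open U" "C2_on U f" by (auto simp: C2_diffeomorphism_on_def)
    moreover obtain D where "\<forall>y\<in>U. has_circle_deriv f (D y) y"
      using \<open>C2_on U f\<close> unfolding C2_on_def by blast
    ultimately show ?thesis using U by blast
  qed
  interpret hyperbolic_circle_map f B \<beta> \<sigma> \<delta>
  proof
    show "has_circle_deriv f (circle_deriv f x) x" for x
    proof -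
      have "\<exists>D. has_circle_deriv f D x"
      proof (cases "x \<in> critical_set f")
        case True
        then show ?thesis by (auto simp: critical_set_def)
      next
        case False
        then show ?thesis using diff by blast
      qed
      then show ?thesis using has_circle_deriv_imp_circle_deriv by metis
    qed
    have "open (- critical_set f)"
    proof (subst open_subopen, intro ballI)
      fix x assume "x \<in> - critical_set f"
      then show "\<exists>T. open T \<and> x \<in> T \<and> T \<subseteq> - critical_set f" using diff[of x] by blast
    qed
    then show "closed (critical_set f)" by (simp add: closed_def)
  qed (use assms in auto)
  obtain F where F: "continuous_on UNIV F" "\<And>t. to_circle (F t) = f (to_circle t)"
    by (rule ex_circle_lift[OF continuous_f], rule that)
  interpret hyperbolic_lift f B \<beta> \<sigma> \<delta> F by unfold_locales (fact F)+
  have ae: "AE x in circle_lebesgue. \<exists>n. x \<in> H n" using assms(10) by (simp add: H_def)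
  interpret expanding_lift f B \<beta> \<sigma> \<delta> F
    by unfold_locales (use ae summable_tail_if_integrable[OF ae _ assms(12)] assms(11) in auto)
  show ?thesis by (rule ex_noise[OF assms(5)])
qed

end
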